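(* There exists a set of seven polygons composed from sixteen identical isosceles right triangles (with side lengths $1,1,\sqrt2$) that can form nineteen pairwise non-congruent convex polygons. Furthermore, no set of seven polygons composed from sixteen identical isosceles right triangles with side lengths $1,1,\sqrt2$ can form $20$ pairwise non-congruent convex polygons.
   Context: Let $T$ denote an isosceles right triangle with side lengths $1$, $1$, $\sqrt2$. A set of $k$ polygons is "composed from sixteen identical isosceles right triangles" if each polygon in the set is a union of copies of $T$ glued along edges (with pairwise disjoint interiors), and the total number of copies of $T$ used over all $k$ polygons is sixteen. A set of polygons $S$ can "form" a polygon $P$ if there is a partition of $P$ into internally disjoint polygons together with a bijection $f$ from the parts of this partition to the polygons of $S$ such that each part $x$ is congruent to $f(x)$ (rotations and reflections allowed, no scaling); that is, the pieces of $S$ can be placed in the plane, internally disjoint, with union exactly $P$. Convex polygons are counted up to congruence (rotation, reflection and translation). *)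

theory Defs
  imports "HOL-Analysis.Analysis"
begin

text \<open>The plane is modelled as the complex numbers.  An isometry of the plane is a
  distance-preserving map (these are exactly the rigid motions, reflections allowed).\<close>

definition plane_isometry :: "(complex \<Rightarrow> complex) \<Rightarrow> bool" where
  "plane_isometry f \<longleftrightarrow> (\<forall>x y. dist (f x) (f y) = dist x y)"

definition congruent :: "complex set \<Rightarrow> complex set \<Rightarrow> bool" where
  "congruent A B \<longleftrightarrow> (\<exists>f. plane_isometry f \<and> f ` A = B)"

text \<open>The standard isosceles right triangle with legs 1, 1 and hypotenuse sqrt 2.\<close>

definition T0 :: "complex set" where
  "T0 = convex hull {0, 1, \<i>}"

definition T0_edges :: "complex set set" where
  "T0_edges = {closed_segment 0 1, closed_segment 0 \<i>, closed_segment 1 \<i>}"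

text \<open>Two copies of T are glued if they have a full common edge.\<close>

definition glued :: "complex set \<Rightarrow> complex set \<Rightarrow> bool" where
  "glued s t \<longleftrightarrow> (\<exists>f g. plane_isometry f \<and> plane_isometry g \<and> s = f ` T0 \<and> t = g ` T0 \<and>
      (\<exists>e\<in>T0_edges. \<exists>e'\<in>T0_edges. f ` e = g ` e'))"

text \<open>P is a polygon composed of n copies of T glued along edges, with pairwise
  disjoint interiors.\<close>

definition composed_of :: "nat \<Rightarrow> complex set \<Rightarrow> bool" where
  "composed_of n P \<longleftrightarrow> (\<exists>Ts. finite Ts \<and> Ts \<noteq> {} \<and> card Ts = n \<and>
      (\<forall>t\<in>Ts. congruent T0 t) \<and>
      (\<forall>s\<in>Ts. \<forall>t\<in>Ts. s \<noteq> t \<longrightarrow> interior s \<inter> interior t = {}) \<and>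
      \<Union>Ts = P \<and>
      (\<forall>s\<in>Ts. \<forall>t\<in>Ts. (s, t) \<in> {(a, b). a \<in> Ts \<and> b \<in> Ts \<and> glued a b}\<^sup>*))"

text \<open>A family of k polygons (indexed by i < k) composed from sixteen copies of T in total.\<close>

definition composed_from_sixteen :: "nat \<Rightarrow> (nat \<Rightarrow> complex set) \<Rightarrow> bool" where
  "composed_from_sixteen k S \<longleftrightarrow>
     (\<exists>n :: nat \<Rightarrow> nat. (\<forall>i<k. composed_of (n i) (S i)) \<and> (\<Sum>i<k. n i) = 16)"

text \<open>The family S (indexed by i < k) can form the polygon P.\<close>

definition can_form :: "nat \<Rightarrow> (nat \<Rightarrow> complex set) \<Rightarrow> complex set \<Rightarrow> bool" where
  "can_form k S P \<longleftrightarrow> (\<exists>g :: nat \<Rightarrow> complex \<Rightarrow> complex.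
      (\<forall>i<k. plane_isometry (g i)) \<and>
      (\<forall>i<k. \<forall>j<k. i \<noteq> j \<longrightarrow> interior (g i ` S i) \<inter> interior (g j ` S j) = {}) \<and>
      (\<Union>i<k. g i ` S i) = P)"

text \<open>S can form m pairwise non-congruent convex polygons.\<close>

definition forms_convex :: "nat \<Rightarrow> (nat \<Rightarrow> complex set) \<Rightarrow> nat \<Rightarrow> bool" where
  "forms_convex k S m \<longleftrightarrow> (\<exists>Q :: nat \<Rightarrow> complex set.
      (\<forall>j<m. convex (Q j) \<and> can_form k S (Q j)) \<and>
      (\<forall>i<m. \<forall>j<m. i \<noteq> j \<longrightarrow> \<not> congruent (Q i) (Q j)))"

end

theory Submission
  imports Defs
begin

text \<open>
  Upper bound.  In a tiling of a convex region all tiles have the same direction modulo 45 degrees: the interior of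
  the region minus the finitely many tile vertices is connected, and at each of its points the tiles that meet share an
  edge line.  So the region is a rectangle with four isosceles right corners cut off.  Each side is a sum of
  tile sides, hence has length \<open>m + n * sqrt 2\<close> with natural \<open>m\<close>, \<open>n\<close>; the area is 8, and the vanishing of the coefficient
  of \<open>sqrt 2\<close> in it forces the corner data to be integral after at most one rotation by 45 degrees.  A finite
  enumeration leaves 20 shapes.  Among them are the 1 by 8 rectangle, in which every tile has a leg on the
  boundary, and the parallelogram with sides 1 and \<open>8 * sqrt 2\<close>, in which every tile has its hypotenuse on the
  boundary.  If one set of pieces forms both, each tile has only one edge left for gluing, so each piece
  has at most two tiles, and seven pieces have at most 14.

  Lower bound.  Explicit lattice placements of seven pieces lie in the other 19 shapes without overlap, and a comparison
  of areas shows that they fill them.  The sum of the fourth powers of the distances between vertices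
  separates the 19 shapes.
\<close>

section \<open>Isometries and tiles\<close>

text \<open>A tiling need not be edge to edge: tiles may slide along each other by arbitrary real
  amounts, so no lattice is available for the tiles themselves, and only the outline of the region
  can be made integral. Directions modulo 45 degrees are compared through the eighth power of a unit
  complex number. The outline is recovered from its support values in the eight directions with
  \<open>n ^ 8 = 1\<close>, because a boundary point that is no tile vertex inherits its supporting
  line from a tile edge. The obstacle is a side that mixes legs and hypotenuses: lengths alone
  permit it, and it takes the area equation, used as an equality case of a mixed area bound, to
  exclude it. A glued edge is followed from one arrangement to another by its midpoint: this is an
  interior point of the piece, whereas an edge on the outline has its midpoint on the boundary of
  the region. The number 20 enters by pigeonhole: twenty pairwise non-congruent regions exhaust the
  list of shapes, both thin ones included.\<close>

lemma T0_eq: "T0 = {w. 0 \<le> Re w \<and> 0 \<le> Im w \<and> Re w + Im w \<le> 1}"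
proof -
  have "w \<in> T0 \<longleftrightarrow> 0 \<le> Re w \<and> 0 \<le> Im w \<and> Re w + Im w \<le> 1" for w
  proof
    assume "w \<in> T0"
    then show "0 \<le> Re w \<and> 0 \<le> Im w \<and> Re w + Im w \<le> 1"
      unfolding T0_def convex_hull_3 by (auto simp: scaleR_conv_of_real)
  next
    assume *: "0 \<le> Re w \<and> 0 \<le> Im w \<and> Re w + Im w \<le> 1"
    have "w = (1 - Re w - Im w) *\<^sub>R 0 + Re w *\<^sub>R 1 + Im w *\<^sub>R \<i>"
      by (simp add: complex_eq_iff)
    then show "w \<in> T0" unfolding T0_def convex_hull_3 mem_Collect_eq using *
      by (intro exI[of _ "1 - Re w - Im w"] exI[of _ "Re w"] exI[of _ "Im w"]) auto
  qed
  then show ?thesis by blast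
qed

section \<open>Plane isometries as rotations and reflections followed by translations\<close>

lemma plane_isometry_inj: "plane_isometry f \<Longrightarrow> inj f"
  unfolding plane_isometry_def by (metis dist_eq_0_iff injI)

lemma plane_isometry_comp:
  "plane_isometry f \<Longrightarrow> plane_isometry g \<Longrightarrow> plane_isometry (f \<circ> g)"
  by (simp add: plane_isometry_def)

lemma plane_isometry_rot: "cmod c = 1 \<Longrightarrow> plane_isometry (\<lambda>z. v + c * z)"
  by (simp add: plane_isometry_def dist_norm norm_mult flip: right_diff_distrib)

lemma plane_isometry_refl: "cmod c = 1 \<Longrightarrow> plane_isometry (\<lambda>z. v + c * cnj z)"
proof -
  assume "cmod c = 1"
  then have "cmod (c * cnj x - c * cnj y) = cmod (x - y)" for x y
    by (metis complex_cnj_diff complex_mod_cnj mult_1 norm_mult right_diff_distrib)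
  then show ?thesis by (simp add: plane_isometry_def dist_norm)
qed

text \<open>A normalisation yields a map \<open>h\<close> that fixes \<open>0\<close> and
  \<open>1\<close>. Squared distances to these two points determine the real part, so
  \<open>h\<close> preserves real parts and then products of imaginary parts; the sign of
  \<open>Im (h \<i>)\<close> decides between identity and conjugation.\<close>

lemma plane_isometry_cases:
  assumes "plane_isometry f"
  obtains v c where "cmod c = 1" "f = (\<lambda>z. v + c * z)"
    | v c where "cmod c = 1" "f = (\<lambda>z. v + c * cnj z)"
proof -
  define c where "c = f 1 - f 0"
  have iso: "cmod (f x - f y) = cmod (x - y)" for x y
    using assms by (simp add: plane_isometry_def dist_norm)
  have c: "cmod c = 1" using iso[of 1 0] by (simp add: c_def)
  then have cc: "c * cnj c = 1" by (simp flip: complex_norm_square)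
  define h where "h z = cnj c * (f z - f 0)" for z
  have fh: "f z = f 0 + c * h z" for z
    using cc by (simp add: h_def flip: mult.assoc)
  have hd: "cmod (h x - h y) = cmod (x - y)" for x y
  proof -
    have "cmod (h x - h y) = cmod (cnj c * (f x - f y))"
      by (simp add: h_def algebra_simps)
    then show ?thesis using c iso by (simp add: norm_mult)
  qed
  have h0: "h 0 = 0" and h1: "h 1 = 1" using cc by (simp_all add: h_def c_def mult.commute)
  have sq: "(Re (h x) - Re (h y))\<^sup>2 + (Im (h x) - Im (h y))\<^sup>2 = (Re x - Re y)\<^sup>2 + (Im x - Im y)\<^sup>2" for x y
    using arg_cong[OF hd[of x y], of "\<lambda>t. t\<^sup>2"] by (simp add: cmod_power2)
  have re: "Re (h z) = Re z" for z
    using sq[of z 0] sq[of z 1] by (simp add: h0 h1 power2_eq_square algebra_simps)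
  have im: "Im (h z) * Im (h w) = Im z * Im w" for z w
    using sq[of z w] sq[of z 0] sq[of w 0] by (simp add: h0 re power2_eq_square algebra_simps)
  have "Im (h \<i>) = 1 \<or> Im (h \<i>) = -1"
    using im[of \<i> \<i>] by (simp add: square_eq_1_iff)
  then show thesis
  proof
    assume "Im (h \<i>) = 1"
    then have "h z = z" for z using im[of z \<i>] re[of z] by (simp add: complex_eq_iff)
    with fh have "f = (\<lambda>z. f 0 + c * z)" by (intro ext) metis
    then show thesis using c that(1) by blast
  next
    assume "Im (h \<i>) = -1"
    then have "h z = cnj z" for z using im[of z \<i>] re[of z] by (simp add: complex_eq_iff)
    with fh have "f = (\<lambda>z. f 0 + c * cnj z)" by (intro ext) metis
    then show thesis using c that(2) by blast
  qed
qed

lemma congruent_refl: "congruent A A"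
  unfolding congruent_def by (rule exI[of _ id]) (simp add: plane_isometry_def)

lemma congruent_trans: "congruent A B \<Longrightarrow> congruent B C \<Longrightarrow> congruent A C"
proof -
  assume "congruent A B" "congruent B C"
  then obtain f g where "plane_isometry f" "f ` A = B" "plane_isometry g" "g ` B = C"
    by (auto simp: congruent_def)
  then have "plane_isometry (g \<circ> f)" "(g \<circ> f) ` A = C"
    by (auto intro: plane_isometry_comp)
  then show ?thesis by (auto simp: congruent_def)
qed

lemma plane_isometry_inverse:
  assumes "plane_isometry f"
  obtains g where "plane_isometry g" "\<And>z. g (f z) = z" "\<And>z. f (g z) = z"
  using assms
proof (cases rule: plane_isometry_cases)
  case (1 v c)
  then have cc: "cnj c * c = 1" "c * cnj c = 1" by (simp_all add: mult.commute flip: complex_norm_square)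
  show ?thesis
  proof (rule that[of "\<lambda>z. - (cnj c * v) + cnj c * z"])
    show "plane_isometry (\<lambda>z. - (cnj c * v) + cnj c * z)"
      using 1 by (intro plane_isometry_rot) auto
  qed (simp_all add: 1(2) distrib_left right_diff_distrib cc flip: mult.assoc)
next
  case (2 v c)
  then have cc: "c * cnj c = 1" by (simp flip: complex_norm_square)
  show ?thesis
  proof (rule that[of "\<lambda>z. - (c * cnj v) + c * cnj z"])
    show "plane_isometry (\<lambda>z. - (c * cnj v) + c * cnj z)"
      using 2 by (intro plane_isometry_refl) auto
  qed (simp_all add: 2(2) distrib_left right_diff_distrib cc flip: mult.assoc)
qed

lemma congruent_sym: "congruent A B \<Longrightarrow> congruent B A"
proof -
  assume "congruent A B"
  then obtain f where f: "plane_isometry f" "f ` A = B" by (auto simp: congruent_def)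
  then obtain g where g: "plane_isometry g" "\<And>z. g (f z) = z" by (metis plane_isometry_inverse)
  have "g ` B = A" unfolding f(2)[symmetric] image_image g(2) by simp
  then show ?thesis using g by (auto simp: congruent_def)
qed

lemma plane_isometry_continuous: "plane_isometry f \<Longrightarrow> continuous_on A f"
  by (auto simp: plane_isometry_def continuous_on_iff)

lemma interior_isometry_image:
  assumes "plane_isometry f"
  shows "interior (f ` A) = f ` interior A"
proof -
  obtain g where g: "plane_isometry g" "\<And>z. g (f z) = z" "\<And>z. f (g z) = z"
    using plane_isometry_inverse[OF assms] by metis
  have img: "f ` B = g -` B" for B
  proof
    show "f ` B \<subseteq> g -` B" using g(2) by auto
    show "g -` B \<subseteq> f ` B"
    proof
      fix z assume "z \<in> g -` B"
      then show "z \<in> f ` B" by (intro image_eqI[of _ _ "g z"]) (simp_all add: g(3))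
    qed
  qed
  have "open (f ` interior A)" unfolding img
    by (intro open_vimage open_interior plane_isometry_continuous g)
  then have 1: "f ` interior A \<subseteq> interior (f ` A)"
    by (intro interior_maximal image_mono interior_subset)
  have "open (f -` interior (f ` A))"
    by (intro open_vimage open_interior plane_isometry_continuous assms)
  moreover have "f -` interior (f ` A) \<subseteq> A"
    using interior_subset[of "f ` A"] by (auto simp: img) (metis g(2) subsetD vimageE)
  ultimately have "f -` interior (f ` A) \<subseteq> interior A" by (intro interior_maximal)
  then have "interior (f ` A) \<subseteq> f ` interior A" unfolding img using g(3) by (metis subsetI subsetD vimageI vimage_eq)
  with 1 show ?thesis by blast
qed

text \<open>Betweenness is an equality of distances, hence invariant under isometries.\<close>

lemma isometry_segment:
  assumes "plane_isometry f"
  shows "f ` closed_segment a b = closed_segment (f a) (f b)"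
proof -
  obtain g where g: "\<And>z. f (g z) = z" using plane_isometry_inverse[OF assms] by metis
  have "f z \<in> closed_segment (f a) (f b) \<longleftrightarrow> z \<in> closed_segment a b" for z
    using assms by (simp add: between_mem_segment[symmetric] between plane_isometry_def)
  then show ?thesis using g by (auto simp: image_iff) metis
qed

lemma convex_isometry_image:
  assumes "plane_isometry f" "convex A"
  shows "convex (f ` A)"
  using assms(2) unfolding convex_contains_segment
  by (auto simp: isometry_segment[OF assms(1), symmetric])

text \<open>The right angle is at \<open>v\<close> and the legs are \<open>c\<close> and
  \<open>\<i> * c\<close>. Since \<open>c\<close> may have any modulus, the same definition
  describes the cut corners of a rectangle.\<close>

definition tile :: "complex \<Rightarrow> complex \<Rightarrow> complex set" where
  "tile v c = (\<lambda>w. v + c * w) ` T0"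

text \<open>This is the reflection in the symmetry axis of \<open>T0\<close>. Because of it every
  reflected copy is also a rotated copy, and tiles are described by \<open>v\<close> and
  \<open>c\<close> alone.\<close>

lemma T0_swap: "(\<lambda>w. \<i> * cnj w) ` T0 = T0"
proof -
  have "z \<in> T0 \<Longrightarrow> \<i> * cnj z \<in> T0" for z by (auto simp: T0_eq)
  moreover have "z = \<i> * cnj (\<i> * cnj z)" for z by (simp add: complex_eq_iff)
  ultimately show ?thesis by (intro set_eqI iffI) (blast intro: image_eqI | force)+
qed

text \<open>A reflection is turned into a rotation by \<open>T0_swap\<close>, at the price of
  exchanging the images of \<open>1\<close> and \<open>\<i>\<close>; hence the disjunction. The last
  formula serves to locate the edge midpoints.\<close>

lemma isometry_T0:
  assumes "plane_isometry f"
  obtains c where "cmod c = 1" "f ` T0 = tile (f 0) c" 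
    "f 1 = f 0 + c \<and> f \<i> = f 0 + \<i> * c \<or> f 1 = f 0 + \<i> * c \<and> f \<i> = f 0 + c"
    "\<And>r s. f (Complex r s) = f 0 + of_real r * (f 1 - f 0) + of_real s * (f \<i> - f 0)"
  using assms
proof (cases rule: plane_isometry_cases)
  case (1 v c)
  show ?thesis
    by (rule that[of c]) (simp_all add: 1 tile_def Complex_eq algebra_simps)
next
  case (2 v c)
  have "f ` T0 = (\<lambda>w. v + (- \<i> * c) * w) ` ((\<lambda>w. \<i> * cnj w) ` T0)"
    unfolding image_image 2(2) by (intro image_cong) (auto simp: algebra_simps)
  then have "f ` T0 = tile (f 0) (- \<i> * c)" unfolding T0_swap tile_def by (simp add: 2(2))
  then show ?thesis
    by (rule that[rotated]) (auto simp: 2 Complex_eq algebra_simps norm_mult)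
qed

lemma congruent_T0_tile: "congruent T0 t \<longleftrightarrow> (\<exists>v c. cmod c = 1 \<and> t = tile v c)"
proof
  assume "congruent T0 t"
  then obtain f where "plane_isometry f" "f ` T0 = t" by (auto simp: congruent_def)
  then show "\<exists>v c. cmod c = 1 \<and> t = tile v c" by (metis isometry_T0)
next
  assume "\<exists>v c. cmod c = 1 \<and> t = tile v c"
  then show "congruent T0 t" by (auto simp: congruent_def tile_def intro: plane_isometry_rot)
qed

lemma mem_tile: 
  assumes "cmod c = 1"
  shows "z \<in> tile v c \<longleftrightarrow> 0 \<le> c \<bullet> (z - v) \<and> 0 \<le> (\<i> * c) \<bullet> (z - v) \<and> (c + \<i> * c) \<bullet> (z - v) \<le> 1"
proof -
  have cc: "c * cnj c = 1" using assms by (simp flip: complex_norm_square)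
  define w where "w = cnj c * (z - v)"
  have z: "v + c * w = z" using cc by (simp add: w_def flip: mult.assoc)
  have "z \<in> tile v c \<longleftrightarrow> w \<in> T0"
  proof
    assume "z \<in> tile v c"
    then obtain u where u: "u \<in> T0" "z = v + c * u" by (auto simp: tile_def)
    have "w = cnj c * c * u" by (simp add: w_def u(2))
    then show "w \<in> T0" using cc u by (simp add: mult.commute)
  qed (use z in \<open>force simp: tile_def\<close>)
  moreover have "Re w = c \<bullet> (z - v)" "Im w = (\<i> * c) \<bullet> (z - v)"
    by (simp_all add: w_def inner_complex_def)
  ultimately show ?thesis by (simp add: T0_eq inner_add_left)
qed

lemma inner_ii_mult: "(\<i> * a) \<bullet> (\<i> * b) = a \<bullet> b" "a \<bullet> (\<i> * a) = 0" "(\<i> * a) \<bullet> a = 0" "(\<i> * a) \<bullet> b = - (a \<bullet> (\<i> * b))"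
  by (auto simp: inner_complex_def)

lemma unit_inner_self: "cmod c = 1 \<Longrightarrow> c \<bullet> c = 1"
  by (simp add: dot_square_norm)

lemma unit_expand:
  assumes "cmod c = 1"
  shows "of_real (c \<bullet> w) * c + of_real ((\<i> * c) \<bullet> w) * (\<i> * c) = w"
proof -
  have *: "Re c * Re c + Im c * Im c = 1"
    using unit_inner_self[OF assms] by (simp add: inner_complex_def)
  have "of_real (c \<bullet> w) * c + of_real ((\<i> * c) \<bullet> w) * (\<i> * c) = of_real (Re c * Re c + Im c * Im c) * w"
    by (simp add: complex_eq_iff inner_complex_def algebra_simps)
  then show ?thesis by (simp add: *)
qed

lemma tile_Int_halfspaces:
  assumes "cmod c = 1"
  shows "tile v c = {z. (-c) \<bullet> z \<le> - (c \<bullet> v)} \<inter> {z. (- \<i> * c) \<bullet> z \<le> - ((\<i> * c) \<bullet> v)}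
            \<inter> {z. (c + \<i> * c) \<bullet> z \<le> 1 + (c + \<i> * c) \<bullet> v}"
  by (auto simp: mem_tile[OF assms] inner_diff_right)

lemma compact_T0: "compact T0"
  unfolding T0_def by (simp add: compact_convex_hull)

lemma compact_tile: "compact (tile v c)"
  unfolding tile_def by (intro compact_continuous_image continuous_intros compact_T0)

lemma closed_tile: "closed (tile v c)"
  by (simp add: compact_tile compact_imp_closed)

lemma tile_conv_hull: "tile v c = convex hull {v, v + c, v + \<i> * c}"
proof -
  have "tile v c = (+) v ` ((\<lambda>w. c * w) ` (convex hull {0, 1, \<i>}))"
    by (simp add: tile_def T0_def image_image)
  also have "(\<lambda>w. c * w) ` (convex hull {0, 1, \<i>}) = convex hull ((\<lambda>w. c * w) ` {0, 1, \<i>})"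
    by (rule convex_hull_linear_image) (simp add: bounded_linear.linear bounded_linear_mult_right)
  finally show ?thesis by (simp add: convex_hull_translation[symmetric] mult.commute)
qed

lemma convex_tile: "convex (tile v c)"
  by (simp add: tile_conv_hull)

lemma tile_vertices: "v \<in> tile v c" "v + c \<in> tile v c" "v + \<i> * c \<in> tile v c"
  by (simp_all add: tile_conv_hull hull_inc)

lemma interior_tile:
  assumes "cmod c = 1"
  shows "z \<in> interior (tile v c) \<longleftrightarrow> 0 < c \<bullet> (z - v) \<and> 0 < (\<i> * c) \<bullet> (z - v) \<and> (c + \<i> * c) \<bullet> (z - v) < 1"
proof -
  have [simp]: "c \<noteq> 0" using assms by auto
  have "1 + \<i> \<noteq> 0" by (simp add: complex_eq_iff)
  then have [simp]: "c + \<i> * c \<noteq> 0" by (metis \<open>c \<noteq> 0\<close> distrib_right mult_1 mult_eq_0_iff)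
  show ?thesis
    unfolding tile_Int_halfspaces[OF assms] interior_Int
    by (subst interior_halfspace_le; simp)+ (auto simp: inner_diff_right)
qed

lemma interior_tile_nonempty:
  assumes "cmod c = 1"
  shows "interior (tile v c) \<noteq> {}"
proof -
  have "v + (c + \<i> * c) / 4 \<in> interior (tile v c)"
    unfolding interior_tile[OF assms]
    using unit_inner_self[OF assms]
    by (simp add: inner_complex_def field_simps)
  then show ?thesis by auto
qed

lemma closure_interior_tile:
  assumes "cmod c = 1"
  shows "closure (interior (tile v c)) = tile v c"
  using convex_closure_interior[OF convex_tile interior_tile_nonempty[OF assms]]
  by (simp add: closed_tile closure_closed)

section \<open>Points in the relative interior of a tile edge\<close>

text \<open>Near \<open>z\<close> the set \<open>t\<close> is a half plane with outward unit normal \<open>n\<close>.\<close>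

definition edge_pt :: "complex set \<Rightarrow> complex \<Rightarrow> complex \<Rightarrow> bool" where
  "edge_pt t n z \<longleftrightarrow> cmod n = 1 \<and> (\<exists>e>0. \<forall>w. dist w z < e \<longrightarrow> (w \<in> t \<longleftrightarrow> n \<bullet> (w - z) \<le> 0))"

lemma edge_ptI:
  assumes "cmod n = 1" "e > 0" "\<And>w. cmod w < e \<Longrightarrow> z + w \<in> t \<longleftrightarrow> n \<bullet> w \<le> 0"
  shows "edge_pt t n z"
  unfolding edge_pt_def using assms
  by (intro conjI exI[of _ e]) (auto simp: dist_norm dest: assms(3)[of "_ - z"])

lemma inner_le_unit: "cmod n = 1 \<Longrightarrow> \<bar>n \<bullet> w\<bar> \<le> cmod w"
  using Cauchy_Schwarz_ineq2[of n w] by simp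

text \<open>A move by less than \<open>min r ((1 - r) / 2)\<close> keeps the coordinate along the
  leg positive and the sum of both coordinates below \<open>1\<close>, so only the inequality of the
  leg itself remains.\<close>

lemma edge_pt_leg1:
  assumes c: "cmod c = 1" and r: "0 < r" "r < 1"
  shows "edge_pt (tile v c) (- \<i> * c) (v + of_real r * c)"
proof (rule edge_ptI[where e = "min r ((1 - r) / 2)"])
  fix w assume w: "cmod w < min r ((1 - r) / 2)"
  have "\<bar>c \<bullet> w\<bar> \<le> cmod w" "\<bar>(\<i> * c) \<bullet> w\<bar> \<le> cmod w"
    using c by (auto intro!: inner_le_unit simp: norm_mult)
  moreover have "c \<bullet> (of_real r * c + w) = r * (c \<bullet> c) + c \<bullet> w" "(\<i> * c) \<bullet> (of_real r * c + w) = (\<i> * c) \<bullet> w"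
    by (simp_all add: inner_complex_def algebra_simps)
  ultimately show "v + of_real r * c + w \<in> tile v c \<longleftrightarrow> (- \<i> * c) \<bullet> w \<le> 0"
    using w r unfolding mem_tile[OF c] unit_inner_self[OF c] by (simp add: inner_add_left add.assoc) linarith
qed (use c r in \<open>auto simp: norm_mult\<close>)

lemma edge_pt_leg2:
  assumes c: "cmod c = 1" and r: "0 < r" "r < 1"
  shows "edge_pt (tile v c) (- c) (v + of_real r * (\<i> * c))"
proof (rule edge_ptI[where e = "min r ((1 - r) / 2)"])
  fix w assume w: "cmod w < min r ((1 - r) / 2)"
  have "\<bar>c \<bullet> w\<bar> \<le> cmod w" "\<bar>(\<i> * c) \<bullet> w\<bar> \<le> cmod w"
    using c by (auto intro!: inner_le_unit simp: norm_mult)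
  moreover have "c \<bullet> (of_real r * (\<i> * c) + w) = c \<bullet> w" "(\<i> * c) \<bullet> (of_real r * (\<i> * c) + w) = r * (c \<bullet> c) + (\<i> * c) \<bullet> w"
    by (simp_all add: inner_complex_def algebra_simps)
  ultimately show "v + of_real r * (\<i> * c) + w \<in> tile v c \<longleftrightarrow> (- c) \<bullet> w \<le> 0"
    using w r unfolding mem_tile[OF c] unit_inner_self[OF c] by (simp add: inner_add_left add.assoc) linarith
qed (use c r in \<open>auto simp: norm_mult\<close>)

text \<open>Rotation by 45 degrees. For unit \<open>c\<close> it is the outward normal of the
  hypotenuse of \<open>tile v c\<close>, and \<open>hyp_dir 1\<close> is a primitive eighth root of
  unity.\<close>

definition hyp_dir :: "complex \<Rightarrow> complex" where
  "hyp_dir c = (c + \<i> * c) / of_real (sqrt 2)"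

lemma cmod_hyp_dir: "cmod (hyp_dir c) = cmod c"
proof -
  have "cmod (c + \<i> * c) = cmod c * cmod (1 + \<i>)" by (simp add: algebra_simps flip: norm_mult)
  moreover have "cmod (1 + \<i>) = sqrt 2" by (simp add: cmod_def)
  ultimately show ?thesis by (simp add: hyp_dir_def norm_divide)
qed

lemma inner_hyp_dir: "hyp_dir c \<bullet> w = (c \<bullet> w + (\<i> * c) \<bullet> w) / sqrt 2"
proof -
  have "hyp_dir c = (1 / sqrt 2) *\<^sub>R (c + \<i> * c)" by (simp add: hyp_dir_def scaleR_conv_of_real field_simps)
  then show ?thesis by (simp only: inner_scaleR_left inner_add_left) simp
qed

lemma edge_pt_hyp:
  assumes c: "cmod c = 1" and r: "0 < r" "r < 1"
  shows "edge_pt (tile v c) (hyp_dir c) (v + of_real r * c + of_real (1 - r) * (\<i> * c))"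
proof (rule edge_ptI[where e = "min r (1 - r)"])
  fix w assume w: "cmod w < min r (1 - r)"
  have "\<bar>c \<bullet> w\<bar> \<le> cmod w" "\<bar>(\<i> * c) \<bullet> w\<bar> \<le> cmod w"
    using c by (auto intro!: inner_le_unit simp: norm_mult)
  moreover have "c \<bullet> (of_real r * c + of_real (1 - r) * (\<i> * c) + w) = r * (c \<bullet> c) + c \<bullet> w" 
     "(\<i> * c) \<bullet> (of_real r * c + of_real (1 - r) * (\<i> * c) + w) = (1 - r) * (c \<bullet> c) + (\<i> * c) \<bullet> w"
    by (simp_all add: inner_complex_def algebra_simps)
  moreover have "hyp_dir c \<bullet> w \<le> 0 \<longleftrightarrow> c \<bullet> w + (\<i> * c) \<bullet> w \<le> 0"
    by (simp add: inner_hyp_dir divide_le_0_iff)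
  moreover have "v + of_real r * c + of_real (1 - r) * (\<i> * c) + w - v = of_real r * c + of_real (1 - r) * (\<i> * c) + w"
    by simp
  ultimately show "v + of_real r * c + of_real (1 - r) * (\<i> * c) + w \<in> tile v c \<longleftrightarrow> (hyp_dir c) \<bullet> w \<le> 0"
    using w r unfolding mem_tile[OF c] inner_add_left unit_inner_self[OF c] by (auto simp: add.assoc)
qed (use c r in \<open>auto simp: cmod_hyp_dir\<close>)

lemma tile_point_cases:
  assumes c: "cmod c = 1" and z: "z \<in> tile v c" "z \<notin> {v, v + c, v + \<i> * c}" "z \<notin> interior (tile v c)"
  obtains n where "n \<in> {- c, - \<i> * c, hyp_dir c}" "edge_pt (tile v c) n z"
proof -
  define x y where "x = c \<bullet> (z - v)" and "y = (\<i> * c) \<bullet> (z - v)"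
  have zz: "z = v + of_real x * c + of_real y * (\<i> * c)"
    using unit_expand[OF c, of "z - v"] by (simp add: x_def y_def algebra_simps)
  have xy: "0 \<le> x" "0 \<le> y" "x + y \<le> 1"
    using z(1) unfolding mem_tile[OF c] by (simp_all add: x_def y_def inner_add_left)
  have "x = 0 \<or> y = 0 \<or> x + y = 1"
    using z(3) xy unfolding interior_tile[OF c] inner_add_left x_def[symmetric] y_def[symmetric] by auto
  moreover have "x = 0 \<Longrightarrow> y \<noteq> 0 \<and> y \<noteq> 1" "y = 0 \<Longrightarrow> x \<noteq> 0 \<and> x \<noteq> 1"
    using z(2) unfolding zz by auto
  ultimately have "x = 0 \<and> 0 < y \<and> y < 1 \<or> y = 0 \<and> 0 < x \<and> x < 1 \<or> y = 1 - x \<and> 0 < x \<and> x < 1"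
    using xy by linarith
  then consider "x = 0" "0 < y" "y < 1" | "y = 0" "0 < x" "x < 1" | "y = 1 - x" "0 < x" "x < 1"
    by blast
  then show thesis
  proof cases
    case 1
    then show thesis using edge_pt_leg2[OF c 1(2,3), of v] that[of "- c"] by (simp add: zz)
  next
    case 2
    then show thesis using edge_pt_leg1[OF c 2(2,3), of v] that[of "- \<i> * c"] by (simp add: zz)
  next
    case 3
    then show thesis using edge_pt_hyp[OF c 3(2,3), of v] that[of "hyp_dir c"] by (simp add: zz)
  qed
qed

text \<open>The vector \<open>- (n + m)\<close> points into both half discs, because its inner
  product with \<open>n\<close> and with \<open>m\<close> is \<open>- (1 + n \<bullet> m)\<close>,
  which is negative unless \<open>m = - n\<close>.\<close>

lemma edge_pt_opposite:
  assumes "edge_pt s n z" "edge_pt t m z" "interior s \<inter> interior t = {}"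
  shows "m = - n"
proof (rule ccontr)
  assume ne: "m \<noteq> - n"
  from assms obtain e1 e2 where e: "e1 > 0" "e2 > 0" and
    s: "\<And>w. dist w z < e1 \<Longrightarrow> w \<in> s \<longleftrightarrow> n \<bullet> (w - z) \<le> 0" and
    t: "\<And>w. dist w z < e2 \<Longrightarrow> w \<in> t \<longleftrightarrow> m \<bullet> (w - z) \<le> 0" and nm: "cmod n = 1" "cmod m = 1"
    unfolding edge_pt_def by blast
  define U where "U = ball z (min e1 e2) \<inter> {w. n \<bullet> w < n \<bullet> z} \<inter> {w. m \<bullet> w < m \<bullet> z}"
  have "open U" unfolding U_def by (intro open_Int open_halfspace_lt open_ball)
  moreover have "U \<subseteq> s" "U \<subseteq> t" unfolding U_def using s t by (auto simp: dist_commute inner_diff_right)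
  ultimately have "U \<subseteq> interior s \<inter> interior t" by (simp add: interior_maximal)
  then have "U = {}" using assms(3) by simp
  \<comment> \<open>By \<open>cmod (n + m) \<le> 2\<close> the displacement is at most half of the
    smaller radius.\<close>
  define d where "d = min e1 e2 / 4"
  have d: "d > 0" using e by (simp add: d_def)
  have "(n + m) \<bullet> (n + m) > 0" using ne by (simp add: eq_neg_iff_add_eq_0 add.commute)
  then have nm0: "1 + n \<bullet> m > 0" 
    using unit_inner_self[OF nm(1)] unit_inner_self[OF nm(2)] by (simp add: inner_add inner_commute)
  have "cmod (n + m) \<le> 2" using norm_triangle_ineq[of n m] nm by simp
  then have "cmod (d *\<^sub>R (n + m)) \<le> d * 2" using d by (simp del: scaleR_right_distrib)
  also have "\<dots> < min e1 e2" using e by (auto simp: d_def)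
  finally have "z - d *\<^sub>R (n + m) \<in> ball z (min e1 e2)" by (simp add: dist_norm)
  moreover have "n \<bullet> (d *\<^sub>R (n + m)) = d * (1 + n \<bullet> m)" "m \<bullet> (d *\<^sub>R (n + m)) = d * (1 + n \<bullet> m)"
    using unit_inner_self[OF nm(1)] unit_inner_self[OF nm(2)] by (simp_all add: inner_add inner_commute algebra_simps)
  ultimately have "z - d *\<^sub>R (n + m) \<in> U"
    using nm0 d unfolding U_def by (simp add: inner_diff_right del: scaleR_right_distrib inner_scaleR_right)
  with \<open>U = {}\<close> show False by blast
qed

text \<open>Within the half disc one can move from \<open>z\<close> in the directions
  \<open>\<i> * n\<close>, \<open>- \<i> * n\<close> and \<open>- n\<close>. The first two force
  \<open>m\<close> to be a real multiple of \<open>n\<close>, the third fixes the sign.\<close>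

lemma edge_pt_normal_unique:
  assumes "edge_pt t n z" "cmod m = 1" "\<And>w. w \<in> t \<Longrightarrow> m \<bullet> (w - z) \<le> 0"
  shows "n = m"
proof -
  from assms(1) obtain e where e: "e > 0" "cmod n = 1" and
    t: "\<And>w. dist w z < e \<Longrightarrow> w \<in> t \<longleftrightarrow> n \<bullet> (w - z) \<le> 0"
    unfolding edge_pt_def by blast
  define d where "d = e / 2"
  have d: "0 < d" "d < e" using e by (auto simp: d_def)
  have half: "m \<bullet> u \<le> 0" if "n \<bullet> u \<le> 0" "cmod u = 1" for u
  proof -
    have "z + d *\<^sub>R u \<in> t" using t[of "z + d *\<^sub>R u"] that d by (simp add: dist_norm mult_le_0_iff)
    from assms(3)[OF this] show ?thesis using d by (simp add: mult_le_0_iff)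
  qed
  have "m \<bullet> (\<i> * n) \<le> 0" "m \<bullet> (- \<i> * n) \<le> 0" "m \<bullet> (- n) \<le> 0"
    using half[of "\<i> * n"] half[of "- \<i> * n"] half[of "- n"] e(2)
    by (simp_all add: norm_mult inner_ii_mult)
  then have 0: "m \<bullet> (\<i> * n) = 0" "0 \<le> m \<bullet> n" by simp_all
  have m: "m = of_real (n \<bullet> m) * n" using unit_expand[OF e(2), of m] 0 by (simp add: inner_commute)
  then have "cmod m = \<bar>n \<bullet> m\<bar> * cmod n" by (metis norm_mult norm_of_real)
  then have "n \<bullet> m = 1" using 0(2) assms(2) e(2) by (simp add: inner_commute)
  then show ?thesis using m by simp
qed

text \<open>A boundary point of a convex set has a supporting line, and the half disc of
  \<open>t\<close> at \<open>z\<close> leaves only \<open>n\<close> as its outward normal.\<close>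

lemma edge_pt_support:
  assumes "edge_pt t n z" "t \<subseteq> P" "convex P" "z \<notin> interior P" "w \<in> P"
  shows "n \<bullet> (w - z) \<le> 0"
proof -
  from assms(1) have "z \<in> t" unfolding edge_pt_def by force
  then have "z \<in> P" using assms by blast
  \<comment> \<open>Once the interior is nonempty it equals the relative interior, to which the
    supporting hyperplane theorem refers.\<close>
  have "interior P \<noteq> {}"
  proof -
    from assms(1) obtain e where e: "e > 0" "cmod n = 1" and
      t: "\<And>w. dist w z < e \<Longrightarrow> w \<in> t \<longleftrightarrow> n \<bullet> (w - z) \<le> 0"
      unfolding edge_pt_def by blast
    have "ball z e \<inter> {w. n \<bullet> w < n \<bullet> z} \<subseteq> P" using t assms(2) by (auto simp: dist_commute inner_diff_right)
    then have "ball z e \<inter> {w. n \<bullet> w < n \<bullet> z} \<subseteq> interior P"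
      by (rule interior_maximal) (intro open_Int open_halfspace_lt open_ball)
    moreover have "z - (e/2) *\<^sub>R n \<in> ball z e \<inter> {w. n \<bullet> w < n \<bullet> z}"
      using e unit_inner_self[OF e(2)] by (simp add: dist_norm inner_diff_right)
    ultimately show ?thesis by blast
  qed
  then have "z \<notin> rel_interior P" using assms(4) by (simp add: rel_interior_nonempty_interior)
  then obtain a where a: "a \<noteq> 0" "\<And>y. y \<in> P \<Longrightarrow> a \<bullet> z \<le> a \<bullet> y"
    using supporting_hyperplane_rel_boundary[OF assms(3) \<open>z \<in> P\<close>] by metis
  define m where "m = - a /\<^sub>R cmod a"
  have m: "cmod m = 1" "\<And>y. y \<in> P \<Longrightarrow> m \<bullet> (y - z) \<le> 0"
    using a by (auto simp: m_def inner_diff_right divide_simps)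
  have "n = m"
    by (rule edge_pt_normal_unique[OF assms(1) m(1)]) (use m assms(2) in blast)
  then show ?thesis using m assms(5) by simp
qed

lemma edge_pt_glued_interior:
  assumes "edge_pt s n z" "edge_pt t (- n) z"
  shows "z \<in> interior (s \<union> t)"
proof -
  from assms obtain e1 e2 where e: "e1 > 0" "e2 > 0" and
    s: "\<And>w. dist w z < e1 \<Longrightarrow> w \<in> s \<longleftrightarrow> n \<bullet> (w - z) \<le> 0" and
    t: "\<And>w. dist w z < e2 \<Longrightarrow> w \<in> t \<longleftrightarrow> (- n) \<bullet> (w - z) \<le> 0"
    unfolding edge_pt_def by blast
  have "ball z (min e1 e2) \<subseteq> s \<union> t"
  proof
    fix w assume "w \<in> ball z (min e1 e2)"
    then show "w \<in> s \<union> t" using s[of w] t[of w] by (auto simp: dist_commute)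
  qed
  then show ?thesis using e by (meson min_less_iff_conj mem_interior)
qed

section \<open>Tilings of convex regions\<close>

text \<open>\<open>V\<close> and \<open>C\<close> choose for each tile its right-angled vertex and
  the direction of one leg. Tiles may meet along parts of edges, and positions are
  arbitrary.\<close>

locale convex_tiling =
  fixes Ts :: "complex set set" and P :: "complex set" and V C :: "complex set \<Rightarrow> complex"
  assumes finite_Ts: "finite Ts" and Ts_ne: "Ts \<noteq> {}"
    and unit: "t \<in> Ts \<Longrightarrow> cmod (C t) = 1"
    and tile_eq: "t \<in> Ts \<Longrightarrow> t = tile (V t) (C t)"
    and disj: "s \<in> Ts \<Longrightarrow> t \<in> Ts \<Longrightarrow> s \<noteq> t \<Longrightarrow> interior s \<inter> interior t = {}"
    and Union_Ts: "\<Union>Ts = P"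
    and convex_P: "convex P"
begin

definition vertices :: "complex set" where
  "vertices = (\<Union>t\<in>Ts. {V t, V t + C t, V t + \<i> * C t})"

lemma countable_vertices: "countable vertices" and finite_vertices: "finite vertices"
  using finite_Ts by (simp_all add: vertices_def uncountable_infinite countable_finite)

lemma tile_subset: "t \<in> Ts \<Longrightarrow> t \<subseteq> P"
  using Union_Ts by blast

lemma closed_tile_Ts: "t \<in> Ts \<Longrightarrow> closed t"
  by (metis tile_eq closed_tile)

lemma compact_P: "compact P"
  unfolding Union_Ts[symmetric] using finite_Ts tile_eq by (metis compact_Union compact_tile)

lemma interior_P_ne: "interior P \<noteq> {}"
proof -
  obtain t where t: "t \<in> Ts" using Ts_ne by blast
  have "interior (tile (V t) (C t)) \<subseteq> interior P"
    using tile_subset[OF t] tile_eq[OF t] by (metis interior_mono)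
  then show ?thesis using interior_tile_nonempty[OF unit[OF t]] by blast
qed

text \<open>A tile is the closure of its interior, so a common point interior to one tile would give
  points interior to both.\<close>

lemma not_interior:
  assumes "s \<in> Ts" "t \<in> Ts" "s \<noteq> t" "z \<in> s" "z \<in> t"
  shows "z \<notin> interior s"
proof
  assume "z \<in> interior s"
  moreover have "z \<in> closure (interior t)"
    using assms closure_interior_tile[OF unit[of t], of "V t"] tile_eq[of t] by metis
  ultimately have "interior s \<inter> closure (interior t) \<noteq> {}" by blast
  then have "interior s \<inter> interior t \<noteq> {}" by (simp add: open_Int_closure_eq_empty)
  then show False using disj assms by blast
qed

lemma edge_pt_cases:
  assumes "t \<in> Ts" "z \<in> t" "z \<notin> vertices" "z \<notin> interior t"
  obtains n where "n \<in> {- C t, - \<i> * C t, hyp_dir (C t)}" "edge_pt t n z"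
proof -
  have "z \<notin> {V t, V t + C t, V t + \<i> * C t}" using assms by (auto simp: vertices_def)
  then show thesis
    using tile_point_cases[OF unit[OF assms(1)], of z "V t"] tile_eq[OF assms(1)] assms that by metis
qed

text \<open>The eighth power of a direction is invariant under rotations by 45 degrees, hence
  it is the same for all edge normals of a tile.\<close>

lemma normal_pow8: 
  assumes "n \<in> {- c, - \<i> * c, hyp_dir c}" 
  shows "n ^ 8 = c ^ 8" "(-n) ^ 8 = c ^ 8"
proof -
  have i8: "\<i> ^ 8 = 1" by (simp add: numeral_eq_Suc)
  have 1: "(1 + \<i>) ^ 8 = 16" by (simp add: numeral_eq_Suc algebra_simps)
  have "sqrt 2 ^ 8 = ((sqrt 2)\<^sup>2) ^ 4" by (simp only: power_mult[symmetric]) simp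
  then have 2: "complex_of_real (sqrt 2) ^ 8 = 16" by (simp flip: of_real_power)
  have "hyp_dir c = c * ((1 + \<i>) / of_real (sqrt 2))" by (simp add: hyp_dir_def algebra_simps)
  then have "hyp_dir c ^ 8 = c ^ 8"
    by (simp only: power_mult_distrib power_divide 1 2) simp
  then show "n ^ 8 = c ^ 8" using assms by (auto simp: power_mult_distrib i8)
  then show "(-n) ^ 8 = c ^ 8" by simp
qed

text \<open>Away from the vertices a common point of two tiles lies inside an edge of each, and
  disjointness makes the two edge normals opposite.\<close>

lemma pow8_eq_at:
  assumes "s \<in> Ts" "t \<in> Ts" "z \<in> s" "z \<in> t" "z \<notin> vertices"
  shows "C s ^ 8 = C t ^ 8"
proof (cases "s = t")
  case False
  have "z \<notin> interior s" "z \<notin> interior t" using not_interior assms False by metis+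
  then obtain n m where n: "n \<in> {- C s, - \<i> * C s, hyp_dir (C s)}" "edge_pt s n z"
    and m: "m \<in> {- C t, - \<i> * C t, hyp_dir (C t)}" "edge_pt t m z"
    using edge_pt_cases[OF assms(1,3,5)] edge_pt_cases[OF assms(2,4,5)] by metis
  have "m = - n" using edge_pt_opposite[OF n(2) m(2)] disj assms False by blast
  then show ?thesis using normal_pow8[OF n(1)] normal_pow8[OF m(1)] by simp
qed simp

lemma pow8_const:
  assumes "s \<in> Ts" "t \<in> Ts"
  shows "C s ^ 8 = C t ^ 8"
proof (rule ccontr)
  assume ne: "C s ^ 8 \<noteq> C t ^ 8"
  define X where "X = interior P - vertices"
  define A where "A = \<Union>{u \<in> Ts. C u ^ 8 = C s ^ 8}"
  define B where "B = \<Union>{u \<in> Ts. C u ^ 8 \<noteq> C s ^ 8}"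
  have "connected X" unfolding X_def
    by (rule connected_open_diff_countable) (use countable_vertices convex_P in \<open>auto intro: convex_connected convex_interior simp: DIM_complex\<close>)
  moreover have "closed A" "closed B" unfolding A_def B_def
    using finite_Ts closed_tile_Ts by (auto intro!: closed_Union)
  moreover have "X \<subseteq> A \<union> B"
    using Union_Ts interior_subset[of P] by (fastforce simp: X_def A_def B_def)
  moreover have "A \<inter> B \<inter> X = {}"
  proof (rule ccontr)
    assume "A \<inter> B \<inter> X \<noteq> {}"
    then obtain z u w where "u \<in> Ts" "C u ^ 8 = C s ^ 8" "z \<in> u" "w \<in> Ts" "C w ^ 8 \<noteq> C s ^ 8" "z \<in> w" "z \<notin> vertices"
      by (auto simp: A_def B_def X_def)
    then show False using pow8_eq_at[of u w z] by simp
  qed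
  ultimately have "A \<inter> X = {} \<or> B \<inter> X = {}"
    by (metis connected_closed)
  \<comment> \<open>The interior of a tile is infinite, so it survives the removal of finitely many
    vertices; hence neither \<open>A\<close> nor \<open>B\<close> can miss \<open>X\<close>.\<close>
  moreover have "u \<inter> X \<noteq> {}" if "u \<in> Ts" for u
  proof -
    have "interior u \<noteq> {}" using interior_tile_nonempty[OF unit[OF that]] tile_eq[OF that] by metis
    then have "infinite (interior u)" using finite_imp_not_open[of "interior u"] by blast
    then obtain z where "z \<in> interior u" "z \<notin> vertices"
      using finite_vertices by (meson finite_subset subsetI)
    moreover have "interior u \<subseteq> interior P" using tile_subset[OF that] by (rule interior_mono)
    ultimately show ?thesis using interior_subset by (auto simp: X_def)
  qed
  ultimately have "s \<inter> X \<noteq> {}" "t \<inter> X \<noteq> {}" "A \<inter> X = {} \<or> B \<inter> X = {}" using assms by simp_all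
  moreover have "s \<subseteq> A" "t \<subseteq> B" using assms ne by (auto simp: A_def B_def)
  ultimately show False by blast
qed

text \<open>\<open>R\<close> is the intersection of the supporting half planes of \<open>P\<close>
  in eight directions. At a boundary point of \<open>P\<close> that is no vertex, the normal of a
  tile edge is one of these directions, so the point is not interior to \<open>R\<close>. Thus
  \<open>P\<close> has no boundary inside the connected set \<open>X\<close>, the interior of
  \<open>R\<close> without the vertices, and therefore contains it.\<close>

lemma P_octagon:
  assumes "\<And>t. t \<in> Ts \<Longrightarrow> C t ^ 8 = 1"
    and h: "\<And>n. n ^ 8 = 1 \<Longrightarrow> (\<exists>z\<in>P. n \<bullet> z = h n) \<and> (\<forall>z\<in>P. n \<bullet> z \<le> h n)"
  shows "P = {z. \<forall>n. n ^ 8 = 1 \<longrightarrow> n \<bullet> z \<le> h n}"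
proof -
  define R where "R = {z. \<forall>n. n ^ 8 = 1 \<longrightarrow> n \<bullet> z \<le> h n}"
  have PR: "P \<subseteq> R" using h by (auto simp: R_def)
  have R: "R = (\<Inter>n\<in>{n. n ^ 8 = 1}. {z. n \<bullet> z \<le> h n})" by (auto simp: R_def)
  have "convex R" unfolding R by (intro convex_INT convex_halfspace_le)
  have "closed R" unfolding R by (intro closed_INT ballI closed_halfspace_le)
  define X where "X = interior R - vertices"
  have "connected X" unfolding X_def
    by (rule connected_open_diff_countable) (use countable_vertices \<open>convex R\<close> in \<open>auto intro: convex_connected convex_interior simp: DIM_complex\<close>)
  have int: "X \<inter> P \<subseteq> interior P"
  proof
    fix z assume z: "z \<in> X \<inter> P"
    show "z \<in> interior P"
    proof (rule ccontr)
      assume zP: "z \<notin> interior P"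
      obtain t where t: "t \<in> Ts" "z \<in> t" using z Union_Ts by blast
      then have "z \<notin> interior t" using zP tile_subset interior_mono by blast
      then obtain n where n: "n \<in> {- C t, - \<i> * C t, hyp_dir (C t)}" "edge_pt t n z"
        using edge_pt_cases[OF t] z by (auto simp: X_def)
      have n8: "n ^ 8 = 1" using normal_pow8(1)[OF n(1)] assms(1)[OF t(1)] by simp
      have "n \<bullet> (w - z) \<le> 0" if "w \<in> P" for w
        using edge_pt_support[OF n(2) tile_subset[OF t(1)] convex_P zP that] .
      then have "h n \<le> n \<bullet> z" using h[OF n8] by (fastforce simp: inner_diff_right)
      then have "R \<subseteq> {w. n \<bullet> w \<le> n \<bullet> z}" using n8 by (force simp: R_def)
      then have "interior R \<subseteq> interior {w. n \<bullet> w \<le> n \<bullet> z}" by (rule interior_mono)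
      moreover have "n \<noteq> 0" using n8 by auto
      ultimately have "interior R \<subseteq> {w. n \<bullet> w < n \<bullet> z}" by simp
      then show False using z by (auto simp: X_def)
    qed
  qed
  have "X \<subseteq> P"
  proof (rule ccontr)
    assume "\<not> X \<subseteq> P"
    then have "- P \<inter> X \<noteq> {}" by blast
    moreover have "interior P \<inter> X \<noteq> {}"
    proof -
      have "infinite (interior P)" using finite_imp_not_open[of "interior P"] interior_P_ne by blast
      then obtain z where "z \<in> interior P" "z \<notin> vertices"
        using finite_vertices by (meson finite_subset subsetI)
      then show ?thesis using interior_mono[OF PR] by (auto simp: X_def)
    qed
    moreover have "X \<subseteq> interior P \<union> - P" using int by blast
    moreover have "interior P \<inter> - P \<inter> X = {}" using interior_subset by blast
    moreover have "open (- P)" using compact_P by (simp add: compact_imp_closed open_Compl)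
    ultimately show False using \<open>connected X\<close> unfolding connected_def by (metis open_interior)
  qed
  have "interior R \<subseteq> P"
  proof -
    have "interior R \<subseteq> closure X"
    proof -
      have "interior R - closure X \<subseteq> vertices" using closure_subset[of X] by (auto simp: X_def)
      then have "finite (interior R - closure X)" using finite_vertices finite_subset by blast
      \<comment> \<open>The difference is open as well as finite; only the empty set is
        both.\<close>
      then have "interior R - closure X = {}" using finite_imp_not_open by blast
      then show ?thesis by blast
    qed
    also have "\<dots> \<subseteq> P" using \<open>X \<subseteq> P\<close> compact_P by (simp add: closure_minimal compact_imp_closed)
    finally show ?thesis .
  qed
  moreover have "interior R \<noteq> {}" using interior_P_ne interior_mono[OF PR] by blast
  then have "R = closure (interior R)" using convex_closure_interior[OF \<open>convex R\<close>] \<open>closed R\<close> by simp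
  ultimately have "R \<subseteq> P" using compact_P by (metis closure_minimal compact_imp_closed)
  then show ?thesis using PR by (auto simp: R_def)
qed

end

section \<open>Area and side lengths\<close>

text \<open>This carries the triangle formula \<open>content_triangle\<close> from
  \<open>real^2\<close> to the complex plane; the measures agree because they agree on
  boxes.\<close>

lemma lborel_complex_vec2:
  "lborel = distr (lborel :: complex measure) borel (\<lambda>z. vector [Re z, Im z] :: real^2)"
proof (rule lborel_eqI)
  have "linear (\<lambda>z. vector [Re z, Im z] :: real^2)" by (intro linearI) (auto simp: vec_eq_iff forall_2)
  then have [measurable]: "(\<lambda>z. vector [Re z, Im z] :: real^2) \<in> borel_measurable borel"
    by (intro borel_measurable_continuous_onI linear_continuous_on linear_conv_bounded_linear[THEN iffD1])
  fix l u :: "real^2" assume le: "\<And>b. b \<in> Basis \<Longrightarrow> l \<bullet> b \<le> u \<bullet> b"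
  have B: "(Basis :: (real^2) set) = {axis 1 1, axis 2 1}" by (auto simp: Basis_vec_def UNIV_2)
  have ne: "axis 1 (1::real) \<noteq> (axis 2 1 :: real^2)" by (simp add: axis_eq_axis)
  have "(\<lambda>z. vector [Re z, Im z] :: real^2) -` box l u = box (Complex (l$1) (l$2)) (Complex (u$1) (u$2))"
    by (auto simp: mem_box B inner_axis Basis_complex_def)
  then have "emeasure (distr lborel borel (\<lambda>z. vector [Re z, Im z] :: real^2)) (box l u)
     = emeasure lborel (box (Complex (l$1) (l$2)) (Complex (u$1) (u$2)))"
    by (subst emeasure_distr) auto
  also have "\<dots> = ennreal (\<Prod>b\<in>Basis. (u - l) \<bullet> b)"
    using le[of "axis 1 1"] le[of "axis 2 1"]
    by (subst emeasure_lborel_box) (auto simp: Basis_complex_def B ne inner_axis)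
  finally show "emeasure (distr lborel borel (\<lambda>z. vector [Re z, Im z] :: real^2)) (box l u) = ennreal (\<Prod>b\<in>Basis. (u - l) \<bullet> b)" .
qed simp

lemma measure_tile: "measure lebesgue (tile v c) = (cmod c)\<^sup>2 / 2"
proof -
  let ?\<phi> = "\<lambda>z. vector [Re z, Im z] :: real^2"
  define \<psi> :: "real^2 \<Rightarrow> complex" where "\<psi> = (\<lambda>x. Complex (x$1) (x$2))"
  have \<psi>\<phi>: "\<psi> (?\<phi> z) = z" for z by (simp add: \<psi>_def)
  have lin: "linear ?\<phi>" by (intro linearI) (auto simp: vec_eq_iff forall_2)
  then have [measurable]: "?\<phi> \<in> borel_measurable borel"
    by (intro borel_measurable_continuous_onI linear_continuous_on linear_conv_bounded_linear[THEN iffD1])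
  have im: "?\<phi> ` tile v c = convex hull {?\<phi> v, ?\<phi> (v + c), ?\<phi> (v + \<i> * c)}"
    unfolding tile_conv_hull by (simp add: convex_hull_linear_image[OF lin])
  have "compact (?\<phi> ` tile v c)" unfolding im by (simp add: compact_convex_hull)
  then have cl: "?\<phi> ` tile v c \<in> sets borel" by (simp add: compact_imp_closed)
  have "?\<phi> -` (?\<phi> ` tile v c) = tile v c" using \<psi>\<phi> by (auto simp: image_iff) metis
  then have "emeasure lborel (?\<phi> ` tile v c) = emeasure lborel (tile v c)"
    by (subst lborel_complex_vec2, subst emeasure_distr) (use cl in auto)
  then have "measure lborel (tile v c) = measure lborel (?\<phi> ` tile v c)"
    by (simp add: measure_def)
  also have "\<dots> = \<bar>(- (Im c) * Im c - Re c * Re c)\<bar> / 2"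
    unfolding im content_triangle by simp
  also have "\<dots> = (cmod c)\<^sup>2 / 2"
  proof -
    have "- (Im c) * Im c - Re c * Re c = - ((cmod c)\<^sup>2)"
      unfolding cmod_power2 by (simp add: power2_eq_square)
    then show ?thesis by simp
  qed
  finally show ?thesis
    by (simp add: closed_tile measure_completion)
qed

lemma lmeasurable_tile: "tile v c \<in> lmeasurable"
  by (simp add: compact_tile lmeasurable_compact)

context convex_tiling begin

lemma Int_subset_frontier:
  assumes "s \<in> Ts" "t \<in> Ts" "s \<noteq> t"
  shows "s \<inter> t \<subseteq> frontier s"
  using not_interior[OF assms] closure_subset by (auto simp: frontier_def)

lemma negligible_Int:
  assumes "s \<in> Ts" "t \<in> Ts" "s \<noteq> t"
  shows "negligible (s \<inter> t)"
proof -
  have "convex s" by (metis tile_eq assms(1) convex_tile)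
  then show ?thesis
    using Int_subset_frontier[OF assms] negligible_convex_frontier negligible_subset by blast
qed

lemma measure_P: "measure lebesgue P = card Ts / 2"
proof -
  have "measure lebesgue (\<Union>Ts) = (\<Sum>t\<in>Ts. measure lebesgue t)"
    by (rule measure_negligible_finite_Union) 
      (use finite_Ts tile_eq lmeasurable_tile negligible_Int in \<open>auto simp: pairwise_def, metis\<close>)
  also have "\<dots> = (\<Sum>t\<in>Ts. 1 / 2)"
    by (intro sum.cong refl) (metis measure_tile tile_eq unit power_one)
  finally show ?thesis by (simp add: Union_Ts)
qed

end

section \<open>Traces of tiles on a supporting line\<close>

text \<open>The points of \<open>A\<close> on the line with unit normal \<open>n\<close> and offset \<open>h\<close>, parametrised by arc length.\<close>

definition line_part :: "complex \<Rightarrow> real \<Rightarrow> complex set \<Rightarrow> real set" where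
  "line_part n h A = {s. of_real h * n + of_real s * (\<i> * n) \<in> A}"

text \<open>A supporting line meets a tile in an edge, in a vertex, or not at all. The numbers
  \<open>d\<close>, \<open>d - \<alpha>\<close> and \<open>d - \<beta>\<close> are the slacks of the
  supporting inequality at the three vertices. The slack at a point of the tile is their mean with
  barycentric weights, so on the line every weight times its slack is zero.\<close>

lemma line_part_tile:
  assumes c: "cmod c = 1" and n: "cmod n = 1" and sub: "\<And>w. w \<in> tile v c \<Longrightarrow> n \<bullet> w \<le> h"
  shows "(n = - \<i> * c \<and> (\<exists>a. line_part n h (tile v c) = {a..a+1}) \<and> (\<forall>r. n \<bullet> (v + of_real r * c) = h)) \<or>
         (n = - c \<and> (\<exists>a. line_part n h (tile v c) = {a..a+1}) \<and> (\<forall>r. n \<bullet> (v + of_real r * (\<i> * c)) = h)) \<or>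
         (n = hyp_dir c \<and> (\<exists>a. line_part n h (tile v c) = {a..a+sqrt 2}) \<and> (\<forall>r. n \<bullet> (v + of_real r * c + of_real (1 - r) * (\<i> * c)) = h)) \<or>
         finite (line_part n h (tile v c))"
proof -
  define \<alpha> \<beta> where "\<alpha> = c \<bullet> n" and "\<beta> = (\<i> * c) \<bullet> n"
  have n_eq: "n = of_real \<alpha> * c + of_real \<beta> * (\<i> * c)" using unit_expand[OF c, of n] by (simp add: \<alpha>_def \<beta>_def)
  have cc: "c \<bullet> c = 1" and nn: "n \<bullet> n = 1" using c n by (auto intro: unit_inner_self)
  have ab: "\<alpha>\<^sup>2 + \<beta>\<^sup>2 = 1"
  proof -
    have "n \<bullet> n = (\<alpha>\<^sup>2 + \<beta>\<^sup>2) * (c \<bullet> c)" by (subst (1 2) n_eq) (simp add: inner_complex_def power2_eq_square algebra_simps)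
    then show ?thesis using cc nn by simp
  qed
  have nc: "n \<bullet> c = \<alpha>" "n \<bullet> (\<i> * c) = \<beta>" by (simp_all add: \<alpha>_def \<beta>_def inner_commute)
  define d where "d = h - n \<bullet> v"
  have lin: "n \<bullet> (v + of_real r * c + of_real q * (\<i> * c)) = h - (d - \<alpha> * r - \<beta> * q)" for r q
  proof -
    have "n \<bullet> (of_real r * c) = r * (n \<bullet> c)" "n \<bullet> (of_real q * (\<i> * c)) = q * (n \<bullet> (\<i> * c))"
      by (simp_all add: inner_complex_def algebra_simps)
    then show ?thesis by (simp add: inner_add_right nc d_def algebra_simps)
  qed
  have d: "0 \<le> d" "0 \<le> d - \<alpha>" "0 \<le> d - \<beta>"
    using sub[OF tile_vertices(1)] sub[OF tile_vertices(2)] sub[OF tile_vertices(3)]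
    by (simp_all add: d_def inner_add_right nc)
  define p where "p s = of_real h * n + of_real s * (\<i> * n)" for s
  define x0 y0 where "x0 = c \<bullet> (of_real h * n - v)" and "y0 = (\<i> * c) \<bullet> (of_real h * n - v)"
  have xs: "c \<bullet> (p s - v) = x0 - s * \<beta>" for s
    by (simp add: p_def x0_def \<beta>_def inner_complex_def algebra_simps)
  have ys: "(\<i> * c) \<bullet> (p s - v) = y0 + s * \<alpha>" for s
    by (simp add: p_def y0_def \<alpha>_def inner_complex_def algebra_simps)
  have rel: "\<alpha> * x0 + \<beta> * y0 = d"
  proof -
    have "of_real h * n - v = of_real x0 * c + of_real y0 * (\<i> * c)"
      using unit_expand[OF c, of "of_real h * n - v"] by (simp add: x0_def y0_def)
    then have "v + of_real x0 * c + of_real y0 * (\<i> * c) = of_real h * n" by (simp add: algebra_simps)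
    moreover have "n \<bullet> (of_real h * n) = h * (n \<bullet> n)" by (simp add: inner_complex_def algebra_simps)
    ultimately show ?thesis using lin[of x0 y0] nn by simp
  qed
  have part: "line_part n h (tile v c) = {s. 0 \<le> x0 - s * \<beta> \<and> 0 \<le> y0 + s * \<alpha> \<and> (x0 - s * \<beta>) + (y0 + s * \<alpha>) \<le> 1}"
    unfolding line_part_def p_def[symmetric] mem_tile[OF c] inner_add_left xs ys ..
  have key: "(1 - x - y) * d + x * (d - \<alpha>) + y * (d - \<beta>) = 0" if "x = x0 - s * \<beta>" "y = y0 + s * \<alpha>" for x y s
    using rel by (simp add: that algebra_simps)
  have pos: "(1 - x - y) * d = 0 \<and> x * (d - \<alpha>) = 0 \<and> y * (d - \<beta>) = 0"
    if "x = x0 - s * \<beta>" "y = y0 + s * \<alpha>" "0 \<le> x" "0 \<le> y" "x + y \<le> 1" for x y s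
  proof -
    have "0 \<le> (1 - x - y) * d" "0 \<le> x * (d - \<alpha>)" "0 \<le> y * (d - \<beta>)" using that d by auto
    then show ?thesis using key[OF that(1,2)] by linarith
  qed
  have inj: "s = t" if "x0 - s * \<beta> = x0 - t * \<beta>" "y0 + s * \<alpha> = y0 + t * \<alpha>" for s t
    using that ab by auto
  have fin: ?thesis if "\<And>s. s \<in> line_part n h (tile v c) \<Longrightarrow> x0 - s * \<beta> = a \<and> y0 + s * \<alpha> = b" for a b
  proof -
    have "s = t" if "s \<in> line_part n h (tile v c)" "t \<in> line_part n h (tile v c)" for s t
      using inj \<open>\<And>s. s \<in> line_part n h (tile v c) \<Longrightarrow> x0 - s * \<beta> = a \<and> y0 + s * \<alpha> = b\<close> that by metis
    then have "\<exists>s. line_part n h (tile v c) \<subseteq> {s}" by blast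
    then have "finite (line_part n h (tile v c))" using finite_subset by blast
    then show ?thesis by blast
  qed
  \<comment> \<open>In the first three cases two slacks vanish and an edge lies on the line; in the
    last three, two slacks are positive and at most one vertex is left.\<close>
  consider "d = 0" "\<alpha> = 0" | "d = 0" "\<beta> = 0" "\<alpha> \<noteq> 0" | "\<alpha> = d" "\<beta> = d" "d > 0"
    | "d > 0" "d - \<alpha> > 0" | "d > 0" "d - \<beta> > 0" | "d - \<alpha> > 0" "d - \<beta> > 0"
    using d by linarith
  then show ?thesis
  proof cases
    case 1
    then have "\<beta> = - 1" using ab d by (auto simp: power2_eq_1_iff)
    then have "n = - \<i> * c" "line_part n h (tile v c) = {- x0..- x0 + 1}"
      using 1 n_eq rel unfolding part by auto
    moreover have "n \<bullet> (v + of_real r * c) = h" for r using lin[of r 0] 1 by simp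
    ultimately show ?thesis by blast
  next
    case 2
    then have "\<alpha> = - 1" using ab d by (auto simp: power2_eq_1_iff)
    then have "n = - c" "line_part n h (tile v c) = {y0 - 1..(y0 - 1) + 1}"
      using 2 n_eq rel unfolding part by auto
    moreover have "n \<bullet> (v + of_real r * (\<i> * c)) = h" for r using lin[of 0 r] 2 by simp
    ultimately show ?thesis by blast
  next
    case 3
    have "(sqrt 2 * d)\<^sup>2 = 1\<^sup>2" using ab 3 by (simp add: power_mult_distrib)
    then have "sqrt 2 * d = 1" using 3 by (subst (asm) power2_eq_iff_nonneg) auto
    then have dd: "d = 1 / sqrt 2" by (simp add: field_simps)
    then have "complex_of_real d = 1 / of_real (sqrt 2)" by simp
    then have "n = hyp_dir c"
      using 3 by (subst n_eq) (simp add: hyp_dir_def add_divide_distrib del: of_real_divide)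
    have xy: "x0 + y0 = 1"
    proof -
      have "d * (x0 + y0) = d * 1" using rel 3 by (simp add: algebra_simps)
      then show ?thesis using 3(3) by simp
    qed
    have "line_part n h (tile v c) = {sqrt 2 * x0 - sqrt 2..(sqrt 2 * x0 - sqrt 2) + sqrt 2}"
    proof (intro set_eqI)
      fix s
      have s: "s * d = s / sqrt 2" by (simp add: dd)
      have "s \<in> line_part n h (tile v c) \<longleftrightarrow> s / sqrt 2 \<le> x0 \<and> x0 - 1 \<le> s / sqrt 2"
        using xy unfolding part 3(1,2) mem_Collect_eq s by linarith
      also have "\<dots> \<longleftrightarrow> s \<le> x0 * sqrt 2 \<and> (x0 - 1) * sqrt 2 \<le> s"
        by (simp add: pos_divide_le_eq pos_le_divide_eq)
      finally show "s \<in> line_part n h (tile v c) \<longleftrightarrow> s \<in> {sqrt 2 * x0 - sqrt 2..(sqrt 2 * x0 - sqrt 2) + sqrt 2}"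
        by (auto simp: algebra_simps)
    qed
    moreover have "n \<bullet> (v + of_real r * c + of_real (1 - r) * (\<i> * c)) = h" for r using lin[of r "1 - r"] 3
      by (simp add: algebra_simps)
    ultimately show ?thesis using \<open>n = hyp_dir c\<close> by blast
  next
    case 4
    show ?thesis by (rule fin[of 0 1]) (use 4 pos[OF refl refl] in \<open>fastforce simp: part\<close>)
  next
    case 5
    show ?thesis by (rule fin[of 1 0]) (use 5 pos[OF refl refl] in \<open>fastforce simp: part\<close>)
  next
    case 6
    show ?thesis by (rule fin[of 0 0]) (use 6 pos[OF refl refl] in \<open>fastforce simp: part\<close>)
  qed
qed

context convex_tiling begin

text \<open>At a common point that is no vertex both tiles would have the supporting normal
  \<open>n\<close>, while disjoint tiles have opposite normals there. So common points are vertices,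
  of which there are finitely many.\<close>

lemma line_part_Int_negligible:
  assumes "s \<in> Ts" "t \<in> Ts" "s \<noteq> t" and n: "cmod n = 1" and h: "\<And>w. w \<in> P \<Longrightarrow> n \<bullet> w \<le> h"
  shows "negligible (line_part n h s \<inter> line_part n h t)"
proof -
  let ?p = "\<lambda>x. of_real h * n + of_real x * (\<i> * n)"
  have ne: "n \<noteq> 0" using n by auto
  have "inj ?p" using ne by (auto simp: inj_def)
  have np: "n \<bullet> ?p x = h" for x
  proof -
    have "n \<bullet> ?p x = h * (n \<bullet> n)" by (simp add: inner_complex_def algebra_simps)
    then show ?thesis using unit_inner_self[OF n] by simp
  qed
  have "line_part n h s \<inter> line_part n h t \<subseteq> ?p -` vertices"
  proof
    fix x assume x: "x \<in> line_part n h s \<inter> line_part n h t"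
    define z where "z = ?p x"
    have z: "z \<in> s" "z \<in> t" using x by (auto simp: line_part_def z_def)
    have le: "n \<bullet> (w - z) \<le> 0" if "w \<in> P" for w using h[OF that] np[of x] by (simp add: inner_diff_right z_def)
    have "z \<in> vertices"
    proof (rule ccontr)
      assume zv: "z \<notin> vertices"
      have *: "edge_pt u n z" if u: "u \<in> Ts" "z \<in> u" "z \<notin> interior u" for u
      proof -
        obtain m where m: "edge_pt u m z" using edge_pt_cases[OF u(1,2) zv u(3)] by blast
        have "m = n" by (rule edge_pt_normal_unique[OF m n]) (use le tile_subset[OF u(1)] in blast)
        then show ?thesis using m by simp
      qed
      have "edge_pt s n z" "edge_pt t n z"
        using * not_interior[OF assms(1-3) z] not_interior[of t s z] assms z by auto
      then have "n = - n" using edge_pt_opposite disj assms by blast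
      then show False using ne by simp
    qed
    then show "x \<in> ?p -` vertices" by (simp add: z_def)
  qed
  moreover have "finite (?p -` vertices)" using finite_vertices \<open>inj ?p\<close> by (rule finite_vimageI)
  ultimately show ?thesis by (meson finite_subset negligible_finite)
qed

text \<open>The quantifier over \<open>r\<close> places the whole line of the leg on the supporting
  line; the value \<open>r = 1 / 2\<close> gives the edge midpoint needed for the thin
  shapes.\<close>

definition on_leg :: "complex \<Rightarrow> real \<Rightarrow> complex set \<Rightarrow> bool" where
  "on_leg n h t \<longleftrightarrow> (n = - \<i> * C t \<and> (\<forall>r. n \<bullet> (V t + of_real r * C t) = h)) \<or>
     (n = - C t \<and> (\<forall>r. n \<bullet> (V t + of_real r * (\<i> * C t)) = h))"

definition on_hyp :: "complex \<Rightarrow> real \<Rightarrow> complex set \<Rightarrow> bool" where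
  "on_hyp n h t \<longleftrightarrow> n = hyp_dir (C t) \<and> (\<forall>r. n \<bullet> (V t + of_real r * C t + of_real (1 - r) * (\<i> * C t)) = h)"

lemma line_part_measure:
  assumes "t \<in> Ts" and n: "cmod n = 1" and h: "\<And>w. w \<in> P \<Longrightarrow> n \<bullet> w \<le> h"
  shows "line_part n h t \<in> lmeasurable"
    "measure lebesgue (line_part n h t) = 0 \<or>
     measure lebesgue (line_part n h t) = 1 \<and> on_leg n h t \<or>
     measure lebesgue (line_part n h t) = sqrt 2 \<and> on_hyp n h t"
proof -
  have sub: "n \<bullet> w \<le> h" if "w \<in> tile (V t) (C t)" for w
    using h that tile_eq[OF assms(1)] tile_subset[OF assms(1)] by blast
  have fin: "finite A \<Longrightarrow> A \<in> lmeasurable \<and> measure lebesgue A = 0" for A :: "real set"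
    by (metis negligible_finite negligible_iff_measure)
  consider a where "line_part n h t = {a..a+1}" "on_leg n h t" | a where "line_part n h t = {a..a + sqrt 2}" "on_hyp n h t"
     | "finite (line_part n h t)"
    using line_part_tile[OF unit[OF assms(1)] n sub, of "V t"] tile_eq[OF assms(1)]
    unfolding on_leg_def on_hyp_def by metis
  note cases = this
  show "line_part n h t \<in> lmeasurable" using cases by cases (use fin in auto)
  show "measure lebesgue (line_part n h t) = 0 \<or>
     measure lebesgue (line_part n h t) = 1 \<and> on_leg n h t \<or>
     measure lebesgue (line_part n h t) = sqrt 2 \<and> on_hyp n h t"
    using cases by cases (use fin in auto)
qed

text \<open>Sorting tiles by the length of their trace turns the length of a side into a count; that
  a leg produces the trace is recovered in \<open>leg_tilesD\<close>.\<close>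

definition leg_tiles :: "complex \<Rightarrow> real \<Rightarrow> complex set set" where
  "leg_tiles n h = {t \<in> Ts. measure lebesgue (line_part n h t) = 1}"

definition hyp_tiles :: "complex \<Rightarrow> real \<Rightarrow> complex set set" where
  "hyp_tiles n h = {t \<in> Ts. measure lebesgue (line_part n h t) = sqrt 2}"

lemma leg_tilesD: "t \<in> leg_tiles n h \<Longrightarrow> cmod n = 1 \<Longrightarrow> (\<And>w. w \<in> P \<Longrightarrow> n \<bullet> w \<le> h) \<Longrightarrow> t \<in> Ts \<and> on_leg n h t"
  using line_part_measure(2)[of t n h] by (auto simp: leg_tiles_def)

lemma hyp_tilesD: "t \<in> hyp_tiles n h \<Longrightarrow> cmod n = 1 \<Longrightarrow> (\<And>w. w \<in> P \<Longrightarrow> n \<bullet> w \<le> h) \<Longrightarrow> t \<in> Ts \<and> on_hyp n h t"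
  using line_part_measure(2)[of t n h] by (auto simp: hyp_tiles_def)

lemma side_length:
  assumes n: "cmod n = 1" and h: "\<And>w. w \<in> P \<Longrightarrow> n \<bullet> w \<le> h" and lp: "line_part n h P = {a..b}" "a \<le> b"
  shows "b - a = card (leg_tiles n h) + card (hyp_tiles n h) * sqrt 2"
proof -
  have "b - a = measure lebesgue (line_part n h P)" using lp by simp
  also have "line_part n h P = \<Union>(line_part n h ` Ts)" by (auto simp: line_part_def Union_Ts[symmetric])
  also have "measure lebesgue \<dots> = (\<Sum>t\<in>Ts. measure lebesgue (line_part n h t))"
    by (rule measure_negligible_finite_Union_image)
      (use finite_Ts line_part_measure(1) line_part_Int_negligible n h in \<open>auto simp: pairwise_def\<close>)
  also have "\<dots> = (\<Sum>t\<in>Ts. (if t \<in> leg_tiles n h then 1 else 0) + (if t \<in> hyp_tiles n h then sqrt 2 else 0))"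
    by (intro sum.cong refl) (use line_part_measure(2)[OF _ n h] in \<open>auto simp: leg_tiles_def hyp_tiles_def\<close>)
  also have "\<dots> = card (leg_tiles n h) + card (hyp_tiles n h) * sqrt 2"
  proof -
    have "leg_tiles n h \<subseteq> Ts" "hyp_tiles n h \<subseteq> Ts" by (auto simp: leg_tiles_def hyp_tiles_def)
    then show ?thesis using finite_Ts
      by (simp add: sum.distrib Int_absorb1 Int_absorb2 flip: sum.inter_restrict)
  qed
  finally show ?thesis .
qed

end

section \<open>Rectangles with cut corners\<close>

text \<open>The rectangle with corners \<open>0\<close>, \<open>W\<close>, \<open>W + \<i> * H\<close>, \<open>\<i> * H\<close> loses there isosceles right triangles with legs \<open>a\<close>, \<open>b\<close>, \<open>c\<close>, \<open>d\<close>
  (in this order).\<close>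

definition oct :: "real \<Rightarrow> real \<Rightarrow> real \<Rightarrow> real \<Rightarrow> real \<Rightarrow> real \<Rightarrow> complex set" where
  "oct W H a b c d = {z. 0 \<le> Re z \<and> Re z \<le> W \<and> 0 \<le> Im z \<and> Im z \<le> H \<and> a \<le> Re z + Im z
      \<and> Re z - Im z \<le> W - b \<and> Re z + Im z \<le> W + H - c \<and> Im z - Re z \<le> H - d}"

text \<open>Each side of the rectangle has room for the two cuts at its ends. Equality is allowed,
  so sides may shrink to points and polygons with fewer than eight sides are covered.\<close>

definition oct_ok :: "real \<Rightarrow> real \<Rightarrow> real \<Rightarrow> real \<Rightarrow> real \<Rightarrow> real \<Rightarrow> bool" where
  "oct_ok W H a b c d \<longleftrightarrow> 0 \<le> a \<and> 0 \<le> b \<and> 0 \<le> c \<and> 0 \<le> d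
      \<and> a + b \<le> W \<and> b + c \<le> H \<and> c + d \<le> W \<and> d + a \<le> H"

lemma convex_oct: "convex (oct W H a b c d)"
proof (rule convexI)
  fix x y u v assume *: "x \<in> oct W H a b c d" "y \<in> oct W H a b c d" "0 \<le> u" "0 \<le> v" "u + v = (1::real)"
  have comb: "u * p + v * q \<le> k" if "p \<le> k" "q \<le> k" for p q k :: real
    using convex_bound_le[OF that *(3-5)] .
  show "u *\<^sub>R x + v *\<^sub>R y \<in> oct W H a b c d"
    using *(1,2) unfolding oct_def mem_Collect_eq
    using comb[of "- Re x" 0 "- Re y"] comb[of "Re x" W "Re y"] comb[of "- Im x" 0 "- Im y"] comb[of "Im x" H "Im y"]
      comb[of "- (Re x + Im x)" "-a" "- (Re y + Im y)"] comb[of "Re x - Im x" "W - b" "Re y - Im y"]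
      comb[of "Re x + Im x" "W + H - c" "Re y + Im y"] comb[of "Im x - Re x" "H - d" "Im y - Re y"]
    by (simp add: algebra_simps)
qed

lemma closed_oct: "closed (oct W H a b c d)"
  unfolding oct_def by (intro closed_Collect_conj closed_Collect_le continuous_intros)

lemma compact_oct: "compact (oct W H a b c d)"
proof -
  have "oct W H a b c d \<subseteq> cbox 0 (Complex W H)" by (auto simp: oct_def in_cbox_complex_iff)
  then show ?thesis using closed_oct compact_eq_bounded_closed bounded_cbox bounded_subset by blast
qed

lemma congruent_oct_rotate: "congruent (oct W H a b c d) (oct H W d a b c)"
  unfolding congruent_def
proof (intro exI conjI)
  show "plane_isometry (\<lambda>z. of_real H + \<i> * z)" by (rule plane_isometry_rot) simp
  have "z \<in> (\<lambda>z. of_real H + \<i> * z) ` oct W H a b c d" if "z \<in> oct H W d a b c" for z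
    by (rule image_eqI[of _ _ "- \<i> * (z - of_real H)"]) (use that in \<open>auto simp: oct_def algebra_simps\<close>)
  then show "(\<lambda>z. of_real H + \<i> * z) ` oct W H a b c d = oct H W d a b c"
    by (auto simp: oct_def)
qed

lemma congruent_oct_reflect: "congruent (oct W H a b c d) (oct W H b a d c)"
  unfolding congruent_def
proof (intro exI conjI)
  show "plane_isometry (\<lambda>z. of_real W + (-1) * cnj z)" by (rule plane_isometry_refl) simp
  have "z \<in> (\<lambda>z. of_real W + (-1) * cnj z) ` oct W H a b c d" if "z \<in> oct W H b a d c" for z
    by (rule image_eqI[of _ _ "of_real W - cnj z"]) (use that in \<open>auto simp: oct_def algebra_simps\<close>)
  then show "(\<lambda>z. of_real W + (-1) * cnj z) ` oct W H a b c d = oct W H b a d c"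
    by (auto simp: oct_def)
qed

text \<open>Sides become cuts and cuts become sides; a side of length \<open>l\<close> becomes a cut
  with legs \<open>l / sqrt 2\<close>. The new coordinates are \<open>Re z - Im z\<close> and
  \<open>Re z + Im z\<close>, divided by \<open>sqrt 2\<close> and shifted so that their lower
  bounds become zero.\<close>

lemma congruent_oct_rotate45:
  "congruent (oct W H a b c d)
     (oct ((W + H - b - d) / sqrt 2) ((W + H - a - c) / sqrt 2) ((H - d - a) / sqrt 2) ((W - a - b) / sqrt 2)
        ((H - b - c) / sqrt 2) ((W - c - d) / sqrt 2))"
  (is "congruent ?A ?B")
  unfolding congruent_def
proof (intro exI conjI)
  define q where "q = cnj (hyp_dir 1)"
  define v where "v = Complex ((H - d) / sqrt 2) (- (a / sqrt 2))"
  have q: "cmod q = 1" by (simp add: q_def cmod_hyp_dir)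
  have r: "Re q = 1 / sqrt 2" "Im q = - (1 / sqrt 2)"
    by (simp_all add: q_def hyp_dir_def)
  show iso: "plane_isometry (\<lambda>z. v + \<i> * q * z)" by (rule plane_isometry_rot) (simp add: norm_mult q)
  define f where "f = (\<lambda>z. v + \<i> * q * z)"
  have Re: "Re (f z) = (H - d + (Re z - Im z)) / sqrt 2" and Im: "Im (f z) = (Re z + Im z - a) / sqrt 2" for z
    by (simp_all add: f_def v_def r add_divide_distrib diff_divide_distrib)
  have mem: "f z \<in> ?B \<longleftrightarrow> z \<in> ?A" for z
  proof -
    have div: "x / sqrt 2 \<le> y / sqrt 2 \<longleftrightarrow> x \<le> y" for x y by (simp add: divide_le_cancel)
    have dp: "0 \<le> x / sqrt 2 \<longleftrightarrow> 0 \<le> x" for x :: real by (simp add: zero_le_divide_iff)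
    show ?thesis
      unfolding oct_def mem_Collect_eq Re Im add_divide_distrib[symmetric] diff_divide_distrib[symmetric] div dp
      by auto
  qed
  have surj: "\<exists>z. f z = w" for w
    by (rule exI[of _ "(w - v) / (\<i> * q)"]) (use q in \<open>auto simp: f_def\<close>)
  show "(\<lambda>z. v + \<i> * q * z) ` ?A = ?B"
    unfolding f_def[symmetric] using mem surj by (auto simp: image_iff) metis
qed

text \<open>The rectangle is the union of the region and the four cut corners, which overlap in null
  sets.\<close>

lemma measure_oct:
  assumes ok: "oct_ok W H a b c d"
  shows "measure lebesgue (oct W H a b c d) = W * H - (a\<^sup>2 + b\<^sup>2 + c\<^sup>2 + d\<^sup>2) / 2"
proof -
  \<comment> \<open>Index \<open>0\<close> is the region; \<open>5\<close>, \<open>2\<close>,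
    \<open>3\<close>, \<open>4\<close> are the corners with legs \<open>a\<close>, \<open>b\<close>,
    \<open>c\<close>, \<open>d\<close>. The indices keep degenerate corners apart even when they
    coincide as sets.\<close>
  define F where "F = (\<lambda>k::nat. if k = 0 then oct W H a b c d else if k = 5 then tile 0 (of_real a)
     else if k = 2 then tile (of_real W) (\<i> * of_real b) else if k = 3 then tile (Complex W H) (- of_real c)
     else tile (\<i> * of_real H) (- \<i> * of_real d))"
  \<comment> \<open>Multiplication by \<open>cnj r\<close> turns the corner back to axis-parallel
    position; \<open>x = 0\<close> is the triangle that consists of one point.\<close>
  have T: "tile v (r * of_real x) = {z. let w = cnj r * (z - v) in 0 \<le> Re w \<and> 0 \<le> Im w \<and> Re w + Im w \<le> x}"
    if "0 \<le> x" "cmod r = 1" for v r x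
  proof -
    have rr: "cnj r * r = 1" using that by (simp add: mult.commute flip: complex_norm_square)
    have "z \<in> tile v (r * of_real x) \<longleftrightarrow> (\<exists>w\<in>T0. cnj r * (z - v) = of_real x * w)" for z
    proof -
      have "z = v + r * of_real x * w \<longleftrightarrow> cnj r * (z - v) = of_real x * w" for w
      proof
        assume "cnj r * (z - v) = of_real x * w"
        then have "(cnj r * r) * (z - v) = r * (of_real x * w)" by (metis mult.assoc mult.commute)
        then have "z - v = r * (of_real x * w)" unfolding rr by simp
        then show "z = v + r * of_real x * w" by (simp add: algebra_simps)
      next
        assume "z = v + r * of_real x * w"
        then have "cnj r * (z - v) = (cnj r * r) * (of_real x * w)" by (simp add: mult.assoc)
        then show "cnj r * (z - v) = of_real x * w" using rr by simp
      qed
      then show ?thesis by (auto simp: tile_def)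
    qed
    moreover have "(\<exists>w\<in>T0. u = of_real x * w) \<longleftrightarrow> 0 \<le> Re u \<and> 0 \<le> Im u \<and> Re u + Im u \<le> x" for u
    proof (cases "x = 0")
      case True
      have "0 \<in> T0" by (simp add: T0_eq)
      then show ?thesis using True by (auto simp: complex_eq_iff)
    next
      case False
      then have x: "x > 0" using that by simp
      show ?thesis
      proof
        assume "\<exists>w\<in>T0. u = of_real x * w"
        then obtain w where w: "0 \<le> Re w" "0 \<le> Im w" "Re w + Im w \<le> 1" "u = of_real x * w" by (auto simp: T0_eq)
        then show "0 \<le> Re u \<and> 0 \<le> Im u \<and> Re u + Im u \<le> x"
          using x mult_left_mono[OF w(3), of x] by (simp add: algebra_simps)
      next
        assume "0 \<le> Re u \<and> 0 \<le> Im u \<and> Re u + Im u \<le> x"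
        then show "\<exists>w\<in>T0. u = of_real x * w"
          using x by (intro bexI[of _ "u / of_real x"]) (auto simp: T0_eq add_divide_distrib[symmetric])
      qed
    qed
    ultimately show ?thesis by (auto simp: Let_def)
  qed
  have o: "0 \<le> a" "0 \<le> b" "0 \<le> c" "0 \<le> d" "a + b \<le> W" "b + c \<le> H" "c + d \<le> W" "d + a \<le> H"
    using ok by (auto simp: oct_ok_def)
  have T1: "F 5 = {z. 0 \<le> Re z \<and> 0 \<le> Im z \<and> Re z + Im z \<le> a}"
  proof -
    have "F 5 = tile 0 (1 * of_real a)" by (simp add: F_def)
    also note T[OF o(1), of 1 0]
    finally show ?thesis by (simp add: Let_def algebra_simps conj_ac)
  qed
  have T2: "F 2 = {z. Re z \<le> W \<and> 0 \<le> Im z \<and> Im z - Re z \<le> b - W}"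
  proof -
    have "F 2 = tile (of_real W) (\<i> * of_real b)" by (simp add: F_def)
    also note T[OF o(2), of \<i> "of_real W"]
    finally show ?thesis by (simp add: Let_def algebra_simps conj_ac)
  qed
  have T3: "F 3 = {z. Re z \<le> W \<and> Im z \<le> H \<and> W + H - c \<le> Re z + Im z}"
  proof -
    have "F 3 = tile (Complex W H) (-1 * of_real c)" by (simp add: F_def)
    also note T[OF o(3), of "-1" "Complex W H"]
    finally show ?thesis by (simp add: Let_def algebra_simps conj_ac)
  qed
  have T4: "F 4 = {z. 0 \<le> Re z \<and> Im z \<le> H \<and> Re z - Im z \<le> d - H}"
  proof -
    have "F 4 = tile (\<i> * of_real H) (- \<i> * of_real d)" by (simp add: F_def)
    also note T[OF o(4), of "-\<i>" "\<i> * of_real H"]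
    finally show ?thesis by (simp add: Let_def algebra_simps conj_ac)
  qed
  have F0: "F 0 = oct W H a b c d" by (simp add: F_def)
  have un: "cbox 0 (Complex W H) = \<Union>(F ` {0,5,2,3,4})"
  proof -
    have "\<Union>(F ` {0,5,2,3,4}) = F 0 \<union> F 5 \<union> F 2 \<union> F 3 \<union> F 4" by auto
    moreover have "cbox 0 (Complex W H) = F 0 \<union> F 5 \<union> F 2 \<union> F 3 \<union> F 4"
    proof (intro subset_antisym subsetI)
      fix z assume z: "z \<in> cbox 0 (Complex W H)"
      show "z \<in> F 0 \<union> F 5 \<union> F 2 \<union> F 3 \<union> F 4"
      proof (rule ccontr)
        assume "z \<notin> F 0 \<union> F 5 \<union> F 2 \<union> F 3 \<union> F 4"
        then have "\<not> Re z + Im z \<le> a" "\<not> Im z - Re z \<le> b - W" "\<not> W + H - c \<le> Re z + Im z"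
          "\<not> Re z - Im z \<le> d - H" "z \<notin> oct W H a b c d"
          using z unfolding F0 T1 T2 T3 T4 in_cbox_complex_iff by auto
        then show False using z unfolding oct_def in_cbox_complex_iff by simp
      qed
    next
      fix z assume "z \<in> F 0 \<union> F 5 \<union> F 2 \<union> F 3 \<union> F 4"
      then show "z \<in> cbox 0 (Complex W H)"
        unfolding F0 T1 T2 T3 T4 oct_def in_cbox_complex_iff Un_iff mem_Collect_eq
        using o by (elim disjE conjE; simp)
    qed
    ultimately show ?thesis by simp
  qed
  have neg: "negligible A" if "A \<subseteq> {z. u \<bullet> z = k}" "u \<noteq> 0" for A k and u :: complex
    using negligible_hyperplane[of u k] that negligible_subset by blast
  have N1: "negligible A" if "\<And>z. z \<in> A \<Longrightarrow> Re z = k" for A k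
    by (rule neg[of _ 1 k]) (use that in \<open>auto simp: inner_complex_def\<close>)
  have N2: "negligible A" if "\<And>z. z \<in> A \<Longrightarrow> Im z = k" for A k
    by (rule neg[of _ \<i> k]) (use that in \<open>auto simp: inner_complex_def\<close>)
  have N3: "negligible A" if "\<And>z. z \<in> A \<Longrightarrow> Re z + Im z = k" for A k
    by (rule neg[of _ "1 + \<i>" k]) (use that in \<open>auto simp: inner_complex_def complex_eq_iff\<close>)
  have N4: "negligible A" if "\<And>z. z \<in> A \<Longrightarrow> Re z - Im z = k" for A k
    by (rule neg[of _ "1 - \<i>" k]) (use that in \<open>auto simp: inner_complex_def complex_eq_iff\<close>)
  \<comment> \<open>Any two parts meet inside a line: the line of the cut, or for two corners a line
    through the place where they can touch.\<close>
  have "negligible (F 0 \<inter> F 5)" by (rule N3[of _ a]) (auto simp: F0 T1 oct_def)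
  moreover have "negligible (F 0 \<inter> F 2)" by (rule N4[of _ "W - b"]) (auto simp: F0 T2 oct_def)
  moreover have "negligible (F 0 \<inter> F 3)" by (rule N3[of _ "W + H - c"]) (auto simp: F0 T3 oct_def)
  moreover have "negligible (F 0 \<inter> F 4)" by (rule N4[of _ "d - H"]) (auto simp: F0 T4 oct_def)
  moreover have "negligible (F 5 \<inter> F 2)" by (rule N1[of _ a]) (use o in \<open>auto simp: T1 T2\<close>)
  moreover have "negligible (F 5 \<inter> F 3)" by (rule N3[of _ a]) (use o in \<open>auto simp: T1 T3\<close>)
  moreover have "negligible (F 5 \<inter> F 4)" by (rule N2[of _ a]) (use o in \<open>auto simp: T1 T4\<close>)
  moreover have "negligible (F 2 \<inter> F 3)" by (rule N2[of _ b]) (use o in \<open>auto simp: T2 T3\<close>)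
  moreover have "negligible (F 2 \<inter> F 4)" by (rule N4[of _ "W - b"]) (use o in \<open>auto simp: T2 T4\<close>)
  moreover have "negligible (F 3 \<inter> F 4)" by (rule N1[of _ d]) (use o in \<open>auto simp: T3 T4\<close>)
  ultimately have pw: "pairwise (\<lambda>x y. negligible (F x \<inter> F y)) {0,5,2,3,4}"
    by (auto simp: pairwise_insert Int_commute)
  have lm: "F k \<in> lmeasurable" if "k \<in> {0,5,2,3,4}" for k
    by (simp add: F_def lmeasurable_tile lmeasurable_compact compact_oct)
  have "measure lebesgue (cbox 0 (Complex W H)) = (\<Sum>k\<in>{0,5,2,3,4}. measure lebesgue (F k))"
    unfolding un by (rule measure_negligible_finite_Union_image) (use lm pw in auto)
  moreover have "measure lebesgue (cbox 0 (Complex W H)) = W * H"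
  proof -
    have "0 \<in> cbox 0 (Complex W H)" using o by (simp add: in_cbox_complex_iff)
    then have "cbox 0 (Complex W H) \<noteq> {}" by blast
    then show ?thesis by (simp add: content_cbox_if Basis_complex_def)
  qed
  moreover have "measure lebesgue (F 5) = a\<^sup>2 / 2" "measure lebesgue (F 2) = b\<^sup>2 / 2"
    "measure lebesgue (F 3) = c\<^sup>2 / 2" "measure lebesgue (F 4) = d\<^sup>2 / 2"
    by (simp_all add: F_def measure_tile norm_mult)
  ultimately show ?thesis by (simp add: F0 add_divide_distrib)
qed

section \<open>Moving a tiled region into standard position\<close>

lemma convex_tiling_exists:
  assumes "finite Ts" "Ts \<noteq> {}" "\<And>t. t \<in> Ts \<Longrightarrow> \<exists>v c. cmod c = 1 \<and> Q c \<and> t = tile v c"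
    "\<And>s t. s \<in> Ts \<Longrightarrow> t \<in> Ts \<Longrightarrow> s \<noteq> t \<Longrightarrow> interior s \<inter> interior t = {}" "\<Union>Ts = P" "convex P"
  obtains V C where "convex_tiling Ts P V C" "\<And>t. t \<in> Ts \<Longrightarrow> Q (C t)"
proof -
  obtain V C where "\<And>t. t \<in> Ts \<Longrightarrow> cmod (C t) = 1 \<and> Q (C t) \<and> t = tile (V t) (C t)"
    using assms(3) by metis
  then show thesis by (intro that[of V C]) (use assms in \<open>auto simp: convex_tiling_def\<close>)
qed

text \<open>Pieces and gluing are forgotten here; convexity of \<open>P\<close> is part of the
  locale.\<close>

definition tiled :: "nat \<Rightarrow> complex set \<Rightarrow> bool" where
  "tiled k P \<longleftrightarrow> (\<exists>Ts V C. convex_tiling Ts P V C \<and> card Ts = k)"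

text \<open>The predicate \<open>Q\<close> transports a property of leg directions, such as
  \<open>c ^ 8 = 1\<close>, along with the tiles.\<close>

lemma convex_tiling_image:
  assumes "convex_tiling Ts P V C" "plane_isometry f"
    and "\<And>t. t \<in> Ts \<Longrightarrow> \<exists>v c. cmod c = 1 \<and> Q c \<and> f ` t = tile v c"
  obtains V' C' where "convex_tiling ((`) f ` Ts) (f ` P) V' C'" "\<And>t. t \<in> (`) f ` Ts \<Longrightarrow> Q (C' t)"
    "card ((`) f ` Ts) = card Ts"
proof -
  interpret convex_tiling Ts P V C by fact
  have inj: "inj f" using assms(2) by (rule plane_isometry_inj)
  have "interior (f ` s) \<inter> interior (f ` t) = {}" if "s \<in> Ts" "t \<in> Ts" "f ` s \<noteq> f ` t" for s t
    using disj[OF that(1,2)] that(3) inj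
    by (auto simp: interior_isometry_image[OF assms(2)] simp flip: image_Int)
  then obtain V' C' where "convex_tiling ((`) f ` Ts) (f ` P) V' C'" "\<And>t. t \<in> (`) f ` Ts \<Longrightarrow> Q (C' t)"
    by (elim convex_tiling_exists[rotated -1])
      (use finite_Ts Ts_ne assms(3) Union_Ts convex_P assms(2) in \<open>auto intro: convex_isometry_image\<close>)
  moreover have "card ((`) f ` Ts) = card Ts"
    by (rule card_image) (use inj in \<open>auto simp: inj_on_def inj_image_eq_iff\<close>)
  ultimately show thesis using that by blast
qed

lemma tiled_congruent:
  assumes "tiled k P" "congruent P P'"
  shows "tiled k P'"
proof -
  obtain Ts V C where T: "convex_tiling Ts P V C" "card Ts = k" using assms by (auto simp: tiled_def)
  obtain f where f: "plane_isometry f" "f ` P = P'" using assms by (auto simp: congruent_def)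
  have "\<exists>v c. cmod c = 1 \<and> True \<and> f ` t = tile v c" if "t \<in> Ts" for t
  proof -
    have "congruent T0 t" using convex_tiling.tile_eq[OF T(1) that] convex_tiling.unit[OF T(1) that]
      by (auto simp: congruent_T0_tile)
    then have "congruent T0 (f ` t)" using f(1) by (meson congruent_def congruent_trans)
    then show ?thesis by (simp add: congruent_T0_tile)
  qed
  from convex_tiling_image[OF T(1) f(1), of "\<lambda>_. True", OF this] f(2) T(2) show ?thesis
    unfolding tiled_def by metis
qed

lemma pow8_eq_1_iff:
  "(n::complex) ^ 8 = 1 \<longleftrightarrow> n \<in> {1, -1, \<i>, -\<i>, hyp_dir 1, - hyp_dir 1, \<i> * hyp_dir 1, - \<i> * hyp_dir 1}"
proof -
  have "complex_of_real (sqrt 2) * complex_of_real (sqrt 2) = 2" by (simp flip: of_real_mult)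
  then have h2: "hyp_dir 1 * hyp_dir 1 = \<i>" by (simp add: hyp_dir_def algebra_simps)
  have "n ^ 8 - 1 = (n - 1) * (n + 1) * (n - \<i>) * (n + \<i>) * (n * n - \<i>) * (n * n + \<i>)"
  proof -
    have "(n - \<i>) * (n + \<i>) = n * n + 1" "(n * n - \<i>) * (n * n + \<i>) = n * n * (n * n) + 1" by (simp_all add: algebra_simps)
    moreover have "n ^ 8 - 1 = (n - 1) * (n + 1) * (n * n + 1) * (n * n * (n * n) + 1)"
      by (simp add: algebra_simps numeral_eq_Suc)
    ultimately show ?thesis by (simp only: mult.assoc)
  qed
  also have "n * n - \<i> = (n - hyp_dir 1) * (n + hyp_dir 1)" by (simp add: algebra_simps h2)
  also have "n * n + \<i> = (n - \<i> * hyp_dir 1) * (n + \<i> * hyp_dir 1)"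
  proof -
    have "(\<i> * hyp_dir 1) * (\<i> * hyp_dir 1) = - (hyp_dir 1 * hyp_dir 1)" by (simp add: algebra_simps)
    then show ?thesis by (simp add: algebra_simps h2)
  qed
  finally have "n ^ 8 = 1 \<longleftrightarrow> (n - 1) * (n + 1) * (n - \<i>) * (n + \<i>) * ((n - hyp_dir 1) * (n + hyp_dir 1)) *
     ((n - \<i> * hyp_dir 1) * (n + \<i> * hyp_dir 1)) = 0" by (metis eq_iff_diff_eq_0)
  then show ?thesis by (auto simp: eq_neg_iff_add_eq_0)
qed

text \<open>After a rotation that makes the legs of one tile axis-parallel, all leg directions are
  eighth roots of unity and \<open>P_octagon\<close> applies.\<close>

lemma tiled_congruent_oct:
  assumes "tiled k P"
  obtains W H a b c d where "oct_ok W H a b c d" "congruent P (oct W H a b c d)"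
proof -
  obtain Ts V C where T: "convex_tiling Ts P V C" using assms by (auto simp: tiled_def)
  then interpret T: convex_tiling Ts P V C .
  obtain t0 where t0: "t0 \<in> Ts" using T.Ts_ne by blast
  define q where "q = cnj (C t0)"
  have q: "cmod q = 1" using T.unit[OF t0] by (simp add: q_def)
  have qq: "cnj (C t0) * C t0 = 1" using T.unit[OF t0] by (simp add: mult.commute flip: complex_norm_square)
  have q8: "(q * C t) ^ 8 = 1" if "t \<in> Ts" for t
    using T.pow8_const[OF that t0] qq by (metis power_mult_distrib power_one q_def)
  define f where "f = (\<lambda>z. 0 + q * z)"
  have f: "plane_isometry f" unfolding f_def by (rule plane_isometry_rot[OF q])
  have "\<exists>v c. cmod c = 1 \<and> c ^ 8 = 1 \<and> f ` t = tile v c" if "t \<in> Ts" for t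
  proof (intro exI conjI)
    show "cmod (q * C t) = 1" using q T.unit[OF that] by (simp add: norm_mult)
    show "(q * C t) ^ 8 = 1" by (rule q8[OF that])
    have "f ` tile (V t) (C t) = tile (q * V t) (q * C t)"
      by (simp add: f_def tile_def image_image algebra_simps)
    then show "f ` t = tile (q * V t) (q * C t)" using T.tile_eq[OF that] by simp
  qed
  then obtain V' C' where T': "convex_tiling ((`) f ` Ts) (f ` P) V' C'" "\<And>t. t \<in> (`) f ` Ts \<Longrightarrow> C' t ^ 8 = 1"
    using convex_tiling_image[OF T f, of "\<lambda>c. c ^ 8 = 1"] by metis
  then interpret T': convex_tiling "(`) f ` Ts" "f ` P" V' C' by simp
  define R where "R = f ` P"
  have R: "compact R" "R \<noteq> {}" using T'.compact_P T'.interior_P_ne interior_subset by (auto simp: R_def)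
  have "\<exists>m. (\<exists>z\<in>R. n \<bullet> z = m) \<and> (\<forall>z\<in>R. n \<bullet> z \<le> m)" for n
    using continuous_attains_sup[OF R, of "\<lambda>z. n \<bullet> z"] by (force intro!: continuous_intros)
  then obtain h where h: "\<And>n. (\<exists>z\<in>R. n \<bullet> z = h n) \<and> (\<forall>z\<in>R. n \<bullet> z \<le> h n)" by metis
  have Req: "R = {z. \<forall>n. n ^ 8 = 1 \<longrightarrow> n \<bullet> z \<le> h n}"
    using T'.P_octagon[OF T'(2), of h] h unfolding R_def by blast
  \<comment> \<open>These are the extremal values of \<open>Re\<close>, \<open>Im\<close>,
    \<open>Re + Im\<close> and \<open>Re - Im\<close> on the region; the factor
    \<open>sqrt 2\<close> compensates for the unit length of the diagonal normals.\<close>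
  define x0 x1 y0 y1 s0 s1 d0 d1 where
    "x0 = - h (-1)" and "x1 = h 1" and "y0 = - h (-\<i>)" and "y1 = h \<i>" and
    "s0 = - (sqrt 2 * h (- hyp_dir 1))" and "s1 = sqrt 2 * h (hyp_dir 1)" and
    "d0 = - (sqrt 2 * h (\<i> * hyp_dir 1))" and "d1 = sqrt 2 * h (- \<i> * hyp_dir 1)"
  note defs = x0_def x1_def y0_def y1_def s0_def s1_def d0_def d1_def
  have in1: "1 \<bullet> z = Re z" "(-1) \<bullet> z = - Re z" "\<i> \<bullet> z = Im z" "(-\<i>) \<bullet> z = - Im z" for z
    by (simp_all add: inner_complex_def)
  have in2: "hyp_dir 1 \<bullet> z = (Re z + Im z) / sqrt 2" "(- hyp_dir 1) \<bullet> z = - (Re z + Im z) / sqrt 2"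
    "(\<i> * hyp_dir 1) \<bullet> z = (Im z - Re z) / sqrt 2" "(- \<i> * hyp_dir 1) \<bullet> z = (Re z - Im z) / sqrt 2" for z
    by (simp_all add: inner_complex_def hyp_dir_def diff_divide_distrib add_divide_distrib)
  have le: "x / sqrt 2 \<le> y \<longleftrightarrow> x \<le> sqrt 2 * y" for x y by (simp add: pos_divide_le_eq mult.commute)
  have eq: "x / sqrt 2 = y \<longleftrightarrow> x = sqrt 2 * y" for x y by (simp add: divide_eq_eq mult.commute)
  have mem: "z \<in> R \<longleftrightarrow> x0 \<le> Re z \<and> Re z \<le> x1 \<and> y0 \<le> Im z \<and> Im z \<le> y1 \<and> s0 \<le> Re z + Im z
    \<and> Re z + Im z \<le> s1 \<and> d0 \<le> Re z - Im z \<and> Re z - Im z \<le> d1" for z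
  proof -
    have "z \<in> R \<longleftrightarrow> 1 \<bullet> z \<le> h 1 \<and> (-1) \<bullet> z \<le> h (-1) \<and> \<i> \<bullet> z \<le> h \<i> \<and> (-\<i>) \<bullet> z \<le> h (-\<i>) \<and>
       hyp_dir 1 \<bullet> z \<le> h (hyp_dir 1) \<and> (- hyp_dir 1) \<bullet> z \<le> h (- hyp_dir 1) \<and>
       (\<i> * hyp_dir 1) \<bullet> z \<le> h (\<i> * hyp_dir 1) \<and> (- \<i> * hyp_dir 1) \<bullet> z \<le> h (- \<i> * hyp_dir 1)"
      unfolding Req pow8_eq_1_iff by blast
    then show ?thesis unfolding in1 in2 le defs by auto
  qed
  \<comment> \<open>Each extremal value is attained. The inequalities of \<open>oct_ok\<close>
    result from the other bounds at these eight points.\<close>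
  obtain w1 where w1: "w1 \<in> R" "Re w1 = x0" using h[of "-1"] by (auto simp: in1 defs)
  obtain w2 where w2: "w2 \<in> R" "Re w2 = x1" using h[of "1"] by (auto simp: in1 defs)
  obtain w3 where w3: "w3 \<in> R" "Im w3 = y0" using h[of "-\<i>"] by (auto simp: in1 defs)
  obtain w4 where w4: "w4 \<in> R" "Im w4 = y1" using h[of "\<i>"] by (auto simp: in1 defs)
  obtain w5 where w5: "w5 \<in> R" "Re w5 + Im w5 = s0" using h[of "- hyp_dir 1"] unfolding in2 eq defs by force
  obtain w6 where w6: "w6 \<in> R" "Re w6 + Im w6 = s1" using h[of "hyp_dir 1"] unfolding in2 eq defs by force
  obtain w7 where w7: "w7 \<in> R" "Re w7 - Im w7 = d0" using h[of "\<i> * hyp_dir 1"] unfolding in2 eq defs by force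
  obtain w8 where w8: "w8 \<in> R" "Re w8 - Im w8 = d1" using h[of "- \<i> * hyp_dir 1"] unfolding in2 eq defs by force
  \<comment> \<open>A cut is the gap between a corner of the bounding box and the diagonal
    supporting line next to it.\<close>
  define W H a b c d where "W = x1 - x0" and "H = y1 - y0" and "a = s0 - x0 - y0" and
    "b = x1 - y0 - d1" and "c = x1 + y1 - s1" and "d = y1 - x0 + d0"
  have ok: "oct_ok W H a b c d"
    using w1 w2 w3 w4 w5 w6 w7 w8 unfolding mem oct_ok_def W_def H_def a_def b_def c_def d_def by linarith
  define v where "v = - Complex x0 y0"
  have "(\<lambda>z. v + 1 * z) ` R = oct W H a b c d"
  proof -
    have "v + z \<in> oct W H a b c d \<longleftrightarrow> z \<in> R" for z
      unfolding mem oct_def W_def H_def a_def b_def c_def d_def by (simp add: v_def) linarith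
    then have "z \<in> (\<lambda>z. v + 1 * z) ` R" if "z \<in> oct W H a b c d" for z
      using that by (intro image_eqI[of _ _ "z - v"]) (simp_all flip: \<open>\<And>z. v + z \<in> oct W H a b c d \<longleftrightarrow> z \<in> R\<close>)
    then show ?thesis using \<open>\<And>z. v + z \<in> oct W H a b c d \<longleftrightarrow> z \<in> R\<close> by auto
  qed
  then have "congruent R (oct W H a b c d)"
    unfolding congruent_def using plane_isometry_rot[of 1 v] by force
  moreover have "congruent P R" using f by (auto simp: congruent_def R_def)
  ultimately show thesis using that ok congruent_trans by blast
qed

section \<open>Integrality\<close>

lemma tiled_measure: "tiled k P \<Longrightarrow> measure lebesgue P = k / 2"
  unfolding tiled_def using convex_tiling.measure_P by metis

text \<open>Infinite descent: \<open>y\<close> and then \<open>x\<close> are even, and halving both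
  gives a smaller solution.\<close>

lemma two_squares_eq: "2 * x\<^sup>2 = y\<^sup>2 \<Longrightarrow> x = 0" for x y :: nat
proof (induction x arbitrary: y rule: less_induct)
  case (less x)
  have "even y" using less.prems by (metis dvd_triv_left even_power)
  then obtain z where z: "y = 2 * z" by blast
  then have x: "x\<^sup>2 = 2 * z\<^sup>2" using less.prems by (simp add: power_mult_distrib)
  then have "even x" by (metis dvd_triv_left even_power)
  then obtain w where w: "x = 2 * w" by blast
  then have "2 * w\<^sup>2 = z\<^sup>2" using x by (simp add: power_mult_distrib)
  then show ?case using less.IH[of w z] w by (cases "x = 0") auto
qed

lemma sqrt2_independent:
  fixes x y :: int
  assumes "real_of_int x + real_of_int y / sqrt 2 = 0"
  shows "x = 0 \<and> y = 0"
proof -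
  have "real_of_int y = - (real_of_int x * sqrt 2)" using assms by (simp add: field_simps)
  then have "(real_of_int y)\<^sup>2 = 2 * (real_of_int x)\<^sup>2" by (simp add: power_mult_distrib)
  then have "y\<^sup>2 = 2 * x\<^sup>2" by (metis of_int_eq_iff of_int_mult of_int_numeral of_int_power)
  then have "2 * (nat \<bar>x\<bar>)\<^sup>2 = (nat \<bar>y\<bar>)\<^sup>2"
    by (metis nat_abs_mult_distrib nat_numeral nat_power_eq abs_ge_zero power2_abs abs_numeral nat_mult_distrib zero_le_numeral)
  then have "x = 0" using two_squares_eq by fastforce
  then show ?thesis using \<open>y\<^sup>2 = 2 * x\<^sup>2\<close> by simp
qed

text \<open>The cut at the corner \<open>0\<close> has length \<open>a * sqrt 2\<close>. If
  \<open>p\<close> legs and \<open>q\<close> hypotenuses lie on it, this is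
  \<open>p + q * sqrt 2\<close>, hence \<open>a = q + p / sqrt 2\<close>.\<close>

lemma oct_bottom_sides:
  assumes "tiled k (oct W H a b c d)" "oct_ok W H a b c d"
  shows "\<exists>(m::nat) (n::nat). W - a - b = m + n * sqrt 2" "\<exists>(q::nat) (p::nat). a = q + p / sqrt 2"
proof -
  obtain Ts V C where "convex_tiling Ts (oct W H a b c d) V C" using assms by (auto simp: tiled_def)
  then interpret T: convex_tiling Ts "oct W H a b c d" V C .
  have ok: "0 \<le> a" "0 \<le> b" "0 \<le> c" "0 \<le> d" "a + b \<le> W" "b + c \<le> H" "c + d \<le> W" "d + a \<le> H"
    using assms(2) by (auto simp: oct_ok_def)
  have "line_part (- \<i>) 0 (oct W H a b c d) = {a..W - b}"
    using ok by (auto simp: line_part_def oct_def)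
  moreover have "(- \<i>) \<bullet> w \<le> 0" if "w \<in> oct W H a b c d" for w
    using that by (auto simp: oct_def inner_complex_def)
  ultimately have "W - b - a = card (T.leg_tiles (- \<i>) 0) + card (T.hyp_tiles (- \<i>) 0) * sqrt 2"
    using ok by (intro T.side_length) auto
  then show "\<exists>(m::nat) (n::nat). W - a - b = m + n * sqrt 2" by (metis diff_diff_add add.commute)
  let ?n = "- hyp_dir 1" and ?h = "- (a / sqrt 2)"
  have sq: "x / sqrt 2 / sqrt 2 = x / 2" for x by (simp add: field_simps)
  have pt: "Re (of_real ?h * ?n + of_real s * (\<i> * ?n)) = a / 2 + s / sqrt 2"
       "Im (of_real ?h * ?n + of_real s * (\<i> * ?n)) = a / 2 - s / sqrt 2" for s
    by (simp_all add: hyp_dir_def sq)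
  have "line_part ?n ?h (oct W H a b c d) = {- (a / sqrt 2)..a / sqrt 2}"
  proof (intro set_eqI)
    fix s
    define u where "u = s / sqrt 2"
    have "s \<in> line_part ?n ?h (oct W H a b c d) \<longleftrightarrow> - (a / 2) \<le> u \<and> u \<le> a / 2"
      unfolding line_part_def oct_def mem_Collect_eq pt u_def[symmetric] using ok by auto
    also have "\<dots> \<longleftrightarrow> - (a / 2) * sqrt 2 \<le> s \<and> s \<le> a / 2 * sqrt 2"
      unfolding u_def by (subst pos_le_divide_eq, simp, subst pos_divide_le_eq, simp_all)
    also have "a / 2 * sqrt 2 = a / sqrt 2" by (simp add: field_simps)
    also have "- (a / 2) * sqrt 2 = - (a / sqrt 2)" by (simp add: field_simps)
    finally show "s \<in> line_part ?n ?h (oct W H a b c d) \<longleftrightarrow> s \<in> {- (a / sqrt 2)..a / sqrt 2}" by simp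
  qed
  moreover have "?n \<bullet> w \<le> ?h" if "w \<in> oct W H a b c d" for w
  proof -
    have "?n \<bullet> w = - ((Re w + Im w) / sqrt 2)" by (simp add: hyp_dir_def inner_complex_def add_divide_distrib)
    moreover have "a / sqrt 2 \<le> (Re w + Im w) / sqrt 2" using that by (intro divide_right_mono) (auto simp: oct_def)
    ultimately show ?thesis by simp
  qed
  moreover have "cmod ?n = 1" by (simp add: cmod_hyp_dir)
  ultimately have "a / sqrt 2 - - (a / sqrt 2) = card (T.leg_tiles ?n ?h) + card (T.hyp_tiles ?n ?h) * sqrt 2"
    using ok by (intro T.side_length) auto
  moreover have "a = (a / sqrt 2 - - (a / sqrt 2)) / sqrt 2" by (simp add: field_simps)
  ultimately have "a = (card (T.leg_tiles ?n ?h) + card (T.hyp_tiles ?n ?h) * sqrt 2) / sqrt 2" by simp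
  then have "a = card (T.hyp_tiles ?n ?h) + card (T.leg_tiles ?n ?h) / sqrt 2"
    by (simp add: add_divide_distrib)
  then show "\<exists>(q::nat) (p::nat). a = q + p / sqrt 2" by metis
qed

lemma tiled_oct_rotate:
  assumes "tiled k (oct W H a b c d)" "oct_ok W H a b c d"
  shows "tiled k (oct H W d a b c)" "oct_ok H W d a b c"
  using assms tiled_congruent[OF _ congruent_oct_rotate] by (auto simp: oct_ok_def)

text \<open>In the next two lemmas the corner legs are \<open>q + p / sqrt 2\<close> and width and height are \<open>W0 + W1 / sqrt 2\<close>
  and \<open>H0 + H1 / sqrt 2\<close>.  The premise \<open>X\<close> says that the mixed part of the area vanishes; geometrically, the region is
  the Minkowski sum of a lattice polygon and a lattice polygon rotated by 45 degrees whose mixed area is zero, so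
  one of the two is a point.\<close>

lemma mixed_area_aux:
  fixes W0 W1 H0 H1 qa qb qc qd pa pb pc pd :: nat
  assumes q: "qa + qb \<le> W0" "qc + qd \<le> W0" "qb + qc \<le> H0" "qd + qa \<le> H0"
    and p: "pa + pb \<le> W1" "pc + pd \<le> W1" "pb + pc \<le> H1" "pd + pa \<le> H1"
    and X: "qa * pa + qb * pb = W0 * H1" "qa * pa = qc * pc" "W1 * H0 = W0 * H1"
    and pos: "qa * pa > 0"
  shows "2 * (W0 * H0) \<le> qa\<^sup>2 + qc\<^sup>2 \<and> 2 * (W1 * H1) \<le> pa\<^sup>2 + pc\<^sup>2"
proof -
  have pos': "qa > 0" "pa > 0" "qc > 0" "pc > 0" using pos X(2) by (auto intro!: Nat.gr0I)
  \<comment> \<open>Since \<open>pc > 0\<close>, the bound \<open>pb + pc \<le> H1\<close> makes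
    \<open>pb\<close> smaller than \<open>H1\<close>, so a positive \<open>qb\<close> would push the
    left side of the first equation in \<open>X\<close> below \<open>W0 * H1\<close>.\<close>
  have "qb = 0"
  proof (rule ccontr)
    assume "qb \<noteq> 0"
    moreover have "pb < H1" using p pos' by simp
    ultimately have "qb * pb < qb * H1" by simp
    moreover have "qa * pa \<le> qa * H1" using p by simp
    ultimately have "qa * pa + qb * pb < (qa + qb) * H1" unfolding add_mult_distrib by (rule add_le_less_mono[rotated])
    also have "\<dots> \<le> W0 * H1" using q by simp
    finally show False using X by simp
  qed
  then have A: "qa * pa = W0 * H1" using X by simp
  have eq: "x = u \<and> y = v" if "x * y = u * v" "x \<le> u" "y \<le> v" "x * y > 0" for x y u v :: nat
  proof -
    have "x > 0" "v > 0" using that by (auto intro!: Nat.gr0I)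
    have "x * y \<le> x * v" "x * v \<le> u * v" using that(2,3) by simp_all
    then have "x * y = x * v" "x * v = u * v" using that(1) by (metis le_antisym)+
    then show ?thesis using \<open>x > 0\<close> \<open>v > 0\<close> by (metis mult_cancel1 mult_cancel2 less_irrefl)
  qed
  have 1: "qa = W0 \<and> pa = H1" by (rule eq[OF A]) (use q p pos in auto)
  have 2: "qa = H0 \<and> pa = W1" by (rule eq) (use A X q p pos in \<open>auto simp: mult.commute\<close>)
  have 3: "qc = W0 \<and> pc = H1" by (rule eq) (use A X q p pos in \<open>auto simp: mult.commute\<close>)
  \<comment> \<open>Both boxes are squares that have lost two opposite corners completely; only a
    diagonal segment of area zero is left of each.\<close>
  show ?thesis using 1 2 3 by (simp add: power2_eq_square)
qed

lemma mixed_area: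
  fixes W0 W1 H0 H1 qa qb qc qd pa pb pc pd :: nat
  assumes q: "qa + qb \<le> W0" "qc + qd \<le> W0" "qb + qc \<le> H0" "qd + qa \<le> H0"
    and p: "pa + pb \<le> W1" "pc + pd \<le> W1" "pb + pc \<le> H1" "pd + pa \<le> H1"
    and X: "W0 * H1 + W1 * H0 = qa * pa + qb * pb + qc * pc + qd * pd"
    and area: "4 * (W0 * H0) + 2 * (W1 * H1) > 2 * (qa\<^sup>2 + qb\<^sup>2 + qc\<^sup>2 + qd\<^sup>2) + (pa\<^sup>2 + pb\<^sup>2 + pc\<^sup>2 + pd\<^sup>2)"
  shows "W0 = 0 \<and> H0 = 0 \<or> W1 = 0 \<and> H1 = 0"
proof -
  have le: "x * y + u * v \<le> M * N" if "x + u \<le> M" "y \<le> N" "v \<le> N" for x y u v M N :: nat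
  proof -
    have "x * y + u * v \<le> x * N + u * N" using that by (intro add_mono mult_le_mono) auto
    also have "\<dots> \<le> M * N" using that by (metis add_mult_distrib mult_le_mono1)
    finally show ?thesis .
  qed
  \<comment> \<open>Bounds for complementary pairs of corners, one with \<open>W0 * H1\<close> and
    one with \<open>W1 * H0\<close>, add up to the equation \<open>X\<close>. Hence all of them are
    equalities, and comparing them gives \<open>eqs\<close>.\<close>
  have "qa * pa + qb * pb \<le> W0 * H1" "qc * pc + qd * pd \<le> W0 * H1" using q p by (auto intro!: le)
  moreover have "pa * qa + pb * qb \<le> W1 * H0" "pc * qc + pd * qd \<le> W1 * H0" using q p by (auto intro!: le)
  moreover have "qb * pb + qc * pc \<le> H0 * W1" "qd * pd + qa * pa \<le> H0 * W1" using q p by (auto intro!: le)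
  moreover have "pb * qb + pc * qc \<le> H1 * W0" "pd * qd + pa * qa \<le> H1 * W0" using q p by (auto intro!: le)
  ultimately have eqs: "qa * pa + qb * pb = W0 * H1" "W1 * H0 = W0 * H1" "qa * pa = qc * pc" "qb * pb = qd * pd"
    using X by (simp_all add: mult.commute)
  show ?thesis
  proof (cases "W0 * H1 = 0")
    case True
    then have "W0 * H1 = 0" "W1 * H0 = 0" using eqs by auto
    moreover have False if "W0 = 0" "W1 = 0" using area by (simp add: that)
    moreover have False if "H0 = 0" "H1 = 0" using area by (simp add: that)
    ultimately show ?thesis by auto
  next
    case False
    then consider "qa * pa > 0" | "qb * pb > 0" using eqs(1) by fastforce
    then have "\<not> 4 * (W0 * H0) + 2 * (W1 * H1) > 2 * (qa\<^sup>2 + qb\<^sup>2 + qc\<^sup>2 + qd\<^sup>2) + (pa\<^sup>2 + pb\<^sup>2 + pc\<^sup>2 + pd\<^sup>2)"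
    proof cases
      case 1
      show ?thesis using mixed_area_aux[OF q p eqs(1) eqs(3) eqs(2) 1] by simp
    next
      case 2
      have "2 * (W0 * H0) \<le> qb\<^sup>2 + qd\<^sup>2 \<and> 2 * (W1 * H1) \<le> pb\<^sup>2 + pd\<^sup>2"
        by (rule mixed_area_aux[where qb = qa and qd = qc and pb = pa and pd = pc])
          (use q p eqs 2 in \<open>simp_all add: add.commute\<close>)
      then show ?thesis by simp
    qed
    then show ?thesis using area by blast
  qed
qed

text \<open>The left side is four times the area formula, with \<open>t\<close> standing for
  \<open>1 / sqrt 2\<close>. As \<open>t * t\<close> is \<open>1 / 2\<close>, it separates into a
  part free of \<open>t\<close> and a multiple of \<open>t\<close>.\<close>

lemma mixed_area_expand:
  fixes t :: real
  assumes "2 * (t * t) = 1"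
  shows "4 * ((w0 + w1 * t) * (h0 + h1 * t)) - 2 * ((qa + pa * t)\<^sup>2 + (qb + pb * t)\<^sup>2 + (qc + pc * t)\<^sup>2 + (qd + pd * t)\<^sup>2) =
    (4 * (w0 * h0) + 2 * (w1 * h1) - 2 * (qa\<^sup>2 + qb\<^sup>2 + qc\<^sup>2 + qd\<^sup>2) - (pa\<^sup>2 + pb\<^sup>2 + pc\<^sup>2 + pd\<^sup>2))
    + 4 * (w0 * h1 + w1 * h0 - (qa * pa + qb * pb + qc * pc + qd * pd)) * t"
  using assms by algebra

lemma tiled_oct_integral:
  assumes t: "tiled k (oct W H a b c d)" and ok: "oct_ok W H a b c d" and k: "k > 0"
  obtains W' H' a' b' c' d' :: nat where "congruent (oct W H a b c d) (oct W' H' a' b' c' d')"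
    "oct_ok W' H' a' b' c' d'"
proof -
  \<comment> \<open>Quarter turns carry each side to the bottom and each cut to the corner
    \<open>0\<close>.\<close>
  note r1 = tiled_oct_rotate[OF t ok]
  note r2 = tiled_oct_rotate[OF r1]
  note r3 = tiled_oct_rotate[OF r2]
  obtain m1 n1 qa pa :: nat where s1: "W - a - b = m1 + n1 * sqrt 2" "a = qa + pa / sqrt 2"
    using oct_bottom_sides[OF t ok] by blast
  obtain m2 n2 qd pd :: nat where s2: "H - d - a = m2 + n2 * sqrt 2" "d = qd + pd / sqrt 2"
    using oct_bottom_sides[OF r1] by blast
  obtain m3 n3 qc pc :: nat where s3: "W - c - d = m3 + n3 * sqrt 2" "c = qc + pc / sqrt 2"
    using oct_bottom_sides[OF r2] by blast
  obtain m4 n4 qb pb :: nat where s4: "H - b - c = m4 + n4 * sqrt 2" "b = qb + pb / sqrt 2"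
    using oct_bottom_sides[OF r3] by blast
  note s = s1 s2 s3 s4
  have r: "x * sqrt 2 = 2 * x / sqrt 2" for x by (simp add: field_simps)
  have uniq: "i = i' \<and> j = j'" if "real i + real j / sqrt 2 = real i' + real j' / sqrt 2" for i j i' j' :: nat
  proof -
    have "real_of_int (int i - int i') + real_of_int (int j - int j') / sqrt 2 = 0"
      using that by (simp add: diff_divide_distrib)
    from sqrt2_independent[OF this] show ?thesis by simp
  qed
  \<comment> \<open>The bottom and left sides give these expressions; the factor \<open>2\<close>
    comes from \<open>n * sqrt 2 = 2 * n / sqrt 2\<close>. The top and right sides give a second
    expression each, and \<open>uniq\<close> equates the coefficients.\<close>
  define W0 W1 H0 H1 where "W0 = qa + qb + m1" and "W1 = pa + pb + 2 * n1" and "H0 = qd + qa + m2" and "H1 = pd + pa + 2 * n2"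
  have W: "W = W0 + W1 / sqrt 2" "W = (qc + qd + m3) + (pc + pd + 2 * n3) / sqrt 2"
    and H: "H = H0 + H1 / sqrt 2" "H = (qb + qc + m4) + (pb + pc + 2 * n4) / sqrt 2"
    using s unfolding r W0_def W1_def H0_def H1_def of_nat_add of_nat_mult of_nat_numeral add_divide_distrib
    by linarith+
  have W': "W0 = qc + qd + m3" "W1 = pc + pd + 2 * n3" using uniq W by metis+
  have H': "H0 = qb + qc + m4" "H1 = pb + pc + 2 * n4" using uniq H by metis+
  have area: "W * H - (a\<^sup>2 + b\<^sup>2 + c\<^sup>2 + d\<^sup>2) / 2 = k / 2"
    using measure_oct[OF ok] tiled_measure[OF t] by simp
  \<comment> \<open>The area equation times four reads \<open>A + 4 * B / sqrt 2 = 0\<close>; the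
    term \<open>2 * k\<close> is four times the area \<open>k / 2\<close>.\<close>
  define A B where "A = 4 * (int W0 * int H0) + 2 * (int W1 * int H1) - 2 * ((int qa)\<^sup>2 + (int qb)\<^sup>2 + (int qc)\<^sup>2 + (int qd)\<^sup>2)
       - ((int pa)\<^sup>2 + (int pb)\<^sup>2 + (int pc)\<^sup>2 + (int pd)\<^sup>2) - 2 * int k"
    and "B = int W0 * int H1 + int W1 * int H0 - (int qa * int pa + int qb * int pb + int qc * int pc + int qd * int pd)"
  have "real_of_int A + real_of_int (4 * B) / sqrt 2 = 0"
  proof -
    define t where "t = 1 / sqrt 2"
    have tt: "2 * (t * t) = 1" by (simp add: t_def)
    have e: "W = W0 + W1 * t" "H = H0 + H1 * t" "a = qa + pa * t" "b = qb + pb * t" "c = qc + pc * t" "d = qd + pd * t"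
      using W(1) H(1) s by (simp_all add: t_def)
    have "4 * (W * H) - 2 * (a\<^sup>2 + b\<^sup>2 + c\<^sup>2 + d\<^sup>2) - 2 * real k = 0" using area by linarith
    then have "real_of_int A + real_of_int (4 * B) * t = 0"
      unfolding e mixed_area_expand[OF tt] by (simp add: A_def B_def)
    then show ?thesis by (simp add: t_def)
  qed
  from sqrt2_independent[OF this] have "A = 0" "B = 0" by simp_all
  have "int (W0 * H1 + W1 * H0) = int (qa * pa + qb * pb + qc * pc + qd * pd)"
    using \<open>B = 0\<close> unfolding B_def by simp
  then have X: "W0 * H1 + W1 * H0 = qa * pa + qb * pb + qc * pc + qd * pd" by (simp only: of_nat_eq_iff)
  have "int (4 * (W0 * H0) + 2 * (W1 * H1)) = int (2 * (qa\<^sup>2 + qb\<^sup>2 + qc\<^sup>2 + qd\<^sup>2) + (pa\<^sup>2 + pb\<^sup>2 + pc\<^sup>2 + pd\<^sup>2) + 2 * k)"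
    using \<open>A = 0\<close> unfolding A_def by simp
  then have Y: "4 * (W0 * H0) + 2 * (W1 * H1) = 2 * (qa\<^sup>2 + qb\<^sup>2 + qc\<^sup>2 + qd\<^sup>2) + (pa\<^sup>2 + pb\<^sup>2 + pc\<^sup>2 + pd\<^sup>2) + 2 * k"
    by (simp only: of_nat_eq_iff)
  have "qa + qb \<le> W0" "pa + pb \<le> W1" "qd + qa \<le> H0" "pd + pa \<le> H1"
    by (simp_all add: W0_def W1_def H0_def H1_def)
  moreover have "qc + qd \<le> W0" "pc + pd \<le> W1" "qb + qc \<le> H0" "pb + pc \<le> H1"
    unfolding W' H' by simp_all
  moreover have "2 * (qa\<^sup>2 + qb\<^sup>2 + qc\<^sup>2 + qd\<^sup>2) + (pa\<^sup>2 + pb\<^sup>2 + pc\<^sup>2 + pd\<^sup>2) < 4 * (W0 * H0) + 2 * (W1 * H1)"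
    unfolding Y using k by simp
  ultimately have "W0 = 0 \<and> H0 = 0 \<or> W1 = 0 \<and> H1 = 0"
    using X by (intro mixed_area[of qa qb W0 qc qd H0 pa pb W1 pc pd H1])
  then show thesis
  proof
    assume *: "W1 = 0 \<and> H1 = 0"
    then have "pa = 0" "pb = 0" "pc = 0" "pd = 0" using W' H' by (auto simp: W1_def H1_def)
    then have "W = W0" "H = H0" "a = qa" "b = qb" "c = qc" "d = qd" using W(1) H(1) s * by simp_all
    then show thesis using that[of W0 H0 qa qb qc qd] ok congruent_refl by simp
  next
    \<comment> \<open>Width, height and cut legs are now multiples of \<open>1 / sqrt 2\<close>. The
      rotation by 45 degrees turns the old sides, of lengths \<open>n1 * sqrt 2\<close> to
      \<open>n4 * sqrt 2\<close>, into cuts with integral legs.\<close>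
    assume *: "W0 = 0 \<and> H0 = 0"
    then have z: "qa = 0" "qb = 0" "qc = 0" "qd = 0" "m1 = 0" "m2 = 0" "m3 = 0" "m4 = 0" using W' H' by (auto simp: W0_def H0_def)
    have half: "x / sqrt 2 / sqrt 2 = x / 2" for x by (simp add: field_simps)
    have sp: "(x + y + 2 * u) / sqrt 2 = x / sqrt 2 + y / sqrt 2 + 2 * (u / sqrt 2)" for x y u
      by (simp add: add_divide_distrib)
    have e: "(W - a - b) / sqrt 2 = n1" "(H - d - a) / sqrt 2 = n2" "(W - c - d) / sqrt 2 = n3" "(H - b - c) / sqrt 2 = n4"
      using s z by simp_all
    have "(W + H - b - d) / sqrt 2 = real (n1 + n2 + pa)"
    proof -
      have "(W + H - b - d) / sqrt 2 = ((W - a - b) + (H - d - a) + 2 * a) / sqrt 2" by simp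
      also have "\<dots> = n1 + n2 + 2 * (a / sqrt 2)" unfolding sp e by simp
      also have "a / sqrt 2 = pa / 2" using s(2) z by (simp add: half)
      finally show ?thesis by simp
    qed
    moreover have "(W + H - a - c) / sqrt 2 = real (n1 + n4 + pb)"
    proof -
      have "(W + H - a - c) / sqrt 2 = ((W - a - b) + (H - b - c) + 2 * b) / sqrt 2" by simp
      also have "\<dots> = n1 + n4 + 2 * (b / sqrt 2)" unfolding sp e by simp
      also have "b / sqrt 2 = pb / 2" using s(8) z by (simp add: half)
      finally show ?thesis by simp
    qed
    ultimately have cong: "congruent (oct W H a b c d) (oct (n1 + n2 + pa) (n1 + n4 + pb) n2 n1 n4 n3)"
      using congruent_oct_rotate45[of W H a b c d] e by simp
    have "n2 + n1 \<le> n1 + n2 + pa" "n1 + n4 \<le> n1 + n4 + pb" by simp_all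
    moreover have "n4 + n3 \<le> n1 + n2 + pa" "n3 + n2 \<le> n1 + n4 + pb"
      using W' H' unfolding W1_def H1_def by linarith+
    ultimately have "oct_ok (n1 + n2 + pa) (n1 + n4 + pb) n2 n1 n4 n3"
      unfolding oct_ok_def by (simp flip: of_nat_add)
    then show thesis using that cong by blast
  qed
qed

section \<open>Enumeration of the twenty shapes\<close>

type_synonym octuple = "int \<times> int \<times> int \<times> int \<times> int \<times> int"

fun octi :: "octuple \<Rightarrow> complex set" where
  "octi (W, H, a, b, c, d) = oct W H a b c d"

fun rot6 :: "octuple \<Rightarrow> octuple" where
  "rot6 (W, H, a, b, c, d) = (H, W, d, a, b, c)"

fun refl6 :: "octuple \<Rightarrow> octuple" where
  "refl6 (W, H, a, b, c, d) = (W, H, b, a, d, c)"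

text \<open>The descriptions of one polygon under the eight symmetries generated by the quarter turn
  and the mirror image.\<close>

definition orbit :: "octuple \<Rightarrow> octuple list" where
  "orbit s = concat (map (\<lambda>t. [t, rot6 t, rot6 (rot6 t), rot6 (rot6 (rot6 t))]) [s, refl6 s])"

text \<open>Every entry has \<open>H \<le> W\<close>, the normalisation of the enumeration. The
  order is that of the rows of \<open>puzzle_placements\<close>.\<close>

definition formed_shapes :: "octuple list" where
  "formed_shapes = [(8,1,0,0,0,0), (3,3,1,0,1,0), (3,3,1,1,0,0), (4,2,0,0,0,0), (4,3,2,0,2,0), (4,3,2,2,0,0),
     (4,4,2,2,2,2), (4,4,4,0,0,0), (5,2,1,1,1,1), (5,2,2,0,0,0), (5,3,3,1,2,0), (5,3,3,2,1,0),
     (5,5,4,1,4,1), (5,5,5,0,3,0), (6,2,2,0,2,0), (6,2,2,2,0,0), (6,4,4,0,4,0), (9,1,1,0,1,0), (9,1,1,1,0,0)]"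

text \<open>The added entry is the thin parallelogram: the part of the strip between the lines
  \<open>Re z + Im z = 8\<close> and \<open>Re z + Im z = 9\<close> with \<open>Im z\<close> from
  \<open>0\<close> to \<open>8\<close>.\<close>

definition all_shapes :: "octuple list" where
  "all_shapes = (9,8,8,0,8,0) # formed_shapes"

text \<open>Given \<open>a\<close> and \<open>d\<close>, the area equation prescribes
  \<open>s\<close> as the value of \<open>b * b + c * c\<close>. Because of
  \<open>b + c \<le> H\<close> it must lie between \<open>0\<close> and \<open>H * H\<close>, which
  prunes the search before \<open>b\<close> and \<open>c\<close> are enumerated.\<close>

definition enum_check :: "int \<Rightarrow> int \<Rightarrow> bool" where
  "enum_check W H = list_all (\<lambda>a. list_all (\<lambda>d. let s = 2*W*H-16-a*a-d*d in s < 0 \<or> H*H < s \<or> 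
     list_all (\<lambda>b. list_all (\<lambda>c. b*b+c*c \<noteq> s \<or> W < a+b \<or> W < c+d \<or>
       list_ex (\<lambda>t. (W,H,a,b,c,d) \<in> set (orbit t)) all_shapes) [0..H-b]) [0..H]) [0..H-a]) [0..H]"

definition bound_pairs :: "(int \<times> int) list" where
  "bound_pairs = filter (\<lambda>(W, H). H * (W - H) \<le> 8 \<and> (W = H \<longrightarrow> W \<le> 8)) (concat (map (\<lambda>W. map (\<lambda>H. (W, H)) [1..W]) [1..9]))"

lemma bound_pairs_check: "list_all (\<lambda>(W,H). enum_check W H) bound_pairs"
  by code_simp

text \<open>The extreme case is \<open>a = M - 1\<close>, \<open>b = 1\<close>. For positive
  \<open>a\<close> and \<open>b\<close> the bound comes from
  \<open>(a - 1) * (b - 1) \<ge> 0\<close>.\<close>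

lemma two_squares_bound:
  fixes a b M :: int
  assumes "0 \<le> a" "0 \<le> b" "a + b \<le> M" "a < M" "b < M"
  shows "a * a + b * b \<le> (M - 1) * (M - 1) + 1"
proof (cases "a = 0 \<or> b = 0")
  case True
  have "a * a \<le> (M - 1) * (M - 1)" "b * b \<le> (M - 1) * (M - 1)" using assms by (auto intro!: mult_mono)
  then show ?thesis using True by auto
next
  case False
  then have "0 \<le> (a - 1) * (b - 1)" using assms by simp
  moreover have "(a + b - 1) * (a + b - 1) \<le> (M - 1) * (M - 1)" using assms False by (intro mult_mono) auto
  moreover have "a * a + b * b = (a + b - 1) * (a + b - 1) + 1 - 2 * ((a - 1) * (b - 1))" by (simp add: algebra_simps)
  ultimately show ?thesis by linarith
qed

text \<open>In \<open>(W - c) * (W + c) = 16\<close> the first factor is not \<open>1\<close> by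
  parity, so it is at least \<open>2\<close> and \<open>W + c \<le> 8\<close>.\<close>

lemma full_side_bound:
  fixes W c :: int
  assumes "0 \<le> c" "c \<le> W" "W * W - c * c = 16"
  shows "W \<le> 8"
proof -
  have "c \<noteq> W" using assms(3) by auto
  then have "1 * (W + c) \<le> (W - c) * (W + c)" using assms by (intro mult_right_mono) auto
  then have "W + c \<le> 16" using assms(3) by (simp add: algebra_simps)
  show ?thesis
  proof (cases "W - c = 1")
    case True
    then have "c = W - 1" by simp
    then have "W * W - (W - 1) * (W - 1) = 16" using assms(3) by simp
    then have "2 * W - 1 = 16" by (simp add: algebra_simps)
    then show ?thesis by presburger
  next
    case False
    then have "2 * (W + c) \<le> (W - c) * (W + c)" using assms \<open>c \<noteq> W\<close> by (intro mult_right_mono) auto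
    then show ?thesis using assms by (simp add: algebra_simps)
  qed
qed

text \<open>The two cuts at each vertical side contribute at most \<open>H * H\<close> to the area
  equation, hence \<open>H * (W - H) \<le> 8\<close>. For \<open>H < W\<close> the inequality
  \<open>(H - 1) * (W - H - 1) \<ge> 0\<close> turns this into \<open>W \<le> 9\<close>. For
  \<open>W = H\<close> it says nothing, and the size of the cuts has to be estimated more
  sharply.\<close>

lemma oct_bounds:
  fixes W H a b c d :: int
  assumes nn: "0 \<le> a" "0 \<le> b" "0 \<le> c" "0 \<le> d"
    and ok: "a + b \<le> W" "b + c \<le> H" "c + d \<le> W" "d + a \<le> H"
    and area: "2 * W * H - (a * a + b * b + c * c + d * d) = 16" and le: "H \<le> W"
  shows "(W, H) \<in> set bound_pairs"
proof -
  have sq: "x * x + y * y \<le> H * H" if "0 \<le> x" "0 \<le> y" "x + y \<le> H" for x y :: int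
  proof -
    have "(x + y) * (x + y) \<le> H * H" using that by (intro mult_mono) auto
    moreover have "0 \<le> x * y" using that by simp
    ultimately show ?thesis by (simp add: algebra_simps)
  qed
  have "a * a + d * d \<le> H * H" "b * b + c * c \<le> H * H" using sq nn ok by (auto simp: add.commute)
  then have HW: "H * (W - H) \<le> 8" using area by (simp add: algebra_simps)
  have "H \<noteq> 0"
  proof
    assume "H = 0"
    then have "a = 0" "b = 0" "c = 0" "d = 0" using nn ok by auto
    then show False using area \<open>H = 0\<close> by simp
  qed
  then have H: "1 \<le> H" using nn ok by linarith
  have "W \<le> 9 \<and> (W = H \<longrightarrow> W \<le> 8)"
  proof (cases "W = H")
    case True
    have "W \<le> 8"
    \<comment> \<open>A cut along a whole side of the square forces both neighbouring cuts to vanish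
      and leaves a difference of two squares equal to \<open>16\<close>.\<close>
    proof (cases "a = W \<or> b = W \<or> c = W \<or> d = W")
      case True
      have fin: "W \<le> 8" if "x = W" "0 \<le> y" "y \<le> W" "2 * W * W - (x * x + y * y) = 16" for x y
        using full_side_bound[of y W] that by simp
      from True show ?thesis
      proof (elim disjE)
        assume "a = W"
        moreover from this have "b = 0" "d = 0" using ok nn \<open>W = H\<close> by auto
        ultimately show ?thesis using fin[of a c] area nn ok \<open>W = H\<close> by auto
      next
        assume "b = W"
        moreover from this have "a = 0" "c = 0" using ok nn \<open>W = H\<close> by auto
        ultimately show ?thesis using fin[of b d] area nn ok \<open>W = H\<close> by auto
      next
        assume "c = W"
        moreover from this have "b = 0" "d = 0" using ok nn \<open>W = H\<close> by auto
        ultimately show ?thesis using fin[of c a] area nn ok \<open>W = H\<close> by auto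
      next
        assume "d = W"
        moreover from this have "a = 0" "c = 0" using ok nn \<open>W = H\<close> by auto
        ultimately show ?thesis using fin[of d b] area nn ok \<open>W = H\<close> by auto
      qed
    next
      case False
      then have "a * a + b * b \<le> (W - 1) * (W - 1) + 1" "c * c + d * d \<le> (W - 1) * (W - 1) + 1"
        using nn ok \<open>W = H\<close> by (auto intro!: two_squares_bound)
      then have "2 * (W * W) - 16 \<le> 2 * ((W - 1) * (W - 1) + 1)" using area \<open>W = H\<close> by simp
      then show ?thesis by (simp add: algebra_simps)
    qed
    then show ?thesis by simp
  next
    case False
    have "0 \<le> (H - 1) * (W - H - 1)" using H False le by simp
    then show ?thesis using HW False by (simp add: algebra_simps)
  qed
  then show ?thesis using HW H le by (auto simp: bound_pairs_def intro!: bexI[of _ W])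
qed

lemma enum_sound:
  fixes W H a b c d :: int
  assumes nn: "0 \<le> a" "0 \<le> b" "0 \<le> c" "0 \<le> d"
    and ok: "a + b \<le> W" "b + c \<le> H" "c + d \<le> W" "d + a \<le> H"
    and area: "2 * W * H - (a * a + b * b + c * c + d * d) = 16" and le: "H \<le> W"
  shows "\<exists>t\<in>set all_shapes. (W, H, a, b, c, d) \<in> set (orbit t)"
proof -
  have "enum_check W H"
    using bound_pairs_check oct_bounds[OF assms] by (auto simp: list_all_iff)
  define s where "s = 2*W*H-16-a*a-d*d"
  have s: "b * b + c * c = s" using area by (simp add: s_def)
  have "(b + c) * (b + c) \<le> H * H" using nn ok by (intro mult_mono) auto
  moreover have "0 \<le> b * c" using nn by simp
  ultimately have "s \<le> H * H" unfolding s[symmetric] by (simp add: algebra_simps)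
  moreover have "0 \<le> s" unfolding s[symmetric] by simp
  moreover have "a \<in> set [0..H]" "d \<in> set [0..H-a]" "b \<in> set [0..H]" "c \<in> set [0..H-b]" using nn ok by auto
  ultimately have "list_ex (\<lambda>t. (W,H,a,b,c,d) \<in> set (orbit t)) all_shapes"
    using \<open>enum_check W H\<close> s ok unfolding enum_check_def list_all_iff Let_def s_def[symmetric]
    by (metis not_le s_def)
  then show ?thesis by (auto simp: list_ex_iff)
qed

lemma congruent_rot6: "congruent (octi t) (octi (rot6 t))"
  by (cases t) (simp add: congruent_oct_rotate)

lemma congruent_refl6: "congruent (octi t) (octi (refl6 t))"
  using congruent_oct_reflect by (cases t) simp

lemma congruent_orbit:
  assumes "t \<in> set (orbit s)"
  shows "congruent (octi s) (octi t)"
proof -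
  note r = congruent_rot6
  note r2 = congruent_trans[OF r r]
  note r3 = congruent_trans[OF r2 r]
  note f = congruent_trans[OF congruent_refl6]
  show ?thesis using assms unfolding orbit_def
    by (auto intro: congruent_refl r r2 r3 congruent_refl6 f[OF r] f[OF r2] f[OF r3])
qed

lemma tiled_16_shape:
  assumes "tiled 16 P"
  shows "\<exists>t\<in>set all_shapes. congruent P (octi t)"
proof -
  obtain W H a b c d where 1: "oct_ok W H a b c d" "congruent P (oct W H a b c d)"
    using tiled_congruent_oct[OF assms] .
  then have t1: "tiled 16 (oct W H a b c d)" using assms tiled_congruent by blast
  obtain W' H' a' b' c' d' :: nat where 2: "congruent (oct W H a b c d) (oct W' H' a' b' c' d')" "oct_ok W' H' a' b' c' d'"
    using tiled_oct_integral[OF t1 1(1)] by (metis zero_less_numeral)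
  then have "measure lebesgue (oct W' H' a' b' c' d') = 8"
    using tiled_measure[OF tiled_congruent[OF t1 2(1)]] by simp
  then have "real W' * real H' - (real a' ^ 2 + real b' ^ 2 + real c' ^ 2 + real d' ^ 2) / 2 = 8"
    using measure_oct[OF 2(2)] by simp
  then have "2 * (real W' * real H') - (real a' ^ 2 + real b' ^ 2 + real c' ^ 2 + real d' ^ 2) = 16"
    by (simp add: field_simps)
  then have "real_of_int (2 * int W' * int H' - (int a' * int a' + int b' * int b' + int c' * int c' + int d' * int d')) = 16"
    by (simp add: power2_eq_square)
  then have area: "2 * int W' * int H' - (int a' * int a' + int b' * int b' + int c' * int c' + int d' * int d') = 16"
    by linarith
  have ok: "int a' + int b' \<le> int W'" "int b' + int c' \<le> int H'" "int c' + int d' \<le> int W'" "int d' + int a' \<le> int H'"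
    using 2(2) by (simp_all add: oct_ok_def flip: of_nat_add)
  have "\<exists>t\<in>set all_shapes. congruent (octi (int W', int H', int a', int b', int c', int d')) (octi t)"
  \<comment> \<open>A quarter turn exchanges width and height, so the enumeration may be confined to
    \<open>H \<le> W\<close>.\<close>
  proof (cases "H' \<le> W'")
    case True
    then have "\<exists>t\<in>set all_shapes. (int W', int H', int a', int b', int c', int d') \<in> set (orbit t)"
      using ok area by (intro enum_sound) auto
    then show ?thesis using congruent_sym[OF congruent_orbit] by blast
  next
    case False
    then have "\<exists>t\<in>set all_shapes. rot6 (int W', int H', int a', int b', int c', int d') \<in> set (orbit t)"
      unfolding rot6.simps using ok area by (intro enum_sound) (auto simp: algebra_simps)
    then show ?thesis using congruent_trans[OF congruent_rot6 congruent_sym[OF congruent_orbit]] by blast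
  qed
  then obtain t where "t \<in> set all_shapes" "congruent (oct W' H' a' b' c' d') (octi t)" by auto
  then show ?thesis using congruent_trans[OF congruent_trans[OF 1(2) 2(1)]] by blast
qed

section \<open>The thin rectangle and the thin parallelogram\<close>

text \<open>The ends of the hypotenuse are the only two points of \<open>T0\<close> at distance
  \<open>sqrt 2\<close>, and the right-angled vertex is the only point of \<open>T0\<close> at
  distance \<open>1\<close> from both.\<close>

lemma isometry_T0_self:
  assumes "plane_isometry F" "F ` T0 = T0"
  shows "F 0 = 0" "{F 1, F \<i>} = {1, \<i>}"
proof -
  have in0: "0 \<in> T0" "1 \<in> T0" "\<i> \<in> T0" by (simp_all add: T0_eq)
  have mem: "F 0 \<in> T0" "F 1 \<in> T0" "F \<i> \<in> T0" using assms(2) in0 by blast+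
  have far: "{p, q} = {1, \<i>}" if "p \<in> T0" "q \<in> T0" "(dist p q)\<^sup>2 = 2" for p q
  proof -
    define x y where "x = Re p - Re q" and "y = Im p - Im q"
    have "x\<^sup>2 + y\<^sup>2 = 2" using that(3) by (simp add: dist_norm cmod_power2 x_def y_def)
    moreover have "\<bar>x\<bar> \<le> 1" "\<bar>y\<bar> \<le> 1" using that(1,2) by (auto simp: T0_eq x_def y_def)
    then have "x\<^sup>2 \<le> 1" "y\<^sup>2 \<le> 1" by (simp_all add: abs_square_le_1)
    ultimately have "x\<^sup>2 = 1" "y\<^sup>2 = 1" by linarith+
    then have "(x = 1 \<or> x = - 1) \<and> (y = 1 \<or> y = - 1)" by (simp add: power2_eq_1_iff)
    then show ?thesis using that(1,2) by (auto simp: T0_eq x_def y_def complex_eq_iff)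
  qed
  have d: "dist (F 1) (F \<i>) = sqrt 2" "dist (F 0) (F 1) = 1" "dist (F 0) (F \<i>) = 1"
    using assms(1) by (simp_all add: plane_isometry_def dist_norm cmod_def)
  show *: "{F 1, F \<i>} = {1, \<i>}" by (rule far) (use mem d in auto)
  have "{dist (F 0) (F 1), dist (F 0) (F \<i>)} = (\<lambda>z. dist (F 0) z) ` {F 1, F \<i>}" by simp
  then have "dist (F 0) 1 = 1" "dist (F 0) \<i> = 1" unfolding * d by auto
  then have "(dist (F 0) 1)\<^sup>2 = 1" "(dist (F 0) \<i>)\<^sup>2 = 1" by simp_all
  then have e: "(Re (F 0) - 1)\<^sup>2 + (Im (F 0))\<^sup>2 = 1" "(Re (F 0))\<^sup>2 + (Im (F 0) - 1)\<^sup>2 = 1"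
    by (simp_all add: dist_norm cmod_power2)
  then have "Re (F 0) = Im (F 0)" by (simp add: power2_eq_square algebra_simps)
  then have "Re (F 0) * (Re (F 0) - 1) = 0" using e by (simp add: power2_eq_square algebra_simps)
  then have "Re (F 0) = 0" using \<open>Re (F 0) = Im (F 0)\<close> mem(1) by (auto simp: T0_eq)
  then show "F 0 = 0" using \<open>Re (F 0) = Im (F 0)\<close> by (simp add: complex_eq_iff)
qed

text \<open>The first two points belong to the legs, the third to the hypotenuse. They serve as
  names of the edges that can be followed through isometries.\<close>

definition edge_mids :: "complex set" where
  "edge_mids = {Complex (1/2) 0, Complex 0 (1/2), Complex (1/2) (1/2)}"

lemma isometry_same_T0:
  assumes "plane_isometry f" "plane_isometry g" "f ` T0 = g ` T0"
  shows "f 0 = g 0" "{f 1, f \<i>} = {g 1, g \<i>}"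
proof -
  obtain h where h: "plane_isometry h" "\<And>z. h (g z) = z" "\<And>z. g (h z) = z"
    using plane_isometry_inverse[OF assms(2)] by metis
  have "(h \<circ> f) ` T0 = h ` (g ` T0)" unfolding image_comp[symmetric] assms(3) ..
  also have "\<dots> = T0" by (simp add: image_image h(2))
  finally have 1: "(h \<circ> f) ` T0 = T0" .
  have 2: "plane_isometry (h \<circ> f)" using h(1) assms(1) by (rule plane_isometry_comp)
  show "f 0 = g 0" using isometry_T0_self(1)[OF 2 1] h(3) by (metis comp_apply)
  have "g ` {(h \<circ> f) 1, (h \<circ> f) \<i>} = g ` {1, \<i>}" unfolding isometry_T0_self(2)[OF 2 1] ..
  then show "{f 1, f \<i>} = {g 1, g \<i>}" by (simp add: h(3))
qed

lemma isometry_mids: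
  assumes "plane_isometry f"
  shows "f ` edge_mids = {(f 0 + f 1) / 2, (f 0 + f \<i>) / 2, (f 1 + f \<i>) / 2}"
    "f (Complex (1/2) (1/2)) = (f 1 + f \<i>) / 2" "f (Complex (1/2) 0) = (f 0 + f 1) / 2" "f (Complex 0 (1/2)) = (f 0 + f \<i>) / 2"
proof -
  obtain c where "\<And>r s. f (Complex r s) = f 0 + of_real r * (f 1 - f 0) + of_real s * (f \<i> - f 0)"
    using isometry_T0[OF assms] by metis
  note * = this[of "1/2" 0] this[of 0 "1/2"] this[of "1/2" "1/2"]
  show 1: "f (Complex (1/2) (1/2)) = (f 1 + f \<i>) / 2" "f (Complex (1/2) 0) = (f 0 + f 1) / 2" "f (Complex 0 (1/2)) = (f 0 + f \<i>) / 2"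
    unfolding * by (simp_all add: field_simps)
  show "f ` edge_mids = {(f 0 + f 1) / 2, (f 0 + f \<i>) / 2, (f 1 + f \<i>) / 2}"
    unfolding edge_mids_def image_insert image_empty 1 ..
qed

text \<open>Isometries with the same image of \<open>T0\<close> may differ by its symmetry, but the
  tile determines its set of edge midpoints.\<close>

lemma isometry_same_mids:
  assumes "plane_isometry f" "plane_isometry g" "f ` T0 = g ` T0"
  shows "f ` edge_mids = g ` edge_mids"
  using isometry_same_T0[OF assms] unfolding isometry_mids(1)[OF assms(1)] isometry_mids(1)[OF assms(2)]
  by (auto simp: doubleton_eq_iff add.commute)

lemma edge_pt_mid:
  assumes "plane_isometry f" "m \<in> edge_mids"
  shows "\<exists>n. edge_pt (f ` T0) n (f m)"
proof -
  obtain c where c: "cmod c = 1" "f ` T0 = tile (f 0) c" 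
    "f 1 = f 0 + c \<and> f \<i> = f 0 + \<i> * c \<or> f 1 = f 0 + \<i> * c \<and> f \<i> = f 0 + c"
    using isometry_T0[OF assms(1)] by metis
  have h: "0 < 1 / (2::real)" "1 / (2::real) < 1" by simp_all
  have e: "f 0 + of_real (1/2) * c = (f 0 + (f 0 + c)) / 2" "f 0 + of_real (1/2) * (\<i> * c) = (f 0 + (f 0 + \<i> * c)) / 2"
    "f 0 + of_real (1/2) * c + of_real (1 - 1/2) * (\<i> * c) = ((f 0 + c) + (f 0 + \<i> * c)) / 2"
    by (simp_all add: field_simps)
  have "f m \<in> {(f 0 + (f 0 + c)) / 2, (f 0 + (f 0 + \<i> * c)) / 2, ((f 0 + c) + (f 0 + \<i> * c)) / 2}"
    using imageI[OF assms(2), of f] c(3) unfolding isometry_mids(1)[OF assms(1)] by (auto simp: add.commute add.left_commute)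
  then consider "f m = (f 0 + (f 0 + c)) / 2" | "f m = (f 0 + (f 0 + \<i> * c)) / 2"
    | "f m = ((f 0 + c) + (f 0 + \<i> * c)) / 2" by blast
  then show ?thesis
  proof cases
    case 1
    then show ?thesis using edge_pt_leg1[OF c(1) h, of "f 0"] unfolding c(2) e 1 by blast
  next
    case 2
    then show ?thesis using edge_pt_leg2[OF c(1) h, of "f 0"] unfolding c(2) e 2 by blast
  next
    case 3
    then show ?thesis using edge_pt_hyp[OF c(1) h, of "f 0"] unfolding c(2) 3 e(3)[symmetric] by blast
  qed
qed

text \<open>The definition of \<open>glued\<close> brings its own isometries. Equal edges have equal
  midpoints, so the gluing can be expressed through a prescribed \<open>F\<close>, and several
  gluings of the same tile become comparable.\<close>

lemma glued_common_mid:
  assumes "glued s t" "s = F ` T0" "plane_isometry F" "interior s \<inter> interior t = {}"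
  obtains m n where "m \<in> edge_mids" "edge_pt s n (F m)" "edge_pt t (- n) (F m)"
proof -
  obtain f g e e' where fg: "plane_isometry f" "plane_isometry g" "s = f ` T0" "t = g ` T0"
    "e \<in> T0_edges" "e' \<in> T0_edges" "f ` e = g ` e'"
    using assms(1) unfolding glued_def by blast
  have mid: "\<exists>p q m. h ` e = closed_segment p q \<and> m \<in> edge_mids \<and> h m = (p + q) / 2"
    if "plane_isometry h" "e \<in> T0_edges" for h e
  proof -
    have "e = closed_segment 0 1 \<or> e = closed_segment 0 \<i> \<or> e = closed_segment 1 \<i>" using that(2) by (simp add: T0_edges_def)
    then show ?thesis
      using isometry_mids(2-4)[OF that(1)] isometry_segment[OF that(1)] unfolding edge_mids_def by blast
  qed
  obtain p q m where 1: "f ` e = closed_segment p q" "m \<in> edge_mids" "f m = (p + q) / 2"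
    using mid[OF fg(1,5)] by blast
  obtain p' q' m' where 2: "g ` e' = closed_segment p' q'" "m' \<in> edge_mids" "g m' = (p' + q') / 2"
    using mid[OF fg(2,6)] by blast
  have "{p, q} = {p', q'}" using 1(1) 2(1) fg(7) closed_segment_eq by metis
  then have eq: "f m = g m'" unfolding 1(3) 2(3) by (auto simp: doubleton_eq_iff add.commute)
  obtain n where n: "edge_pt s n (f m)" using edge_pt_mid[OF fg(1) 1(2)] fg(3) by blast
  obtain n' where n': "edge_pt t n' (f m)" using edge_pt_mid[OF fg(2) 2(2)] fg(4) eq by metis
  have "n' = - n" by (rule edge_pt_opposite[OF n n' assms(4)])
  moreover have "f m \<in> F ` edge_mids"
    using isometry_same_mids[OF fg(1) assms(3)] fg(3) assms(2) 1(2) by blast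
  then obtain m2 where "m2 \<in> edge_mids" "f m = F m2" by blast
  ultimately show thesis using that n n' by metis
qed

text \<open>The packing half of \<open>composed_of\<close>, from which tilings of formed polygons
  are built; the condition on gluing is kept apart in \<open>glue_connected\<close>.\<close>

definition tiles_of :: "complex set set \<Rightarrow> complex set \<Rightarrow> bool" where
  "tiles_of Ts A \<longleftrightarrow> finite Ts \<and> Ts \<noteq> {} \<and> (\<forall>t\<in>Ts. congruent T0 t) \<and>
      (\<forall>s\<in>Ts. \<forall>t\<in>Ts. s \<noteq> t \<longrightarrow> interior s \<inter> interior t = {}) \<and> \<Union>Ts = A"

definition glue_connected :: "complex set set \<Rightarrow> bool" where
  "glue_connected Ts \<longleftrightarrow> (\<forall>s\<in>Ts. \<forall>t\<in>Ts. (s, t) \<in> {(a, b). a \<in> Ts \<and> b \<in> Ts \<and> glued a b}\<^sup>*)"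

lemma composed_of_iff: "composed_of n P \<longleftrightarrow> (\<exists>Ts. tiles_of Ts P \<and> glue_connected Ts \<and> card Ts = n)"
  unfolding composed_of_def tiles_of_def glue_connected_def by blast

text \<open>If every tile had at most one neighbour, a tile together with its neighbour would be
  closed under gluing, and connectivity would leave at most two tiles.\<close>

lemma composed_two_neighbours:
  assumes card: "card Ts \<ge> 3" and "glue_connected Ts"
  obtains s t t' where "s \<in> Ts" "t \<in> Ts" "t' \<in> Ts" "s \<noteq> t" "s \<noteq> t'" "t \<noteq> t'" "glued s t" "glued s t'"
proof (rule ccontr)
  note found = that
  have conn: "\<forall>s\<in>Ts. \<forall>t\<in>Ts. (s, t) \<in> {(a, b). a \<in> Ts \<and> b \<in> Ts \<and> glued a b}\<^sup>*"
    using assms(2) by (simp add: glue_connected_def)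
  assume none: "\<not> thesis"
  have sym: "glued b a" if "glued a b" for a b using that unfolding glued_def by metis
  have uniq: "t = t'" if "s \<in> Ts" "t \<in> Ts" "t' \<in> Ts" "s \<noteq> t" "s \<noteq> t'" "glued s t" "glued s t'" for s t t'
    using that none found[of s t t'] by blast
  let ?R = "{(a, b). a \<in> Ts \<and> b \<in> Ts \<and> glued a b}"
  obtain s where s: "s \<in> Ts" using card by fastforce
  have "\<exists>A. s \<in> A \<and> card A \<le> 2 \<and> finite A \<and> (\<forall>a\<in>A. \<forall>b. (a, b) \<in> ?R \<longrightarrow> b \<in> A)"
  proof (cases "\<exists>t\<in>Ts. t \<noteq> s \<and> glued s t")
    case True
    then obtain t where t: "t \<in> Ts" "t \<noteq> s" "glued s t" by blast
    have "b \<in> {s, t}" if ab: "a \<in> {s, t}" "(a, b) \<in> ?R" for a b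
    proof (rule ccontr)
      assume b: "b \<notin> {s, t}"
      have "b \<in> Ts" "glued a b" using ab(2) by auto
      then show False
        using b ab(1) uniq[of s t b] uniq[of t s b] t s sym[OF t(3)] by auto
    qed
    moreover have "card {s, t} \<le> 2" using t by simp
    ultimately show ?thesis by (intro exI[of _ "{s, t}"]) auto
  next
    case False
    then show ?thesis by (intro exI[of _ "{s}"]) auto
  qed
  then obtain A where A: "s \<in> A" "card A \<le> 2" "finite A" "\<And>a b. a \<in> A \<Longrightarrow> (a, b) \<in> ?R \<Longrightarrow> b \<in> A" by blast
  have reach: "x \<in> A" if "(s, x) \<in> ?R\<^sup>*" for x
    using that by (induction rule: rtrancl_induct) (use A(1,4) in blast)+
  have "Ts \<subseteq> A"
  proof
    fix x assume "x \<in> Ts"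
    then show "x \<in> A" using bspec[OF bspec[OF conn s]] reach by simp
  qed
  then have "card Ts \<le> 2" using A card_mono by (metis le_trans)
  then show False using card by simp
qed

text \<open>All tiles of all placed pieces are collected. Tiles of different pieces are distinct,
  since their interiors are nonempty and disjoint, so the numbers of tiles add up.\<close>

lemma can_form_tiling:
  fixes k :: nat
  assumes tiles: "\<And>i. i < k \<Longrightarrow> tiles_of (Ts i) (S i)"
    and g: "\<And>i. i < k \<Longrightarrow> plane_isometry (g i)"
    and disj: "\<And>i j. i < k \<Longrightarrow> j < k \<Longrightarrow> i \<noteq> j \<Longrightarrow> interior (g i ` S i) \<inter> interior (g j ` S j) = {}"
    and un: "(\<Union>i<k. g i ` S i) = P" and P: "convex P" and k: "k > 0"
  obtains V C where "convex_tiling (\<Union>i<k. (`) (g i) ` Ts i) P V C"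
    "card (\<Union>i<k. (`) (g i) ` Ts i) = (\<Sum>i<k. card (Ts i))"
proof -
  have comp: "finite (Ts i) \<and> Ts i \<noteq> {} \<and> (\<forall>t\<in>Ts i. congruent T0 t) \<and>
      (\<forall>s\<in>Ts i. \<forall>t\<in>Ts i. s \<noteq> t \<longrightarrow> interior s \<inter> interior t = {}) \<and> \<Union>(Ts i) = S i" if "i < k" for i
    using tiles[OF that] unfolding tiles_of_def .
  let ?T = "\<lambda>i. (`) (g i) ` Ts i"
  let ?U = "\<Union>i<k. ?T i"
  have tile: "\<exists>v c. cmod c = 1 \<and> True \<and> u = tile v c" if "i < k" "u \<in> ?T i" for u i
  proof -
    have "congruent T0 u"
      using that comp[OF that(1)] g[OF that(1)] congruent_trans unfolding congruent_def[of _ u]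
      by (auto simp: congruent_def) (metis image_comp plane_isometry_comp)
    then show ?thesis by (simp add: congruent_T0_tile)
  qed
  have sub: "interior u \<subseteq> interior (g i ` S i)" if iu: "i < k" "u \<in> ?T i" for u i
  proof (rule interior_mono)
    obtain t where "t \<in> Ts i" "u = g i ` t" using iu(2) by blast
    moreover have "t \<in> Ts i \<Longrightarrow> t \<subseteq> S i" for t using comp[OF iu(1)] Union_upper[of t "Ts i"] by simp
    ultimately show "u \<subseteq> g i ` S i" by blast
  qed
  have ne: "interior u \<noteq> {}" if "i < k" "u \<in> ?T i" for u i
    using tile[OF that] interior_tile_nonempty by auto
  have dis: "interior u \<inter> interior w = {}" if uw: "i < k" "u \<in> ?T i" "j < k" "w \<in> ?T j" "u \<noteq> w" for u w i j
  proof (cases "i = j")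
    case True
    then obtain s t where st: "s \<in> Ts i" "t \<in> Ts i" "u = g i ` s" "w = g i ` t" "s \<noteq> t" using uw by blast
    then have "interior s \<inter> interior t = {}" using comp[OF uw(1)] by blast
    then show ?thesis using st g[OF uw(1)] plane_isometry_inj[OF g[OF uw(1)]]
      by (simp add: interior_isometry_image image_Int[symmetric])
  next
    case False
    then show ?thesis using disj[OF uw(1,3)] sub[OF uw(1,2)] sub[OF uw(3,4)] by blast
  qed
  have fT: "finite ?U" by (intro finite_UN_I finite_imageI) (use comp in auto)
  have nT: "?U \<noteq> {}" using comp[OF k] k by auto
  have uT: "\<Union>?U = P" using comp unfolding un[symmetric] by fastforce
  have tT: "\<exists>v c. cmod c = 1 \<and> True \<and> u = tile v c" if "u \<in> ?U" for u
    using tile that by blast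
  have dT: "interior u \<inter> interior w = {}" if "u \<in> ?U" "w \<in> ?U" "u \<noteq> w" for u w
    using dis that by blast
  have "\<exists>V C. convex_tiling ?U P V C"
  proof (rule convex_tiling_exists[where Q = "\<lambda>_. True", OF fT nT tT dT uT P])
    fix V C assume "convex_tiling ?U P V C"
    then show ?thesis by blast
  qed
  then obtain V C where V: "convex_tiling ?U P V C" by blast
  have "card ?U = (\<Sum>i<k. card (?T i))"
  proof (rule card_UN_disjoint)
    show "\<forall>i\<in>{..<k}. \<forall>j\<in>{..<k}. i \<noteq> j \<longrightarrow> ?T i \<inter> ?T j = {}"
    proof (intro ballI impI)
      fix i j assume ij: "i \<in> {..<k}" "j \<in> {..<k}" "i \<noteq> j"
      show "?T i \<inter> ?T j = {}"
      proof (rule ccontr)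
        assume "?T i \<inter> ?T j \<noteq> {}"
        then obtain u where u: "u \<in> ?T i" "u \<in> ?T j" by blast
        have "interior u \<subseteq> interior (g i ` S i) \<inter> interior (g j ` S j)"
          using sub[OF _ u(1)] sub[OF _ u(2)] ij by simp
        moreover have "interior (g i ` S i) \<inter> interior (g j ` S j) = {}" using disj ij by simp
        ultimately show False using ne[OF _ u(1)] ij by auto
      qed
    qed
  qed (use comp in auto)
  also have "\<dots> = (\<Sum>i<k. card (Ts i))"
  proof (rule sum.cong)
    fix i assume "i \<in> {..<k}"
    then have "inj (g i)" using g plane_isometry_inj by simp
    then show "card (?T i) = card (Ts i)" by (intro card_image) (auto simp: inj_on_def inj_image_eq_iff)
  qed simp
  finally show thesis using V that by blast
qed

section \<open>Edge midpoints on the boundary of the thin shapes\<close>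

lemma not_interior_halfplane:
  assumes "\<And>w. w \<in> P \<Longrightarrow> n \<bullet> w \<le> h" "n \<bullet> z = h" "n \<noteq> (0::complex)"
  shows "z \<notin> interior P"
proof
  assume "z \<in> interior P"
  also have "interior P \<subseteq> interior {w. n \<bullet> w \<le> h}" using assms(1) by (intro interior_mono) auto
  finally show False using assms(2,3) by simp
qed

context convex_tiling begin

lemma isometry_tile:
  assumes "t \<in> Ts" "plane_isometry F" "F ` T0 = t"
  shows "F 0 = V t" "F 1 = V t + C t \<and> F \<i> = V t + \<i> * C t \<or> F 1 = V t + \<i> * C t \<and> F \<i> = V t + C t"
proof -
  have G: "plane_isometry (\<lambda>z. V t + C t * z)" using unit[OF assms(1)] by (rule plane_isometry_rot)
  have "F ` T0 = (\<lambda>z. V t + C t * z) ` T0" using tile_eq[OF assms(1)] assms(3) by (simp add: tile_def)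
  from isometry_same_T0[OF assms(2) G this]
  show "F 0 = V t" "F 1 = V t + C t \<and> F \<i> = V t + \<i> * C t \<or> F 1 = V t + \<i> * C t \<and> F \<i> = V t + C t"
    by (auto simp: doubleton_eq_iff mult.commute)
qed

lemma on_leg_boundary:
  assumes "t \<in> Ts" "plane_isometry F" "F ` T0 = t" "cmod n = 1" "\<And>w. w \<in> P \<Longrightarrow> n \<bullet> w \<le> h" "on_leg n h t"
  shows "F (Complex (1/2) 0) \<notin> interior P \<or> F (Complex 0 (1/2)) \<notin> interior P"
proof -
  have "n \<noteq> 0" using assms(4) by auto
  have e: "V t + of_real (1/2) * C t = (V t + (V t + C t)) / 2" "V t + of_real (1/2) * (\<i> * C t) = (V t + (V t + \<i> * C t)) / 2"
    by (simp_all add: field_simps)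
  have "n \<bullet> ((V t + (V t + C t)) / 2) = h \<or> n \<bullet> ((V t + (V t + \<i> * C t)) / 2) = h"
    using assms(6) unfolding on_leg_def e[symmetric] by blast
  then have "(V t + (V t + C t)) / 2 \<notin> interior P \<or> (V t + (V t + \<i> * C t)) / 2 \<notin> interior P"
    using not_interior_halfplane[of P n h, OF assms(5) _ \<open>n \<noteq> 0\<close>] by blast
  then show ?thesis
    using isometry_tile[OF assms(1-3)] unfolding isometry_mids(3,4)[OF assms(2)] by metis
qed

lemma on_hyp_boundary:
  assumes "t \<in> Ts" "plane_isometry F" "F ` T0 = t" "cmod n = 1" "\<And>w. w \<in> P \<Longrightarrow> n \<bullet> w \<le> h" "on_hyp n h t"
  shows "F (Complex (1/2) (1/2)) \<notin> interior P"
proof -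
  have "n \<noteq> 0" using assms(4) by auto
  have e: "V t + of_real (1/2) * C t + of_real (1 - 1/2) * (\<i> * C t) = ((V t + C t) + (V t + \<i> * C t)) / 2"
    by (simp_all add: field_simps)
  have "n \<bullet> (((V t + C t) + (V t + \<i> * C t)) / 2) = h"
    using assms(6) unfolding on_hyp_def e[symmetric] by blast
  then have "((V t + C t) + (V t + \<i> * C t)) / 2 \<notin> interior P"
    using not_interior_halfplane[of P n h, OF assms(5) _ \<open>n \<noteq> 0\<close>] by blast
  then show ?thesis
    using isometry_tile(2)[OF assms(1-3)] unfolding isometry_mids(2)[OF assms(2)] by (metis add.commute)
qed

end

lemma disjoint_cover:
  assumes "finite T" "A \<subseteq> T" "B \<subseteq> T" "A \<inter> B = {}" "card A + card B = card T"
  shows "A \<union> B = T"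
  using assms by (intro card_subset_eq) (auto simp: card_Un_disjoint finite_subset)

text \<open>A long side of length \<open>8 = x + y * sqrt 2\<close> carries exactly eight legs. The
  families of the two long sides are disjoint, because the outward normals
  \<open>- \<i> * C t\<close> and \<open>- C t\<close> of one tile are never opposite; so together
  they comprise all sixteen tiles.\<close>

lemma rectangle_leg_boundary:
  assumes T: "convex_tiling Ts (oct 8 1 0 0 0 0) V C" "card Ts = 16"
    and F: "plane_isometry F" "F ` T0 \<in> Ts"
  shows "F (Complex (1/2) 0) \<notin> interior (oct 8 1 0 0 0 0) \<or> F (Complex 0 (1/2)) \<notin> interior (oct 8 1 0 0 0 0)"
proof -
  let ?P = "oct 8 1 0 0 0 0"
  interpret T: convex_tiling Ts "oct 8 1 0 0 0 0" V C by fact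
  have h1: "(- \<i>) \<bullet> w \<le> 0" if "w \<in> ?P" for w using that by (auto simp: oct_def inner_complex_def)
  have h2: "\<i> \<bullet> w \<le> 1" if "w \<in> ?P" for w using that by (auto simp: oct_def inner_complex_def)
  have l1: "line_part (- \<i>) 0 ?P = {0..8}" by (auto simp: line_part_def oct_def)
  have l2: "line_part \<i> 1 ?P = {-8..0}" by (auto simp: line_part_def oct_def)
  have c8: "x = 8" if "8 = real x + real y * sqrt 2" for x y :: nat
  proof -
    have "real y * sqrt 2 = 2 * real y / sqrt 2" by (simp add: field_simps)
    then have "real_of_int (int x - 8) + real_of_int (2 * int y) / sqrt 2 = 0" using that by simp
    from sqrt2_independent[OF this] show ?thesis by simp
  qed
  have "8 - 0 = card (T.leg_tiles (- \<i>) 0) + card (T.hyp_tiles (- \<i>) 0) * sqrt 2"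
    by (rule T.side_length[OF _ h1 l1]) auto
  then have c1: "card (T.leg_tiles (- \<i>) 0) = 8" using c8 by simp
  have "0 - - 8 = card (T.leg_tiles \<i> 1) + card (T.hyp_tiles \<i> 1) * sqrt 2"
    by (rule T.side_length[OF _ h2 l2]) auto
  then have c2: "card (T.leg_tiles \<i> 1) = 8" using c8 by simp
  have d1: "t \<in> T.leg_tiles (- \<i>) 0 \<Longrightarrow> t \<in> Ts \<and> T.on_leg (- \<i>) 0 t" for t
    by (rule T.leg_tilesD[OF _ _ h1]) auto
  have d2: "t \<in> T.leg_tiles \<i> 1 \<Longrightarrow> t \<in> Ts \<and> T.on_leg \<i> 1 t" for t
    by (rule T.leg_tilesD[OF _ _ h2]) auto
  have dis: "T.leg_tiles (- \<i>) 0 \<inter> T.leg_tiles \<i> 1 = {}"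
  proof (rule ccontr)
    assume "T.leg_tiles (- \<i>) 0 \<inter> T.leg_tiles \<i> 1 \<noteq> {}"
    then obtain t where "T.on_leg (- \<i>) 0 t" "T.on_leg \<i> 1 t" using d1 d2 by blast
    then have "- \<i> \<in> {- \<i> * C t, - C t}" "\<i> \<in> {- \<i> * C t, - C t}" unfolding T.on_leg_def by blast+
    then show False by (auto simp: complex_eq_iff)
  qed
  have "T.leg_tiles (- \<i>) 0 \<union> T.leg_tiles \<i> 1 = Ts"
    by (rule disjoint_cover[OF T.finite_Ts _ _ dis]) (use c1 c2 d1 d2 T(2) in auto)
  then consider "T.on_leg (- \<i>) 0 (F ` T0)" | "T.on_leg \<i> 1 (F ` T0)" using F(2) d1 d2 by blast
  then show ?thesis
  proof cases
    case 1
    show ?thesis by (rule T.on_leg_boundary[OF F(2,1) refl _ h1 1]) auto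
  next
    case 2
    show ?thesis by (rule T.on_leg_boundary[OF F(2,1) refl _ h2 2]) auto
  qed
qed

text \<open>The long sides lie on \<open>Re z + Im z = 8\<close> and \<open>Re z + Im z = 9\<close>
  and have length \<open>8 * sqrt 2\<close>, so each carries exactly eight hypotenuses. A tile has
  one hypotenuse with one normal and cannot serve both sides; so all sixteen tiles are used.\<close>

lemma parallelogram_hyp_boundary:
  assumes T: "convex_tiling Ts (oct 9 8 8 0 8 0) V C" "card Ts = 16"
    and F: "plane_isometry F" "F ` T0 \<in> Ts"
  shows "F (Complex (1/2) (1/2)) \<notin> interior (oct 9 8 8 0 8 0)"
proof -
  let ?P = "oct 9 8 8 0 8 0" and ?n = "hyp_dir 1" and ?h = "8 / sqrt 2" and ?k = "9 / sqrt 2"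
  interpret T: convex_tiling Ts "oct 9 8 8 0 8 0" V C by fact
  have in1: "?n \<bullet> z = (Re z + Im z) / sqrt 2" "(- ?n) \<bullet> z = - ((Re z + Im z) / sqrt 2)" for z
    by (simp_all add: inner_complex_def hyp_dir_def diff_divide_distrib add_divide_distrib)
  have mem: "z \<in> ?P \<longleftrightarrow> 0 \<le> Im z \<and> Im z \<le> 8 \<and> 8 \<le> Re z + Im z \<and> Re z + Im z \<le> 9" for z
    by (auto simp: oct_def)
  have h1: "(- ?n) \<bullet> w \<le> - ?h" if "w \<in> ?P" for w
    using that unfolding mem in1 neg_le_iff_le by (intro divide_right_mono) auto
  have h2: "?n \<bullet> w \<le> 9 / sqrt 2" if "w \<in> ?P" for w
    using that unfolding mem in1 by (intro divide_right_mono) auto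
  have sq: "x / sqrt 2 / sqrt 2 = x / 2" for x by (simp add: field_simps)
  have pt: "Re (of_real h * n + of_real s * (\<i> * n)) = (h - s) / sqrt 2" "Im (of_real h * n + of_real s * (\<i> * n)) = (h + s) / sqrt 2"
    if "n = ?n" for h s n by (simp_all add: that hyp_dir_def diff_divide_distrib add_divide_distrib)
  have pt': "Re (of_real h * n + of_real s * (\<i> * n)) = (s - h) / sqrt 2" "Im (of_real h * n + of_real s * (\<i> * n)) = - ((h + s) / sqrt 2)"
    if "n = - ?n" for h s n by (simp_all add: that hyp_dir_def diff_divide_distrib add_divide_distrib)
  have div: "k \<le> s / sqrt 2 \<longleftrightarrow> k * sqrt 2 \<le> s" "s / sqrt 2 \<le> k \<longleftrightarrow> s \<le> k * sqrt 2" for s k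
    by (simp_all add: pos_le_divide_eq pos_divide_le_eq)
  have l1: "line_part (- ?n) (- ?h) ?P = {- (4 * sqrt 2)..4 * sqrt 2}"
  proof (intro set_eqI)
    fix s
    define u where "u = s / sqrt 2"
    have "s \<in> line_part (- ?n) (- ?h) ?P \<longleftrightarrow> - 4 \<le> u \<and> u \<le> 4"
      unfolding line_part_def mem_Collect_eq mem pt'[OF refl] u_def
      by (simp add: add_divide_distrib diff_divide_distrib sq) auto
    then show "s \<in> line_part (- ?n) (- ?h) ?P \<longleftrightarrow> s \<in> {- (4 * sqrt 2)..4 * sqrt 2}"
      unfolding u_def div by simp
  qed
  have l2: "line_part ?n ?k ?P = {- (9 / 2 * sqrt 2)..7 / 2 * sqrt 2}"
  proof (intro set_eqI)
    fix s
    define u where "u = s / sqrt 2"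
    have "s \<in> line_part ?n ?k ?P \<longleftrightarrow> - (9 / 2) \<le> u \<and> u \<le> 7 / 2"
    proof -
      have "(9 / sqrt 2 + s) / sqrt 2 = 9 / 2 + u" "(9 / sqrt 2 - s) / sqrt 2 = 9 / 2 - u"
        unfolding u_def by (simp_all add: add_divide_distrib diff_divide_distrib sq)
      then show ?thesis unfolding line_part_def mem_Collect_eq mem pt[OF refl] by auto
    qed
    then show "s \<in> line_part ?n ?k ?P \<longleftrightarrow> s \<in> {- (9 / 2 * sqrt 2)..7 / 2 * sqrt 2}"
      unfolding u_def div by simp
  qed
  have c8: "y = 8" if "8 * sqrt 2 = real x + real y * sqrt 2" for x y :: nat
  proof -
    have "real y * sqrt 2 = 2 * real y / sqrt 2" "8 * sqrt 2 = 16 / sqrt 2" by (simp_all add: field_simps)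
    then have "real_of_int (int x) + real_of_int (2 * int y - 16) / sqrt 2 = 0" using that
      by (simp add: diff_divide_distrib)
    from sqrt2_independent[OF this] show ?thesis by simp
  qed
  have un: "cmod ?n = 1" "cmod (- ?n) = 1" by (simp_all add: cmod_hyp_dir)
  have "4 * sqrt 2 - - (4 * sqrt 2) = card (T.leg_tiles (- ?n) (- ?h)) + card (T.hyp_tiles (- ?n) (- ?h)) * sqrt 2"
    by (rule T.side_length[OF un(2) h1 l1]) auto
  then have c1: "card (T.hyp_tiles (- ?n) (- ?h)) = 8" using c8 by simp
  have "7 / 2 * sqrt 2 - - (9 / 2 * sqrt 2) = card (T.leg_tiles ?n ?k) + card (T.hyp_tiles ?n ?k) * sqrt 2"
    by (rule T.side_length[OF un(1) h2 l2]) auto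
  then have c2: "card (T.hyp_tiles ?n ?k) = 8" using c8 by simp
  note d1 = T.hyp_tilesD[OF _ un(2) h1] and d2 = T.hyp_tilesD[OF _ un(1) h2]
  have dis: "T.hyp_tiles (- ?n) (- ?h) \<inter> T.hyp_tiles ?n ?k = {}"
  proof (rule ccontr)
    assume "T.hyp_tiles (- ?n) (- ?h) \<inter> T.hyp_tiles ?n ?k \<noteq> {}"
    then obtain t where "T.on_hyp (- ?n) (- ?h) t" "T.on_hyp ?n ?k t" using d1 d2 by blast
    then have "- ?n = ?n" unfolding T.on_hyp_def by metis
    then show False using un by auto
  qed
  have "T.hyp_tiles (- ?n) (- ?h) \<union> T.hyp_tiles ?n ?k = Ts"
    by (rule disjoint_cover[OF T.finite_Ts _ _ dis]) (use c1 c2 d1 d2 T(2) in auto)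
  then consider "T.on_hyp (- ?n) (- ?h) (F ` T0)" | "T.on_hyp ?n ?k (F ` T0)" using F(2) d1 d2 by blast
  then show ?thesis
  proof cases
    case 1
    show ?thesis by (rule T.on_hyp_boundary[OF F(2,1) refl un(2) h1 1])
  next
    case 2
    show ?thesis by (rule T.on_hyp_boundary[OF F(2,1) refl un(1) h2 2])
  qed
qed

section \<open>Exclusion of twenty shapes\<close>

lemma can_form_congruent:
  assumes "can_form k S P" "congruent P P'"
  shows "can_form k S P'"
proof -
  obtain g where g: "\<forall>i<k. plane_isometry (g i)"
      "\<forall>i<k. \<forall>j<k. i \<noteq> j \<longrightarrow> interior (g i ` S i) \<inter> interior (g j ` S j) = {}" "(\<Union>i<k. g i ` S i) = P"
    using assms(1) unfolding can_form_def by blast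
  obtain f where f: "plane_isometry f" "f ` P = P'" using assms(2) by (auto simp: congruent_def)
  have "\<forall>i<k. plane_isometry (f \<circ> g i)" using g(1) f(1) plane_isometry_comp by blast
  moreover have "interior ((f \<circ> g i) ` S i) \<inter> interior ((f \<circ> g j) ` S j) = {}" if "i < k" "j < k" "i \<noteq> j" for i j
  proof -
    have "interior ((f \<circ> g l) ` S l) = f ` interior (g l ` S l)" for l
      unfolding image_comp[symmetric] interior_isometry_image[OF f(1)] ..
    moreover have "interior (g i ` S i) \<inter> interior (g j ` S j) = {}" using g(2) that by blast
    ultimately show ?thesis using plane_isometry_inj[OF f(1)] by (simp add: image_Int[symmetric])
  qed
  moreover have "(\<Union>i<k. (f \<circ> g i) ` S i) = P'" unfolding f(2)[symmetric] g(3)[symmetric] by auto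
  ultimately show ?thesis unfolding can_form_def by (intro exI[of _ "\<lambda>i. f \<circ> g i"]) blast
qed

lemma composed_from_sixteen_tiles:
  assumes "composed_from_sixteen k S"
  obtains Ts where "\<And>i. i < k \<Longrightarrow> tiles_of (Ts i) (S i)" "\<And>i. i < k \<Longrightarrow> glue_connected (Ts i)"
    "(\<Sum>i<k. card (Ts i)) = 16"
proof -
  obtain n where n: "\<forall>i<k. composed_of (n i) (S i)" "(\<Sum>i<k. n i) = 16"
    using assms unfolding composed_from_sixteen_def by blast
  then obtain Ts where Ts: "\<And>i. i < k \<Longrightarrow> tiles_of (Ts i) (S i) \<and> glue_connected (Ts i) \<and> card (Ts i) = n i"
    unfolding composed_of_iff by metis
  have "(\<Sum>i<k. card (Ts i)) = (\<Sum>i<k. n i)" using Ts by (intro sum.cong) auto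
  then show thesis using that[of Ts] Ts n(2) by simp
qed

lemma can_form_tiled:
  assumes "composed_from_sixteen k S" "can_form k S P" "convex P" "k > 0"
  shows "tiled 16 P"
proof -
  obtain Ts where Ts: "\<And>i. i < k \<Longrightarrow> tiles_of (Ts i) (S i)" "(\<Sum>i<k. card (Ts i)) = 16"
    using composed_from_sixteen_tiles[OF assms(1)] by metis
  obtain g where g: "\<And>i. i < k \<Longrightarrow> plane_isometry (g i)"
      "\<And>i j. i < k \<Longrightarrow> j < k \<Longrightarrow> i \<noteq> j \<Longrightarrow> interior (g i ` S i) \<inter> interior (g j ` S j) = {}" "(\<Union>i<k. g i ` S i) = P"
    using assms(2) unfolding can_form_def by metis
  show ?thesis unfolding tiled_def
    by (rule can_form_tiling[OF Ts(1) g assms(3,4)]) (use Ts(2) in auto)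
qed

lemma rectangle_and_parallelogram_impossible:
  assumes S: "composed_from_sixteen 7 S" and R: "can_form 7 S (oct 8 1 0 0 0 0)" and Q: "can_form 7 S (oct 9 8 8 0 8 0)"
  shows False
proof -
  obtain Ts where Ts: "\<And>i. i < 7 \<Longrightarrow> tiles_of (Ts i) (S i)"
    and conn: "\<And>i. i < 7 \<Longrightarrow> glue_connected (Ts i)"
    and card: "(\<Sum>i<7. card (Ts i)) = 16"
    using composed_from_sixteen_tiles[OF S] by metis
  have "\<exists>i<7. card (Ts i) \<ge> 3"
  proof (rule ccontr)
    assume "\<not> ?thesis"
    then have "(\<Sum>i<7. card (Ts i)) \<le> (\<Sum>i<(7::nat). 2)" by (intro sum_mono) (auto simp: not_le)
    then show False using card by simp
  qed
  then obtain i where i: "i < 7" "card (Ts i) \<ge> 3" by blast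
  have Tsi: "finite (Ts i)" "\<And>t. t \<in> Ts i \<Longrightarrow> congruent T0 t"
    "\<And>s t. s \<in> Ts i \<Longrightarrow> t \<in> Ts i \<Longrightarrow> s \<noteq> t \<Longrightarrow> interior s \<inter> interior t = {}" "\<Union>(Ts i) = S i"
    using Ts[OF i(1)] by (auto simp: tiles_of_def)
  obtain s t t' where st: "s \<in> Ts i" "t \<in> Ts i" "t' \<in> Ts i" "s \<noteq> t" "s \<noteq> t'" "t \<noteq> t'" "glued s t" "glued s t'"
    using composed_two_neighbours[OF i(2) conn[OF i(1)]] by metis
  obtain F where F: "plane_isometry F" "s = F ` T0" using Tsi(2)[OF st(1)] by (auto simp: congruent_def)
  obtain m n where m: "m \<in> edge_mids" "edge_pt s n (F m)" "edge_pt t (- n) (F m)"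
    using glued_common_mid[OF st(7) F(2,1) Tsi(3)[OF st(1,2,4)]] by metis
  obtain m' n' where m': "m' \<in> edge_mids" "edge_pt s n' (F m')" "edge_pt t' (- n') (F m')"
    using glued_common_mid[OF st(8) F(2,1) Tsi(3)[OF st(1,3,5)]] by metis
  \<comment> \<open>Two neighbours at the same edge of \<open>s\<close> would both have the normal
    \<open>- n\<close> there, while disjointness of the neighbours makes their normals
    opposite.\<close>
  have "m \<noteq> m'"
  proof
    assume "m = m'"
    then have "- n' = - n" using edge_pt_opposite[OF m(2) _ Tsi(3)[OF st(1,3,5)]] m'(3) by blast
    moreover have "- n' = - (- n)" using edge_pt_opposite[OF m(3) _ Tsi(3)[OF st(2,3,6)]] m'(3) \<open>m = m'\<close> by blast
    ultimately have "n = 0" by simp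
    then show False using m(2) by (simp add: edge_pt_def)
  qed
  \<comment> \<open>The midpoint of a glued edge is interior to the union of the two tiles, hence to
    every placed copy of the piece and to the region around it.\<close>
  have int: "g (F x) \<in> interior P"
    if g: "plane_isometry g" "g ` S i \<subseteq> P" and x: "x \<in> {m, m'}" for g x P
  proof -
    have "F x \<in> interior (s \<union> t) \<or> F x \<in> interior (s \<union> t')"
      using x edge_pt_glued_interior[OF m(2,3)] edge_pt_glued_interior[OF m'(2,3)] by blast
    moreover have "interior (s \<union> t) \<subseteq> interior (S i)" "interior (s \<union> t') \<subseteq> interior (S i)"
      using st Tsi(4) by (auto intro!: interior_mono)
    ultimately have "g (F x) \<in> interior (g ` S i)" unfolding interior_isometry_image[OF g(1)] by blast
    then show ?thesis using interior_mono[OF g(2)] by blast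
  qed
  have "\<exists>g V C T. plane_isometry g \<and> g ` S i \<subseteq> P \<and> convex_tiling T P V C \<and> card T = 16 \<and> (g \<circ> F) ` T0 \<in> T"
    if cf: "can_form 7 S P" "convex P" for P
  proof -
    obtain g where g: "\<And>i. i < 7 \<Longrightarrow> plane_isometry (g i)"
        "\<And>i j. i < 7 \<Longrightarrow> j < 7 \<Longrightarrow> i \<noteq> j \<Longrightarrow> interior (g i ` S i) \<inter> interior (g j ` S j) = {}" "(\<Union>i<7. g i ` S i) = P"
      using cf(1) unfolding can_form_def by metis
    have "\<exists>V C. convex_tiling (\<Union>i<7. (`) (g i) ` Ts i) P V C \<and>
      card (\<Union>i<7. (`) (g i) ` Ts i) = (\<Sum>i<7. card (Ts i))"
      by (rule can_form_tiling[OF Ts g cf(2)]) auto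
    then obtain V C where V: "convex_tiling (\<Union>i<7. (`) (g i) ` Ts i) P V C"
      "card (\<Union>i<7. (`) (g i) ` Ts i) = (\<Sum>i<7. card (Ts i))" by blast
    have "(g i \<circ> F) ` T0 = g i ` s" unfolding F(2) image_comp ..
    then have "(g i \<circ> F) ` T0 \<in> (\<Union>i<7. (`) (g i) ` Ts i)" using i(1) st(1) by blast
    moreover have "g i ` S i \<subseteq> P" using g(3) i(1) by blast
    moreover have "card (\<Union>i<7. (`) (g i) ` Ts i) = 16" using V(2) card by simp
    ultimately show ?thesis using V(1) g(1)[OF i(1)] by blast
  qed
  note place = this
  obtain g V C T where g: "plane_isometry g" "g ` S i \<subseteq> oct 8 1 0 0 0 0"
     "convex_tiling T (oct 8 1 0 0 0 0) V C" "card T = 16" "(g \<circ> F) ` T0 \<in> T"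
    using place[OF R convex_oct] by blast
  obtain g' V' C' T' where g': "plane_isometry g'" "g' ` S i \<subseteq> oct 9 8 8 0 8 0"
     "convex_tiling T' (oct 9 8 8 0 8 0) V' C'" "card T' = 16" "(g' \<circ> F) ` T0 \<in> T'"
    using place[OF Q convex_oct] by blast
  have "(g \<circ> F) (Complex (1/2) 0) \<notin> interior (oct 8 1 0 0 0 0) \<or> (g \<circ> F) (Complex 0 (1/2)) \<notin> interior (oct 8 1 0 0 0 0)"
    by (rule rectangle_leg_boundary[OF g(3,4) plane_isometry_comp[OF g(1) F(1)] g(5)])
  then have "Complex (1/2) 0 \<notin> {m, m'} \<or> Complex 0 (1/2) \<notin> {m, m'}" using int[OF g(1,2)] by auto
  moreover have "(g' \<circ> F) (Complex (1/2) (1/2)) \<notin> interior (oct 9 8 8 0 8 0)"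
    by (rule parallelogram_hyp_boundary[OF g'(3,4) plane_isometry_comp[OF g'(1) F(1)] g'(5)])
  then have "Complex (1/2) (1/2) \<notin> {m, m'}" using int[OF g'(1,2)] by auto
  \<comment> \<open>The hypotenuse and at least one leg are barred, so one midpoint is left for the
    two distinct points \<open>m\<close> and \<open>m'\<close>.\<close>
  ultimately show False using m(1) m'(1) \<open>m \<noteq> m'\<close> unfolding edge_mids_def by blast
qed

text \<open>Twenty non-congruent polygons are assigned injectively to a list of twenty shapes, so
  every shape is formed, in particular the rectangle and the parallelogram.\<close>

lemma not_forms_twenty:
  assumes S: "composed_from_sixteen 7 S"
  shows "\<not> forms_convex 7 S 20"
proof
  assume "forms_convex 7 S 20"
  then obtain Q :: "nat \<Rightarrow> complex set" where "(\<forall>j<20. convex (Q j) \<and> can_form 7 S (Q j)) \<and>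
      (\<forall>i<20. \<forall>j<20. i \<noteq> j \<longrightarrow> \<not> congruent (Q i) (Q j))"
    unfolding forms_convex_def by blast
  then have Q: "\<And>j. j < 20 \<Longrightarrow> convex (Q j) \<and> can_form 7 S (Q j)"
    "\<And>i j. i < 20 \<Longrightarrow> j < 20 \<Longrightarrow> i \<noteq> j \<Longrightarrow> \<not> congruent (Q i) (Q j)" by simp_all
  have "\<exists>t\<in>set all_shapes. congruent (Q j) (octi t)" if "j < 20" for j
    using tiled_16_shape can_form_tiled[OF S] Q(1)[OF that] by simp
  then obtain f where f: "\<And>j. j < 20 \<Longrightarrow> f j \<in> set all_shapes \<and> congruent (Q j) (octi (f j))" by metis
  have "inj_on f {..<20}"
  proof (rule inj_onI)
    fix i j :: nat assume "i \<in> {..<20}" "j \<in> {..<20}" "f i = f j"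
    then have ij: "i < 20" "j < 20" "f i = f j" by auto
    have "congruent (Q i) (Q j)"
      using congruent_trans[OF conjunct2[OF f[OF ij(1)]]] congruent_sym[OF conjunct2[OF f[OF ij(2)]]] ij(3) by simp
    then show "i = j" using Q(2) ij by blast
  qed
  then have "card (f ` {..<20}) = 20" by (simp add: card_image)
  moreover have "card (set all_shapes) \<le> 20"
    by (rule order_trans[OF card_length]) (simp add: all_shapes_def formed_shapes_def)
  moreover have "f ` {..<20} \<subseteq> set all_shapes" using f by auto
  ultimately have "f ` {..<20} = set all_shapes" by (intro card_seteq) auto
  have form: "can_form 7 S (octi t)" if t: "t \<in> set all_shapes" for t
  proof -
    obtain j where "j < 20" "t = f j" using t unfolding \<open>f ` {..<20} = set all_shapes\<close>[symmetric] by auto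
    then show ?thesis using f Q(1) can_form_congruent by blast
  qed
  have "can_form 7 S (oct 8 1 0 0 0 0)" using form[of "(8,1,0,0,0,0)"] by (simp add: all_shapes_def formed_shapes_def)
  moreover have "can_form 7 S (oct 9 8 8 0 8 0)" using form[of "(9,8,8,0,8,0)"] by (simp add: all_shapes_def)
  ultimately show False using rectangle_and_parallelogram_impossible[OF S] by blast
qed

section \<open>Lattice tilings\<close>

definition gauss :: "int \<times> int \<Rightarrow> complex" where
  "gauss p = Complex (of_int (fst p)) (of_int (snd p))"

text \<open>Multiplication by \<open>\<i> powi k\<close>, on integer pairs so that placements can be
  checked by evaluation.\<close>

definition turn :: "int \<Rightarrow> int \<times> int \<Rightarrow> int \<times> int" where
  "turn k p = (let (x, y) = p; m = k mod 4 in
     if m = 0 then (x, y) else if m = 1 then (- y, x) else if m = 2 then (- x, - y) else (y, - x))"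

lemma ii_powi_mod4: "\<i> powi k = (if k mod 4 = 0 then 1 else if k mod 4 = 1 then \<i> else if k mod 4 = 2 then -1 else -\<i>)"
proof -
  have "\<i> powi k = \<i> powi (4 * (k div 4) + k mod 4)" by simp
  also have "\<dots> = (\<i> powi 4) powi (k div 4) * \<i> powi (k mod 4)"
    by (simp only: power_int_add power_int_mult complex_i_not_zero simp_thms)
  also have "\<i> powi 4 = 1" by (simp add: power_int_def numeral_eq_Suc)
  finally have 1: "\<i> powi k = \<i> powi (k mod 4)" by simp
  have "k mod 4 = 0 \<or> k mod 4 = 1 \<or> k mod 4 = 2 \<or> k mod 4 = 3" by presburger
  then show ?thesis unfolding 1 by (auto simp: power_int_def numeral_eq_Suc)
qed

lemma gauss_turn: "gauss (turn k p) = \<i> powi k * gauss p"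
  by (cases p) (auto simp: gauss_def turn_def ii_powi_mod4 Let_def complex_eq_iff)

lemma cmod_ii_powi: "cmod (\<i> powi k) = 1"
  by (simp add: norm_power_int)

type_synonym ltile = "int \<times> int \<times> int"

text \<open>\<open>(x, y, k)\<close> has its right angle at \<open>(x, y)\<close> and legs in the directions \<open>\<i> powi k\<close> and \<open>\<i> powi (k + 1)\<close>;
  \<open>(p, q, k, r)\<close> is a rotation by \<open>k\<close> quarter turns, after complex conjugation if \<open>r\<close>, followed by a translation.\<close>

fun lat_tile :: "ltile \<Rightarrow> complex set" where
  "lat_tile (x, y, k) = tile (gauss (x, y)) (\<i> powi k)"

type_synonym placement = "int \<times> int \<times> int \<times> bool"

fun lat_iso :: "placement \<Rightarrow> complex \<Rightarrow> complex" where
  "lat_iso (p, q, k, r) z = gauss (p, q) + \<i> powi k * (if r then cnj z else z)"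

text \<open>Conjugation sends the leg directions \<open>\<i> powi j\<close> and
  \<open>\<i> powi (j + 1)\<close> to \<open>\<i> powi (- j)\<close> and
  \<open>\<i> powi (- j - 1)\<close> and reverses the orientation, so the latter becomes the first
  leg; hence \<open>k - j - 1\<close>.\<close>

fun lat_map :: "placement \<Rightarrow> ltile \<Rightarrow> ltile" where
  "lat_map (p, q, k, r) (x, y, j) =
     (let (u, v) = turn k (x, if r then - y else y) in (p + u, q + v, if r then k - j - 1 else k + j))"

lemma plane_isometry_lat_iso: "plane_isometry (lat_iso g)"
proof -
  obtain p q k r where g: "g = (p, q, k, r)" by (cases g)
  have "lat_iso g = (if r then (\<lambda>z. gauss (p, q) + \<i> powi k * cnj z) else (\<lambda>z. gauss (p, q) + \<i> powi k * z))"
    by (auto simp: g fun_eq_iff)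
  then show ?thesis using plane_isometry_rot[OF cmod_ii_powi] plane_isometry_refl[OF cmod_ii_powi] by simp
qed

lemma lat_iso_tile: "lat_iso g ` lat_tile t = lat_tile (lat_map g t)"
proof -
  obtain p q k r where g: "g = (p, q, k, r)" by (cases g)
  obtain x y j where t: "t = (x, y, j)" by (cases t)
  have add: "gauss (p + u, q + v) = gauss (p, q) + gauss (u, v)" for u v by (simp add: gauss_def complex_eq_iff)
  obtain u v where uv: "turn k (x, if r then - y else y) = (u, v)" by (cases "turn k (x, if r then - y else y)")
  have m: "gauss (u, v) = \<i> powi k * gauss (x, if r then - y else y)" using gauss_turn uv by metis
  show ?thesis
  proof (cases r)
    case True
    have c: "cnj (gauss (x, y)) = gauss (x, - y)" by (simp add: gauss_def complex_eq_iff)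
    have e: "\<i> powi (k - j - 1) * \<i> = \<i> powi k * cnj (\<i> powi j)"
    proof -
      have "cnj (\<i> powi j) = \<i> powi (- j)" unfolding ii_powi_mod4[of j] ii_powi_mod4[of "- j"]
        by (auto; presburger)
      then have "\<i> powi k * cnj (\<i> powi j) = \<i> powi (k - j - 1 + 1)" by (simp add: power_int_add[symmetric])
      also have "\<dots> = \<i> powi (k - j - 1) * \<i>" by (subst power_int_add) auto
      finally show ?thesis ..
    qed
    have "lat_iso g ` lat_tile t = (\<lambda>w. gauss (p, q) + \<i> powi k * cnj (gauss (x, y) + \<i> powi j * w)) ` T0"
      using True by (simp add: g t tile_def image_image)
    also have "\<dots> = (\<lambda>w. (gauss (p, q) + gauss (u, v)) + \<i> powi (k - j - 1) * (\<i> * cnj w)) ` T0"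
    proof (rule image_cong)
      fix w
      have "\<i> powi (k - j - 1) * (\<i> * cnj w) = \<i> powi k * cnj (\<i> powi j) * cnj w" by (simp only: mult.assoc[symmetric] e)
      moreover have "gauss (u, v) = \<i> powi k * cnj (gauss (x, y))" using True by (simp add: m c)
      ultimately show "gauss (p, q) + \<i> powi k * cnj (gauss (x, y) + \<i> powi j * w)
          = (gauss (p, q) + gauss (u, v)) + \<i> powi (k - j - 1) * (\<i> * cnj w)"
        by (simp only: complex_cnj_add complex_cnj_mult distrib_left mult.assoc add.assoc)
    qed simp
    also have "\<dots> = (\<lambda>w. (gauss (p, q) + gauss (u, v)) + \<i> powi (k - j - 1) * w) ` ((\<lambda>w. \<i> * cnj w) ` T0)"
      by (simp add: image_image)
    also have "\<dots> = lat_tile (lat_map g t)"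
      unfolding T0_swap using True uv by (simp add: g t add tile_def)
    finally show ?thesis .
  next
    case False
    have "lat_iso g ` lat_tile t = (\<lambda>w. gauss (p, q) + \<i> powi k * (gauss (x, y) + \<i> powi j * w)) ` T0"
      using False by (simp add: g t tile_def image_image)
    also have "\<dots> = lat_tile (lat_map g t)"
      using False uv by (simp add: g t add tile_def m distrib_left power_int_add mult.assoc add.assoc)
    finally show ?thesis .
  qed
qed

text \<open>A lattice tile is half of a unit square, which is recorded by its lower left
  corner.\<close>

fun lat_square :: "ltile \<Rightarrow> int \<times> int" where
  "lat_square (x, y, k) = (let m = k mod 4 in (if m = 1 \<or> m = 2 then x - 1 else x, if m = 2 \<or> m = 3 then y - 1 else y))"

text \<open>Two halves of one square are apart when their right angles are at opposite corners. No
  tile is apart from itself, so a list sorted by this relation has no repetitions.\<close>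

fun lat_apart :: "ltile \<Rightarrow> ltile \<Rightarrow> bool" where
  "lat_apart (x, y, k) (x', y', k') \<longleftrightarrow> lat_square (x, y, k) \<noteq> lat_square (x', y', k') \<or> (k' - k) mod 4 = 2"

text \<open>In the coordinates of the unit square, the residue of \<open>k\<close> modulo
  \<open>4\<close> selects one side of one of the two diagonals.\<close>

lemma interior_lat_tile:
  assumes "z \<in> interior (lat_tile (x, y, k))" and s: "lat_square (x, y, k) = (a, b)"
  defines "u \<equiv> Re z - of_int a" and "v \<equiv> Im z - of_int b"
  shows "0 < u \<and> u < 1 \<and> 0 < v \<and> v < 1 \<and>
    (if k mod 4 = 0 then u + v < 1 else if k mod 4 = 1 then v < u else if k mod 4 = 2 then 1 < u + v else u < v)"
proof -
  have "0 < (\<i> powi k) \<bullet> (z - gauss (x, y)) \<and> 0 < (\<i> * \<i> powi k) \<bullet> (z - gauss (x, y)) \<and> (\<i> powi k + \<i> * \<i> powi k) \<bullet> (z - gauss (x, y)) < 1"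
    using assms(1) by (simp add: interior_tile[OF cmod_ii_powi])
  moreover have "k mod 4 = 0 \<or> k mod 4 = 1 \<or> k mod 4 = 2 \<or> k mod 4 = 3" by presburger
  ultimately show ?thesis
    using s by (elim disjE) (auto simp: ii_powi_mod4 inner_complex_def gauss_def u_def v_def)
qed

lemma lat_apart_interior:
  assumes "lat_apart s t"
  shows "interior (lat_tile s) \<inter> interior (lat_tile t) = {}"
proof (rule ccontr)
  assume "interior (lat_tile s) \<inter> interior (lat_tile t) \<noteq> {}"
  then obtain z where z: "z \<in> interior (lat_tile s)" "z \<in> interior (lat_tile t)" by blast
  obtain x y k where s: "s = (x, y, k)" by (cases s)
  obtain x' y' k' where t: "t = (x', y', k')" by (cases t)
  obtain a b where ab: "lat_square (x, y, k) = (a, b)" by (cases "lat_square (x, y, k)")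
  obtain a' b' where ab': "lat_square (x', y', k') = (a', b')" by (cases "lat_square (x', y', k')")
  note 1 = interior_lat_tile[OF z(1)[unfolded s] ab] and 2 = interior_lat_tile[OF z(2)[unfolded t] ab']
  have "\<lfloor>Re z\<rfloor> = a" "\<lfloor>Im z\<rfloor> = b" using 1 by (simp_all add: floor_eq_iff)
  moreover have "\<lfloor>Re z\<rfloor> = a'" "\<lfloor>Im z\<rfloor> = b'" using 2 by (simp_all add: floor_eq_iff)
  ultimately have eq: "a = a'" "b = b'" by simp_all
  then have "(k' - k) mod 4 = 2" using assms ab ab' by (simp add: s t)
  then have "k mod 4 = 0 \<and> k' mod 4 = 2 \<or> k mod 4 = 2 \<and> k' mod 4 = 0 \<or> k mod 4 = 1 \<and> k' mod 4 = 3 \<or> k mod 4 = 3 \<and> k' mod 4 = 1"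
    by presburger
  then show False using 1 2 eq by (elim disjE) auto
qed

lemma lat_tile_ne: "interior (lat_tile t) \<noteq> {}"
  by (cases t) (simp add: interior_tile_nonempty cmod_ii_powi)

lemma congruent_lat_tile: "congruent T0 (lat_tile t)"
  unfolding congruent_T0_tile using cmod_ii_powi by (cases t) (simp only: lat_tile.simps, blast)

lemma negligible_lat_Int:
  assumes "lat_apart s t"
  shows "negligible (lat_tile s \<inter> lat_tile t)"
proof -
  obtain x y k where s: "s = (x, y, k)" by (cases s)
  obtain x' y' k' where t: "t = (x', y', k')" by (cases t)
  have cl: "closure (interior (lat_tile t)) = lat_tile t" by (simp add: t closure_interior_tile cmod_ii_powi)
  have "interior (lat_tile s) \<inter> closure (interior (lat_tile t)) = {}"
    using lat_apart_interior[OF assms] by (simp add: open_Int_closure_eq_empty)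
  then have "lat_tile s \<inter> lat_tile t \<subseteq> frontier (lat_tile s)"
    unfolding cl using closure_subset by (fastforce simp: frontier_def)
  moreover have "convex (lat_tile s)" by (simp add: s convex_tile)
  ultimately show ?thesis using negligible_convex_frontier negligible_subset by blast
qed

lemma measure_lat_tile: "measure lebesgue (lat_tile t) = 1 / 2" "lat_tile t \<in> lmeasurable" "compact (lat_tile t)"
  by (cases t; simp add: measure_tile cmod_ii_powi lmeasurable_tile compact_tile)+

section \<open>Lattice tiles that fill a shape\<close>

definition lat_union :: "ltile list \<Rightarrow> complex set" where
  "lat_union ts = (\<Union>t\<in>set ts. lat_tile t)"

lemma sorted_wrt_nth_cases:
  assumes "sorted_wrt R ts" "i < length ts" "j < length ts" "i \<noteq> j"
  shows "R (ts ! i) (ts ! j) \<or> R (ts ! j) (ts ! i)"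
  using assms sorted_wrt_nth_less[of R ts] by (metis linorder_neqE_nat)

lemma lat_union_measure:
  assumes "sorted_wrt lat_apart ts"
  shows "measure lebesgue (lat_union ts) = length ts / 2"
proof -
  have "lat_union ts = \<Union>((\<lambda>i. lat_tile (ts ! i)) ` {..<length ts})"
    unfolding lat_union_def set_conv_nth by blast
  also have "measure lebesgue \<dots> = (\<Sum>i<length ts. measure lebesgue (lat_tile (ts ! i)))"
  proof (rule measure_negligible_finite_Union_image)
    show "pairwise (\<lambda>i j. negligible (lat_tile (ts ! i) \<inter> lat_tile (ts ! j))) {..<length ts}"
      unfolding pairwise_def using sorted_wrt_nth_cases[OF assms] negligible_lat_Int by (metis Int_commute lessThan_iff)
  qed (auto simp: measure_lat_tile)
  finally show ?thesis by (simp add: measure_lat_tile)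
qed

lemma compact_lat_union: "compact (lat_union ts)"
  unfolding lat_union_def by (intro compact_UN measure_lat_tile) simp

text \<open>The part of the interior of \<open>P\<close> missed by the closed set \<open>U\<close>
  is open and has measure zero, so it is empty, and taking closures gives equality. Placements can
  thus be verified by containment and area.\<close>

lemma full_measure_eq:
  fixes U P :: "complex set"
  assumes "compact U" "U \<subseteq> P" "compact P" "convex P" "interior P \<noteq> {}" "measure lebesgue U = measure lebesgue P"
  shows "U = P"
proof -
  have lm: "U \<in> lmeasurable" "P \<in> lmeasurable" using assms by (simp_all add: lmeasurable_compact)
  then have "measure lebesgue (P - U) = 0" using assms(2,6) by (simp add: measurable_measure_Diff fmeasurableD)
  moreover have "P - U \<in> lmeasurable" using lm by (simp add: fmeasurable_Diff)
  ultimately have "negligible (P - U)" by (simp add: negligible_iff_measure)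
  then have "negligible (interior P - U)" using interior_subset negligible_subset by (metis Diff_mono order_refl)
  moreover have "open (interior P - U)" using assms by (simp add: open_Diff compact_imp_closed)
  ultimately have "interior P - U = {}" using open_not_negligible by blast
  then have "interior P \<subseteq> U" by blast
  then have "closure (interior P) \<subseteq> U" using assms by (simp add: closure_minimal compact_imp_closed)
  moreover have "closure (interior P) = P" using convex_closure_interior[OF assms(4,5)] assms(3) by (simp add: compact_imp_closed closure_closed)
  ultimately show ?thesis using assms by blast
qed

text \<open>The conditions of \<open>oct_ok\<close>, with the equation for area \<open>8\<close>
  doubled to remain within the integers.\<close>

definition area8_octuple :: "octuple \<Rightarrow> bool" where
  "area8_octuple t = (case t of (W, H, a, b, c, d) \<Rightarrow> 0 \<le> a \<and> 0 \<le> b \<and> 0 \<le> c \<and> 0 \<le> d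
      \<and> a + b \<le> W \<and> b + c \<le> H \<and> c + d \<le> W \<and> d + a \<le> H \<and> 2 * W * H - (a * a + b * b + c * c + d * d) = 16)"

lemma area8_octuple_oct_ok: "area8_octuple (W, H, a, b, c, d) \<Longrightarrow> oct_ok W H a b c d"
  unfolding area8_octuple_def oct_ok_def prod.case of_int_add[symmetric] of_int_le_iff of_int_0_le_iff by blast

fun in_octi :: "octuple \<Rightarrow> int \<times> int \<Rightarrow> bool" where
  "in_octi (W, H, a, b, c, d) (x, y) \<longleftrightarrow> 0 \<le> x \<and> x \<le> W \<and> 0 \<le> y \<and> y \<le> H \<and> a \<le> x + y
      \<and> x - y \<le> W - b \<and> x + y \<le> W + H - c \<and> y - x \<le> H - d"

text \<open>Convexity reduces containment to the three vertices; \<open>(- v, u)\<close> is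
  \<open>(u, v)\<close> after a quarter turn.\<close>

fun tile_in_octi :: "octuple \<Rightarrow> ltile \<Rightarrow> bool" where
  "tile_in_octi t (x, y, k) \<longleftrightarrow> in_octi t (x, y) \<and>
     (case turn k (1, 0) of (u, v) \<Rightarrow> in_octi t (x + u, y + v) \<and> in_octi t (x - v, y + u))"

lemma gauss_in_octi_iff: "gauss p \<in> octi t \<longleftrightarrow> in_octi t p"
proof -
  obtain W H a b c d where t: "t = (W, H, a, b, c, d)" by (cases t)
  obtain x y where p: "p = (x, y)" by (cases p)
  have "of_int x - of_int y \<le> (of_int W - of_int b :: real) \<longleftrightarrow> x - y \<le> W - b"
    "of_int x + of_int y \<le> (of_int W + of_int H - of_int c :: real) \<longleftrightarrow> x + y \<le> W + H - c"
    "of_int y - of_int x \<le> (of_int H - of_int d :: real) \<longleftrightarrow> y - x \<le> H - d"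
    "of_int a \<le> (of_int x + of_int y :: real) \<longleftrightarrow> a \<le> x + y"
    by (simp_all flip: of_int_diff of_int_add)
  then show ?thesis by (simp add: t p gauss_def oct_def)
qed

lemma convex_octi: "convex (octi t)" and compact_octi: "compact (octi t)"
  by (cases t; simp add: convex_oct compact_oct)+

lemma lat_tile_subset_octi:
  assumes "tile_in_octi s t"
  shows "lat_tile t \<subseteq> octi s"
proof -
  obtain x y k where t: "t = (x, y, k)" by (cases t)
  obtain u v where uv: "turn k (1, 0) = (u, v)" by (cases "turn k (1, 0)")
  have g: "gauss (u, v) = \<i> powi k" using gauss_turn[of k "(1, 0)"] by (simp add: uv gauss_def complex_eq_iff)
  have e: "gauss (x + u, y + v) = gauss (x, y) + gauss (u, v)" "gauss (x - v, y + u) = gauss (x, y) + \<i> * gauss (u, v)"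
    by (simp_all add: gauss_def complex_eq_iff)
  have "gauss (x, y) \<in> octi s" "gauss (x, y) + \<i> powi k \<in> octi s" "gauss (x, y) + \<i> * \<i> powi k \<in> octi s"
    using assms unfolding g[symmetric] e[symmetric] gauss_in_octi_iff by (simp_all add: t uv)
  then show ?thesis
    unfolding t lat_tile.simps tile_conv_hull by (intro hull_minimal) (auto simp: convex_octi)
qed

lemma lat_union_octi:
  assumes "area8_octuple s" "sorted_wrt lat_apart ts" "length ts = 16" "list_all (tile_in_octi s) ts"
  shows "lat_union ts = octi s"
proof (rule full_measure_eq)
  show sub: "lat_union ts \<subseteq> octi s"
    using assms(4) unfolding list_all_iff lat_union_def by (intro UN_least lat_tile_subset_octi) blast
  obtain t where "t \<in> set ts" using assms(3) by (cases ts) auto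
  then have "interior (lat_tile t) \<subseteq> interior (octi s)" using sub by (intro interior_mono) (auto simp: lat_union_def)
  then show "interior (octi s) \<noteq> {}" using lat_tile_ne by blast
  obtain W H a b c d where s: "s = (W, H, a, b, c, d)" by (cases s)
  note ok = area8_octuple_oct_ok[OF assms(1)[unfolded s]]
  have "2 * W * H - (a * a + b * b + c * c + d * d) = 16" using assms(1) by (simp add: s area8_octuple_def)
  then have "real_of_int (2 * W * H - (a * a + b * b + c * c + d * d)) = real_of_int 16" by (simp only:)
  then have eq: "2 * (real_of_int W * real_of_int H) - (real_of_int a * real_of_int a + real_of_int b * real_of_int b
      + real_of_int c * real_of_int c + real_of_int d * real_of_int d) = 16" by (simp add: mult.assoc)
  have half: "x - y / 2 = 8" if "2 * x - y = 16" for x y :: real using that by (simp add: field_simps)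
  have "measure lebesgue (octi s) = 8"
    unfolding s octi.simps measure_oct[OF ok] power2_eq_square by (rule half[OF eq])
  then show "measure lebesgue (lat_union ts) = measure lebesgue (octi s)"
    using lat_union_measure[OF assms(2)] assms(3) by simp
qed (auto simp: compact_lat_union compact_octi convex_octi)

text \<open>The common part of the two interiors is open and covered by finitely many null sets,
  hence empty.\<close>

lemma interior_Un_Int:
  assumes "finite A" "finite B" "\<And>s t. s \<in> A \<Longrightarrow> t \<in> B \<Longrightarrow> negligible (f s \<inter> f t)"
  shows "interior (\<Union>(f ` A)) \<inter> interior (\<Union>(f ` B)) = {}"
proof -
  have "negligible (\<Union>((\<lambda>(s, t). f s \<inter> f t) ` (A \<times> B)))"
    using assms by (intro negligible_Union) auto
  moreover have "interior (\<Union>(f ` A)) \<inter> interior (\<Union>(f ` B)) \<subseteq> \<Union>((\<lambda>(s, t). f s \<inter> f t) ` (A \<times> B))"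
  proof
    fix z assume "z \<in> interior (\<Union>(f ` A)) \<inter> interior (\<Union>(f ` B))"
    then have "z \<in> \<Union>(f ` A)" "z \<in> \<Union>(f ` B)" using interior_subset by blast+
    then obtain s t where "s \<in> A" "z \<in> f s" "t \<in> B" "z \<in> f t" by auto
    then show "z \<in> \<Union>((\<lambda>(s, t). f s \<inter> f t) ` (A \<times> B))" by (intro UN_I[of "(s, t)"]) auto
  qed
  ultimately have "negligible (interior (\<Union>(f ` A)) \<inter> interior (\<Union>(f ` B)))"
    by (rule negligible_subset)
  moreover have "open (interior (\<Union>(f ` A)) \<inter> interior (\<Union>(f ` B)))" by (intro open_Int open_interior)
  ultimately show ?thesis using open_not_negligible by metis
qed

lemma lat_union_map: "lat_iso g ` lat_union ts = lat_union (map (lat_map g) ts)"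
  by (simp add: lat_union_def image_UN lat_iso_tile)

lemma lat_union_concat: "lat_union (concat tss) = (\<Union>ts\<in>set tss. lat_union ts)"
  by (auto simp: lat_union_def)

lemma sorted_wrt_concat:
  assumes "sorted_wrt R (concat tss)" "i < j" "j < length tss" "x \<in> set (tss ! i)" "y \<in> set (tss ! j)"
  shows "R x y"
  using assms
proof (induction tss arbitrary: i j)
  case (Cons ts tss)
  show ?case
  proof (cases i)
    case 0
    then have "x \<in> set ts" "y \<in> set (concat tss)" using Cons.prems by (auto simp: nth_Cons split: nat.splits)
    then show ?thesis using Cons.prems(1) by (auto simp: sorted_wrt_append)
  next
    case (Suc i')
    then show ?thesis using Cons.prems Cons.IH[of i' "j - 1"] by (auto simp: sorted_wrt_append nth_Cons split: nat.splits)
  qed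
qed simp

text \<open>With all placed tiles in one list, a single pairwise check covers overlaps within pieces
  and between pieces.\<close>

definition lat_place :: "ltile list list \<Rightarrow> placement list \<Rightarrow> ltile list" where
  "lat_place ps gs = concat (map2 (\<lambda>g p. map (lat_map g) p) gs ps)"

definition forms_check :: "ltile list list \<Rightarrow> octuple \<Rightarrow> placement list \<Rightarrow> bool" where
  "forms_check ps s gs \<longleftrightarrow> area8_octuple s \<and> length gs = length ps \<and> length (lat_place ps gs) = 16 \<and>
     list_all (tile_in_octi s) (lat_place ps gs) \<and> sorted_wrt lat_apart (lat_place ps gs)"

lemma forms_check_sound:
  assumes "forms_check ps s gs"
  shows "can_form (length ps) (\<lambda>i. lat_union (ps ! i)) (octi s)"
  unfolding can_form_def
proof (intro exI[of _ "\<lambda>i. lat_iso (gs ! i)"] conjI allI impI)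
  have len: "length gs = length ps" and srt: "sorted_wrt lat_apart (lat_place ps gs)"
    using assms by (simp_all add: forms_check_def)
  let ?q = "\<lambda>i. map (lat_map (gs ! i)) (ps ! i)"
  have img: "lat_iso (gs ! i) ` lat_union (ps ! i) = lat_union (?q i)" for i by (rule lat_union_map)
  have less: "interior (lat_union (?q i)) \<inter> interior (lat_union (?q j)) = {}" if "i < j" "j < length ps" for i j
    unfolding lat_union_def
  proof (rule interior_Un_Int)
    fix a b assume "a \<in> set (?q i)" "b \<in> set (?q j)"
    then show "negligible (lat_tile a \<inter> lat_tile b)"
      using sorted_wrt_concat[OF srt[unfolded lat_place_def], of i j a b] that len by (intro negligible_lat_Int) simp
  qed auto
  show "plane_isometry (lat_iso (gs ! i))" for i by (rule plane_isometry_lat_iso)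
  show "interior (lat_iso (gs ! i) ` lat_union (ps ! i)) \<inter> interior (lat_iso (gs ! j) ` lat_union (ps ! j)) = {}"
    if "i < length ps" "j < length ps" "i \<noteq> j" for i j
    unfolding img using less[of i j] less[of j i] that by (metis Int_commute linorder_neqE_nat)
  have "(\<Union>i<length ps. lat_iso (gs ! i) ` lat_union (ps ! i)) = lat_union (lat_place ps gs)"
  proof -
    have "set (map2 (\<lambda>g p. map (lat_map g) p) gs ps) = ?q ` {..<length ps}"
      using len by (force simp: set_conv_nth image_iff)
    then show ?thesis unfolding img lat_place_def lat_union_concat by simp
  qed
  also have "\<dots> = octi s" using assms by (intro lat_union_octi) (auto simp: forms_check_def)
  finally show "(\<Union>i<length ps. lat_iso (gs ! i) ` lat_union (ps ! i)) = octi s" .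
qed

text \<open>With \<open>c' = - c\<close> the second tile is the first one after a half turn about
  the midpoint of a leg or of the hypotenuse, depending on \<open>v'\<close>. With
  \<open>v' = v\<close> both right angles are at the same point and the tiles share a leg.\<close>

lemma glued_tileI:
  assumes c: "cmod c = 1" and adj: "c' = - c \<and> v' \<in> {v + c, v + \<i> * c, v + c + \<i> * c} \<or> v' = v \<and> c' \<in> {\<i> * c, - \<i> * c}"
  shows "glued (tile v c) (tile v' c')"
proof -
  let ?f = "\<lambda>z. v + c * z" and ?g = "\<lambda>z. v' + c' * z"
  have c': "cmod c' = 1" using adj c by (auto simp: norm_mult)
  have iso: "plane_isometry ?f" "plane_isometry ?g" using c c' by (auto intro: plane_isometry_rot)
  have f: "?f ` closed_segment 0 1 = closed_segment v (v + c)" "?f ` closed_segment 0 \<i> = closed_segment v (v + \<i> * c)"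
    "?f ` closed_segment 1 \<i> = closed_segment (v + c) (v + \<i> * c)"
    unfolding isometry_segment[OF iso(1)] by (simp_all add: mult.commute)
  have g: "?g ` closed_segment 0 1 = closed_segment v' (v' + c')" "?g ` closed_segment 0 \<i> = closed_segment v' (v' + \<i> * c')"
    "?g ` closed_segment 1 \<i> = closed_segment (v' + c') (v' + \<i> * c')"
    unfolding isometry_segment[OF iso(2)] by (simp_all add: mult.commute)
  have "\<exists>e\<in>T0_edges. \<exists>e'\<in>T0_edges. ?f ` e = ?g ` e'"
    using adj
  proof (elim disjE conjE insertE emptyE)
    assume "c' = - c" "v' = v + c"
    then have "?f ` closed_segment 0 1 = ?g ` closed_segment 0 1" unfolding f g by (simp add: closed_segment_commute)
    then show ?thesis unfolding T0_edges_def by blast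
  next
    assume "c' = - c" "v' = v + \<i> * c"
    then have "?f ` closed_segment 0 \<i> = ?g ` closed_segment 0 \<i>" unfolding f g by (simp add: closed_segment_commute)
    then show ?thesis unfolding T0_edges_def by blast
  next
    assume "c' = - c" "v' = v + c + \<i> * c"
    then have "?f ` closed_segment 1 \<i> = ?g ` closed_segment 1 \<i>" unfolding f g by (simp add: closed_segment_commute)
    then show ?thesis unfolding T0_edges_def by blast
  next
    assume "v' = v" "c' = \<i> * c"
    then have "?f ` closed_segment 0 \<i> = ?g ` closed_segment 0 1" unfolding f g by simp
    then show ?thesis unfolding T0_edges_def by blast
  next
    assume "v' = v" "c' = - \<i> * c"
    then have "?f ` closed_segment 0 1 = ?g ` closed_segment 0 \<i>" unfolding f g by simp
    then show ?thesis unfolding T0_edges_def by blast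
  qed
  then show ?thesis using iso unfolding glued_def tile_def
    by (intro exI[of _ ?f] exI[of _ ?g] conjI refl)
qed

fun lat_adj :: "ltile \<Rightarrow> ltile \<Rightarrow> bool" where
  "lat_adj (x, y, k) (x', y', k') \<longleftrightarrow>
     (k' - k) mod 4 = 2 \<and> (x' - x, y' - y) \<in> set [turn k (1, 0), turn k (0, 1), turn k (1, 1)] \<or>
     x' = x \<and> y' = y \<and> ((k' - k) mod 4 = 1 \<or> (k' - k) mod 4 = 3)"

lemma glued_lat_adj:
  assumes "lat_adj s t"
  shows "glued (lat_tile s) (lat_tile t)"
proof -
  obtain x y k where s: "s = (x, y, k)" by (cases s)
  obtain x' y' k' where t: "t = (x', y', k')" by (cases t)
  have kk: "\<i> powi k' = \<i> powi (k' - k) * \<i> powi k" by (simp add: power_int_add[symmetric])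
  have g: "gauss (x', y') = gauss (x, y) + gauss (x' - x, y' - y)" by (simp add: gauss_def complex_eq_iff)
  have tg: "gauss (turn k (1, 0)) = \<i> powi k" "gauss (turn k (0, 1)) = \<i> * \<i> powi k" "gauss (turn k (1, 1)) = \<i> powi k + \<i> * \<i> powi k"
    unfolding gauss_turn by (simp_all add: gauss_def complex_eq_iff)
  show ?thesis unfolding s t lat_tile.simps
  proof (rule glued_tileI[OF cmod_ii_powi])
    consider "(k' - k) mod 4 = 2" "(x' - x, y' - y) \<in> {turn k (1, 0), turn k (0, 1), turn k (1, 1)}"
      | "x' = x" "y' = y" "(k' - k) mod 4 = 1 \<or> (k' - k) mod 4 = 3"
      using assms by (auto simp: s t)
    then show "\<i> powi k' = - (\<i> powi k) \<and> gauss (x', y') \<in> {gauss (x, y) + \<i> powi k, gauss (x, y) + \<i> * \<i> powi k, gauss (x, y) + \<i> powi k + \<i> * \<i> powi k}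
      \<or> gauss (x', y') = gauss (x, y) \<and> \<i> powi k' \<in> {\<i> * \<i> powi k, - \<i> * \<i> powi k}"
    proof cases
      case 1
      then have "\<i> powi k' = - (\<i> powi k)" unfolding kk ii_powi_mod4[of "k' - k"] by simp
      moreover have "gauss (x' - x, y' - y) \<in> {\<i> powi k, \<i> * \<i> powi k, \<i> powi k + \<i> * \<i> powi k}"
        using 1(2) tg by (metis insertE emptyE insertI1 insertI2)
      ultimately show ?thesis unfolding g by (auto simp: add.assoc)
    next
      case 2
      then have "\<i> powi k' \<in> {\<i> * \<i> powi k, - \<i> * \<i> powi k}" unfolding kk ii_powi_mod4[of "k' - k"] by auto
      then show ?thesis using 2 by simp
    qed
  qed
qed

lemma path_connected:
  assumes "successively (\<lambda>s t. glued (f s) (f t)) ts" "f ` set ts \<subseteq> A" "s \<in> set ts"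
  shows "(f (hd ts), f s) \<in> {(a, b). a \<in> A \<and> b \<in> A \<and> glued a b}\<^sup>*"
  using assms
proof (induction ts)
  case (Cons u us)
  show ?case
  proof (cases "s = u")
    case False
    then have s: "s \<in> set us" using Cons.prems by simp
    then have "us \<noteq> []" by auto
    then have "glued (f u) (f (hd us))" "successively (\<lambda>s t. glued (f s) (f t)) us"
      using Cons.prems(1) by (simp_all add: successively_Cons)
    moreover have "f u \<in> A" "f (hd us) \<in> A" using Cons.prems(2) \<open>us \<noteq> []\<close> by auto
    moreover have "(f (hd us), f s) \<in> {(a, b). a \<in> A \<and> b \<in> A \<and> glued a b}\<^sup>*"
      using Cons.IH[OF calculation(2) _ s] Cons.prems(2) by simp
    ultimately show ?thesis by (auto intro: converse_rtrancl_into_rtrancl)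
  qed simp
qed simp

text \<open>Consecutive tiles of the list are glued, which suffices for pieces that are strips of
  tiles: any two tiles are connected through the head of the list, because gluing is
  symmetric.\<close>

lemma composed_of_lat_union:
  assumes "ts \<noteq> []" "sorted_wrt lat_apart ts" "successively lat_adj ts"
  shows "composed_of (length ts) (lat_union ts)"
  unfolding composed_of_iff
proof (intro exI[of _ "lat_tile ` set ts"] conjI)
  have ap: "interior (lat_tile s) \<inter> interior (lat_tile t) = {}" if st: "s \<in> set ts" "t \<in> set ts" "s \<noteq> t" for s t
  proof -
    obtain i j where "i < length ts" "j < length ts" "s = ts ! i" "t = ts ! j" "i \<noteq> j"
      using st by (metis in_set_conv_nth)
    then show ?thesis using sorted_wrt_nth_cases[OF assms(2)] lat_apart_interior by (metis Int_commute)
  qed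
  show "tiles_of (lat_tile ` set ts) (lat_union ts)"
    unfolding tiles_of_def
  proof (intro conjI ballI impI)
    fix u v assume "u \<in> lat_tile ` set ts" "v \<in> lat_tile ` set ts" "u \<noteq> v"
    then obtain s t where "s \<in> set ts" "t \<in> set ts" "u = lat_tile s" "v = lat_tile t" "s \<noteq> t" by blast
    then show "interior u \<inter> interior v = {}" using ap by blast
  next
    fix u assume "u \<in> lat_tile ` set ts"
    then show "congruent T0 u" using congruent_lat_tile by blast
  qed (use assms(1) in \<open>simp_all add: lat_union_def\<close>)
  have inj: "inj_on lat_tile (set ts)"
    using ap lat_tile_ne by (metis (no_types, lifting) inf.idem inj_onI)
  have "distinct ts"
    unfolding distinct_conv_nth
  proof (intro allI impI)
    fix i j assume ij: "i < length ts" "j < length ts" "i \<noteq> j"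
    then show "ts ! i \<noteq> ts ! j"
      using sorted_wrt_nth_cases[OF assms(2) ij] lat_apart_interior[of "ts ! i" "ts ! j"] lat_apart_interior[of "ts ! j" "ts ! i"] lat_tile_ne[of "ts ! i"] by force
  qed
  then show "card (lat_tile ` set ts) = length ts" by (simp add: card_image[OF inj] distinct_card)
  have sucs: "successively (\<lambda>s t. glued (lat_tile s) (lat_tile t)) ts"
    using assms(3) by (rule successively_mono) (auto intro: glued_lat_adj)
  let ?R = "{(a, b). a \<in> lat_tile ` set ts \<and> b \<in> lat_tile ` set ts \<and> glued a b}"
  have "sym ?R" by (rule symI) (auto simp: glued_def; metis)
  then have sy: "sym (?R\<^sup>*)" by (rule sym_rtrancl)
  show "glue_connected (lat_tile ` set ts)"
    unfolding glue_connected_def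
  proof (intro ballI)
    fix s t assume "s \<in> lat_tile ` set ts" "t \<in> lat_tile ` set ts"
    then have "(lat_tile (hd ts), s) \<in> ?R\<^sup>*" "(lat_tile (hd ts), t) \<in> ?R\<^sup>*"
      using path_connected[OF sucs subset_refl] by auto
    then show "(s, t) \<in> ?R\<^sup>*" using symD[OF sy] by (meson rtrancl_trans)
  qed
qed

section \<open>Vertices\<close>

lemma extreme_points_isometry_image:
  assumes "plane_isometry f"
  shows "{x. x extreme_point_of (f ` S)} = f ` {x. x extreme_point_of S}"
proof -
  have inj: "inj f" by (rule plane_isometry_inj[OF assms])
  have seg: "f x \<in> open_segment (f a) (f b) \<longleftrightarrow> x \<in> open_segment a b" for x a b
    using isometry_segment[OF assms, of a b] inj unfolding open_segment_def
    by (auto simp: inj_image_mem_iff inj_eq simp flip: isometry_segment[OF assms])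
  show ?thesis
    unfolding extreme_point_of_def using inj by (auto simp: seg inj_image_mem_iff)
qed

text \<open>Stated through extreme points, it is visibly invariant under isometries; the even power
  keeps it integral for lattice polygons.\<close>

definition vertex_moment :: "complex set \<Rightarrow> real" where
  "vertex_moment P = (\<Sum>x | x extreme_point_of P. \<Sum>y | y extreme_point_of P. dist x y ^ 4)"

lemma vertex_moment_congruent:
  assumes "congruent P Q"
  shows "vertex_moment P = vertex_moment Q"
proof -
  obtain f where f: "plane_isometry f" "f ` P = Q" using assms by (auto simp: congruent_def)
  have inj: "inj_on f A" for A using plane_isometry_inj[OF f(1)] inj_on_subset by blast
  have "vertex_moment Q = (\<Sum>x | x extreme_point_of P. \<Sum>y | y extreme_point_of P. dist (f x) (f y) ^ 4)"
    unfolding vertex_moment_def f(2)[symmetric] extreme_points_isometry_image[OF f(1)]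
    by (simp add: sum.reindex[OF inj])
  also have "\<dots> = vertex_moment P" using f(1) by (simp add: vertex_moment_def plane_isometry_def)
  finally show ?thesis ..
qed

lemma extreme_point_if_unique_minimum:
  fixes x u :: complex
  assumes "x \<in> P" "\<And>y. y \<in> P \<Longrightarrow> u \<bullet> x \<le> u \<bullet> y \<and> (u \<bullet> y = u \<bullet> x \<longrightarrow> y = x)"
  shows "x extreme_point_of P"
  unfolding extreme_point_of_def
proof (intro conjI ballI notI)
  fix a b assume ab: "a \<in> P" "b \<in> P" "x \<in> open_segment a b"
  then obtain r where r: "0 < r" "r < 1" "x = (1 - r) *\<^sub>R a + r *\<^sub>R b" "a \<noteq> b" by (auto simp: in_segment)
  have "(1 - r) * (u \<bullet> a - u \<bullet> x) + r * (u \<bullet> b - u \<bullet> x) = 0"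
    by (simp add: r(3) inner_add_right algebra_simps)
  moreover have "0 \<le> (1 - r) * (u \<bullet> a - u \<bullet> x)" "0 \<le> r * (u \<bullet> b - u \<bullet> x)"
    using assms(2)[OF ab(1)] assms(2)[OF ab(2)] r by auto
  ultimately have "(1 - r) * (u \<bullet> a - u \<bullet> x) = 0" "r * (u \<bullet> b - u \<bullet> x) = 0" by linarith+
  then have "u \<bullet> a = u \<bullet> x" "u \<bullet> b = u \<bullet> x" using r by simp_all
  then show False using assms(2) ab r(4) by metis
qed (rule assms(1))

lemma not_extreme_point:
  fixes x u :: complex
  assumes "x + u \<in> P" "x - u \<in> P" "u \<noteq> 0"
  shows "\<not> x extreme_point_of P"
proof
  assume "x extreme_point_of P"
  moreover have "x \<in> open_segment (x - u) (x + u)"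
    unfolding in_segment
  proof (intro conjI exI[of _ "1/2"])
    show "x - u \<noteq> x + u" using assms(3) by (simp add: complex_eq_iff)
    show "x = (1 - 1 / 2) *\<^sub>R (x - u) + (1 / 2) *\<^sub>R (x + u)" by (simp add: complex_eq_iff field_simps)
  qed simp_all
  ultimately show False using assms by (auto simp: extreme_point_of_def)
qed

text \<open>Each listed point is the unique minimum of a linear form with coefficients
  \<open>1\<close> and \<open>2\<close> up to sign, whose gradient lies strictly between the inward
  normals of the side and the cut that meet there. Any other point can be moved both ways along its
  side, along its cut, or horizontally.\<close>

lemma extreme_points_oct:
  assumes "oct_ok W H a b c d"
  shows "{x. x extreme_point_of oct W H a b c d} =
    {Complex a 0, Complex (W - b) 0, Complex W b, Complex W (H - c), Complex (W - c) H, Complex d H, Complex 0 (H - d), Complex 0 a}"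
    (is "?E = ?V")
proof (intro subset_antisym subsetI)
  note ok = assms[unfolded oct_ok_def]
  have min: "x extreme_point_of oct W H a b c d"
    if "x \<in> oct W H a b c d"
       "\<And>y. y \<in> oct W H a b c d \<Longrightarrow> p * Re x + q * Im x \<le> p * Re y + q * Im y \<and> (p * Re y + q * Im y = p * Re x + q * Im x \<longrightarrow> Re y = Re x \<and> Im y = Im x)"
    for x p q
    by (rule extreme_point_if_unique_minimum[of _ _ "Complex p q"]) (use that in \<open>auto simp: inner_complex_def complex_eq_iff\<close>)
  fix x assume "x \<in> ?V"
  then have "x extreme_point_of oct W H a b c d"
  proof (elim insertE emptyE)
    assume "x = Complex a 0" then show ?thesis by (intro min[of _ 1 2]) (use ok in \<open>auto simp: oct_def\<close>)
  next
    assume "x = Complex (W - b) 0" then show ?thesis by (intro min[of _ "-1" 2]) (use ok in \<open>auto simp: oct_def\<close>)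
  next
    assume "x = Complex W b" then show ?thesis by (intro min[of _ "-2" 1]) (use ok in \<open>auto simp: oct_def\<close>)
  next
    assume "x = Complex W (H - c)" then show ?thesis by (intro min[of _ "-2" "-1"]) (use ok in \<open>auto simp: oct_def\<close>)
  next
    assume "x = Complex (W - c) H" then show ?thesis by (intro min[of _ "-1" "-2"]) (use ok in \<open>auto simp: oct_def\<close>)
  next
    assume "x = Complex d H" then show ?thesis by (intro min[of _ 1 "-2"]) (use ok in \<open>auto simp: oct_def\<close>)
  next
    assume "x = Complex 0 (H - d)" then show ?thesis by (intro min[of _ 2 "-1"]) (use ok in \<open>auto simp: oct_def\<close>)
  next
    assume "x = Complex 0 a" then show ?thesis by (intro min[of _ 2 1]) (use ok in \<open>auto simp: oct_def\<close>)
  qed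
  then show "x \<in> ?E" by simp
next
  note ok = assms[unfolded oct_ok_def]
  fix x assume "x \<in> ?E"
  then have ex: "x extreme_point_of oct W H a b c d" by simp
  then have m: "x \<in> oct W H a b c d" by (simp add: extreme_point_of_def)
  have move: "r = 0" if "x + of_real r * u \<in> oct W H a b c d" "x - of_real r * u \<in> oct W H a b c d" "u \<noteq> 0" for r u
    using not_extreme_point[OF that(1,2)] ex that(3) by auto
  show "x \<in> ?V"
  proof (rule ccontr)
    assume nv: "x \<notin> ?V"
    define p q where "p = Re x" and "q = Im x"
    have x: "x = Complex p q" by (simp add: p_def q_def)
    \<comment> \<open>\<open>A\<close> and \<open>B\<close> are the amounts of room on the two ends
      of the side or cut that contains \<open>x\<close>.\<close>
    have slide: False
      if "0 < A" "0 < B" "u \<noteq> 0" "\<And>e. 0 < e \<Longrightarrow> e \<le> A \<Longrightarrow> e \<le> B \<Longrightarrow>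
        x + of_real e * u \<in> oct W H a b c d \<and> x - of_real e * u \<in> oct W H a b c d" for A B u
      using that(4)[of "min A B"] move[of "min A B" u] that(1-3) by (auto simp: min_def split: if_splits)
    note in_oct = m[unfolded x oct_def mem_Collect_eq complex.sel]
    note nv' = nv[unfolded x insert_iff complex.inject empty_iff]
    have q0: "0 < q"
    proof (rule ccontr)
      assume "\<not> 0 < q"
      then have h: "q = 0" "a < p" "p < W - b" using in_oct nv' by auto
      show False by (rule slide[of "(p - a)" "(W - b - p)" "1"]) (use h ok in_oct in \<open>auto simp: x oct_def complex_eq_iff\<close>)
    qed
    have qH: "q < H"
    proof (rule ccontr)
      assume "\<not> q < H"
      then have h: "q = H" "d < p" "p < W - c" using in_oct nv' by auto
      show False by (rule slide[of "(p - d)" "(W - c - p)" "1"]) (use h ok in_oct in \<open>auto simp: x oct_def complex_eq_iff\<close>)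
    qed
    have p0: "0 < p"
    proof (rule ccontr)
      assume "\<not> 0 < p"
      then have h: "p = 0" "a < q" "q < H - d" using in_oct nv' by auto
      show False by (rule slide[of "(q - a)" "(H - d - q)" "\<i>"]) (use h ok in_oct in \<open>auto simp: x oct_def complex_eq_iff\<close>)
    qed
    have pW: "p < W"
    proof (rule ccontr)
      assume "\<not> p < W"
      then have h: "p = W" "b < q" "q < H - c" using in_oct nv' by auto
      show False by (rule slide[of "(q - b)" "(H - c - q)" "\<i>"]) (use h ok in_oct in \<open>auto simp: x oct_def complex_eq_iff\<close>)
    qed
    have s0: "a < p + q"
    proof (rule ccontr)
      assume "\<not> a < p + q"
      then have h: "p + q = a" using in_oct by auto
      show False by (rule slide[of "p" "q" "Complex 1 (- 1)"]) (use h ok in_oct p0 q0 in \<open>auto simp: x oct_def complex_eq_iff\<close>)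
    qed
    have s1: "p - q < W - b"
    proof (rule ccontr)
      assume "\<not> p - q < W - b"
      then have h: "p - q = W - b" using in_oct by auto
      show False by (rule slide[of "(W - p)" "q" "Complex 1 1"]) (use h ok in_oct pW q0 in \<open>auto simp: x oct_def complex_eq_iff\<close>)
    qed
    have s2: "p + q < W + H - c"
    proof (rule ccontr)
      assume "\<not> p + q < W + H - c"
      then have h: "p + q = W + H - c" using in_oct by auto
      show False by (rule slide[of "(W - p)" "(H - q)" "Complex 1 (- 1)"]) (use h ok in_oct pW qH in \<open>auto simp: x oct_def complex_eq_iff\<close>)
    qed
    have s3: "q - p < H - d"
    proof (rule ccontr)
      assume "\<not> q - p < H - d"
      then have h: "q - p = H - d" using in_oct by auto
      show False by (rule slide[of "p" "(H - q)" "Complex 1 1"]) (use h ok in_oct p0 qH in \<open>auto simp: x oct_def complex_eq_iff\<close>)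
    qed
    \<comment> \<open>A horizontal move leaves \<open>q\<close> unchanged; \<open>M\<close> collects
      the slacks of the six other inequalities, all positive by now.\<close>
    define M where "M = {p, W - p, p + q - a, W - b - (p - q), W + H - c - (p + q), H - d - (q - p)}"
    have M: "finite M" "M \<noteq> {}" by (simp_all add: M_def)
    have "\<forall>k\<in>M. 0 < k" unfolding M_def using p0 pW s0 s1 s2 s3 by simp
    then have "0 < Min M" using M by simp
    moreover have "\<forall>k\<in>M. Min M \<le> k" using M by simp
    ultimately obtain e where e0: "0 < e" and "\<forall>k\<in>M. e \<le> k" by blast
    then have e: "e \<le> p" "e \<le> W - p" "e \<le> p + q - a" "e \<le> W - b - (p - q)" "e \<le> W + H - c - (p + q)" "e \<le> H - d - (q - p)"
      unfolding M_def by simp_all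
    show False using move[of e 1] e0 e in_oct by (simp add: x oct_def)
  qed
qed

text \<open>Neighbouring corners coincide when a side or a cut has length zero, and the moment must
  count each vertex once.\<close>

fun octi_vertices :: "octuple \<Rightarrow> (int \<times> int) list" where
  "octi_vertices (W, H, a, b, c, d) =
     remdups [(a, 0), (W - b, 0), (W, b), (W, H - c), (W - c, H), (d, H), (0, H - d), (0, a)]"

definition octi_moment :: "octuple \<Rightarrow> int" where
  "octi_moment s = (let vs = octi_vertices s in
     sum_list (map (\<lambda>(x, y). sum_list (map (\<lambda>(u, v). ((x - u) * (x - u) + (y - v) * (y - v)) * ((x - u) * (x - u) + (y - v) * (y - v))) vs)) vs))"

lemma vertex_moment_octi:
  assumes "area8_octuple s"
  shows "vertex_moment (octi s) = of_int (octi_moment s)"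
proof -
  obtain W H a b c d where s: "s = (W, H, a, b, c, d)" by (cases s)
  note ok = area8_octuple_oct_ok[OF assms[unfolded s]]
  define vs where "vs = octi_vertices s"
  have dv: "distinct vs" by (simp only: vs_def s octi_vertices.simps distinct_remdups)
  have ext: "{x. x extreme_point_of octi s} = gauss ` set vs"
    unfolding s octi.simps extreme_points_oct[OF ok] vs_def octi_vertices.simps set_remdups
    by (simp add: gauss_def)
  have inj: "inj_on gauss A" for A by (auto simp: inj_on_def gauss_def)
  have d4: "dist (gauss p) (gauss q) ^ 4 = of_int (case p of (x, y) \<Rightarrow> case q of (u, v) \<Rightarrow>
      ((x - u) * (x - u) + (y - v) * (y - v)) * ((x - u) * (x - u) + (y - v) * (y - v)))" for p q
  proof -
    have "dist (gauss p) (gauss q) ^ 4 = ((dist (gauss p) (gauss q))\<^sup>2)\<^sup>2" by (simp flip: power_mult)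
    also have "(dist (gauss p) (gauss q))\<^sup>2 = of_int ((fst p - fst q) * (fst p - fst q) + (snd p - snd q) * (snd p - snd q))"
      unfolding dist_norm cmod_power2 by (simp add: gauss_def power2_eq_square)
    finally show ?thesis by (simp add: power2_eq_square split_beta)
  qed
  have "vertex_moment (octi s) = (\<Sum>p\<in>set vs. \<Sum>q\<in>set vs. dist (gauss p) (gauss q) ^ 4)"
    unfolding vertex_moment_def ext by (simp add: sum.reindex[OF inj])
  also have "\<dots> = of_int (octi_moment s)"
    unfolding d4 octi_moment_def Let_def vs_def[symmetric]
    by (simp add: sum.distinct_set_conv_list[OF dv, symmetric] split_beta)
  finally show ?thesis .
qed

section \<open>A puzzle forming nineteen convex polygons\<close>

text \<open>Two single tiles, two right triangles with hypotenuse \<open>2\<close>, two right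
  trapezoids of three tiles with parallel sides \<open>1\<close> and \<open>2\<close>, and a
  parallelogram with sides \<open>2\<close> and \<open>sqrt 2\<close>. The tiles of each piece are
  listed as a strip.\<close>

definition puzzle :: "ltile list list" where
  "puzzle = [[(0,1,3)], [(0,1,3)], [(1,0,1), (1,0,0)], [(1,0,1), (1,0,0)], [(0,1,3), (1,0,1), (1,1,3)],
     [(0,1,3), (1,0,1), (1,1,3)], [(1,0,1), (1,1,3), (2,0,1), (2,1,3)]]"

text \<open>Each row belongs to the entry of \<open>formed_shapes\<close> in the same position and
  lists one motion for each piece of \<open>puzzle\<close>.\<close>

definition puzzle_placements :: "placement list list" where
  "puzzle_placements = [
     [(8,0,2,True), (5,1,0,True), (8,0,2,True), (5,1,0,True), (5,0,2,True), (0,1,0,True), (4,0,2,True)],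
     [(2,3,0,True), (2,1,0,True), (3,2,3,True), (1,2,0,True), (2,0,1,False), (2,2,2,True), (0,3,3,False)],
     [(3,3,3,True), (2,1,2,True), (3,3,3,True), (2,0,1,True), (2,0,1,False), (2,2,2,True), (0,3,3,False)],
     [(3,1,1,True), (3,0,1,True), (2,2,0,True), (2,1,0,True), (1,1,0,True), (1,0,1,False), (3,1,2,True)],
     [(3,0,1,True), (2,2,2,True), (3,0,1,True), (2,1,1,True), (2,0,1,True), (0,3,3,False), (1,3,3,False)],
     [(4,2,2,True), (3,3,0,True), (2,2,0,True), (2,0,1,True), (3,2,2,True), (0,3,3,False), (1,3,3,False)],
     [(3,3,0,True), (4,2,3,True), (3,3,2,True), (1,1,0,True), (2,3,3,False), (2,3,2,False), (3,1,2,True)],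
     [(4,0,2,True), (3,3,0,True), (4,4,3,True), (2,4,0,True), (4,1,2,True), (3,2,2,True), (3,3,2,True)],
     [(4,1,2,True), (3,0,1,True), (4,0,1,True), (3,0,1,True), (2,2,3,False), (2,2,2,False), (3,0,2,True)],
     [(5,2,3,True), (4,1,3,True), (5,2,3,True), (5,0,2,True), (4,1,2,True), (3,0,2,True), (3,1,2,True)],
     [(5,1,3,True), (3,2,2,True), (5,1,2,True), (3,1,1,True), (4,0,2,True), (3,1,2,True), (3,2,2,True)],
     [(4,3,0,True), (3,2,0,True), (3,2,0,True), (2,1,0,True), (4,2,2,True), (3,1,2,True), (3,2,2,True)],
     [(4,2,0,True), (3,3,0,True), (3,1,0,True), (2,4,2,True), (4,1,2,True), (3,2,2,True), (3,3,2,True)],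
     [(4,3,0,True), (3,4,0,True), (5,2,3,True), (3,2,0,True), (4,2,2,True), (3,3,2,True), (3,4,2,True)],
     [(4,2,0,True), (3,1,0,True), (6,0,2,True), (3,1,0,True), (4,1,2,True), (3,0,2,True), (3,1,2,True)],
     [(4,2,0,True), (3,1,0,True), (4,2,0,True), (3,1,0,True), (4,1,2,True), (3,0,2,True), (3,1,2,True)],
     [(4,2,0,True), (3,3,0,True), (6,0,2,True), (3,1,0,True), (4,1,2,True), (3,2,2,True), (3,3,2,True)],
     [(8,1,0,True), (8,0,2,True), (8,0,2,True), (5,1,0,True), (4,1,0,True), (4,0,2,True), (3,0,2,True)],
     [(9,1,3,True), (8,0,2,True), (8,0,2,True), (5,1,0,True), (4,1,0,True), (4,0,2,True), (3,0,2,True)]]"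

lemma puzzle_check: "list_all2 (forms_check puzzle) formed_shapes puzzle_placements"
  by code_simp

lemma puzzle_pieces_check:
  "list_all (\<lambda>ts. ts \<noteq> [] \<and> sorted_wrt lat_apart ts \<and> successively lat_adj ts) puzzle"
  by code_simp

lemma moments_distinct: "distinct (map octi_moment formed_shapes)"
  by code_simp

lemma puzzle_composed: "composed_from_sixteen 7 (\<lambda>i. lat_union (puzzle ! i))"
  unfolding composed_from_sixteen_def
proof (intro exI[of _ "\<lambda>i. length (puzzle ! i)"] conjI allI impI)
  show "composed_of (length (puzzle ! i)) (lat_union (puzzle ! i))" if "i < 7" for i
  proof (rule composed_of_lat_union)
    have "puzzle ! i \<in> set puzzle" using that by (intro nth_mem) (simp add: puzzle_def)
    then show "puzzle ! i \<noteq> []" "sorted_wrt lat_apart (puzzle ! i)" "successively lat_adj (puzzle ! i)"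
      using puzzle_pieces_check unfolding list_all_iff by blast+
  qed
  show "(\<Sum>i<7. length (puzzle ! i)) = 16" by (simp add: puzzle_def eval_nat_numeral)
qed

lemma puzzle_forms_nineteen: "forms_convex 7 (\<lambda>i. lat_union (puzzle ! i)) 19"
  unfolding forms_convex_def
proof (intro exI[of _ "\<lambda>j. octi (formed_shapes ! j)"] conjI allI impI)
  have len: "length formed_shapes = 19" "length puzzle = 7" by (simp_all add: formed_shapes_def puzzle_def)
  have ck: "forms_check puzzle (formed_shapes ! j) (puzzle_placements ! j)" if "j < 19" for j
    using list_all2_nthD[OF puzzle_check] that len by simp
  show "convex (octi (formed_shapes ! j))" for j by (rule convex_octi)
  show "can_form 7 (\<lambda>i. lat_union (puzzle ! i)) (octi (formed_shapes ! j))" if "j < 19" for j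
    using forms_check_sound[OF ck[OF that]] len by simp
  show "\<not> congruent (octi (formed_shapes ! i)) (octi (formed_shapes ! j))" if "i < 19" "j < 19" "i \<noteq> j" for i j
  proof
    assume "congruent (octi (formed_shapes ! i)) (octi (formed_shapes ! j))"
    then have "vertex_moment (octi (formed_shapes ! i)) = vertex_moment (octi (formed_shapes ! j))"
      by (rule vertex_moment_congruent)
    moreover have "area8_octuple (formed_shapes ! i)" "area8_octuple (formed_shapes ! j)" using ck that by (simp_all add: forms_check_def)
    ultimately have "octi_moment (formed_shapes ! i) = octi_moment (formed_shapes ! j)"
      by (simp add: vertex_moment_octi)
    then show False using moments_distinct that len by (simp add: distinct_conv_nth)
  qed
qed

theorem theorem2:
  shows "(\<exists>S. composed_from_sixteen 7 S \<and> forms_convex 7 S 19) \<and>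
         (\<forall>S. composed_from_sixteen 7 S \<longrightarrow> \<not> forms_convex 7 S 20)"
  using puzzle_composed puzzle_forms_nineteen not_forms_twenty by blast

end
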